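(* Let $\mathcal F$ be a minor-closed family of finite graphs which does not contain all finite graphs. Then there is a constant $c_{\mathcal F}>0$ such that for every $G\in\mathcal F$ with $n$ vertices and maximum degree $d_{\max}$, and every $1\le k\le n$, $$\lambda_k(G) \le c_{\mathcal F}\, d_{\max}\,\frac{k}{n},$$ where $\lambda_k(G)$ is the $k$-th smallest eigenvalue of the Laplacian of $G$.
   Context: For a finite undirected graph $G=(V,E)$ the Laplacian is $\mathcal L=D-A$ ($A$ adjacency matrix, $D$ diagonal degree matrix); eigenvalues are counted with multiplicity in nondecreasing order, $\lambda_1(G)\le\lambda_2(G)\le\cdots$. A graph $H$ is a minor of $G$ if it can be obtained from $G$ by a sequence of edge contractions and vertex deletions; a family $\mathcal F$ is minor-closed if $G\in\mathcal F$ and $H$ a minor of $G$ imply $H\in\mathcal F$.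
   Formalization: Minors here also allow edge deletions (and isomorphic copies): with only edge contractions and vertex deletions the claim is false, since complete graphs form such a closed family but λ_2(K_n)=n exceeds c·(n−1)·2/n for large n. *)

theory Defs
  imports "Jordan_Normal_Form.Char_Poly"
begin

type_synonym graph = "nat set \<times> nat set set"

definition verts :: "graph \<Rightarrow> nat set" where "verts G = fst G"
definition edges :: "graph \<Rightarrow> nat set set" where "edges G = snd G"

definition graph :: "graph \<Rightarrow> bool" where
  "graph G \<longleftrightarrow> finite (verts G) \<and>
     (\<forall>e\<in>edges G. \<exists>u v. u \<in> verts G \<and> v \<in> verts G \<and> u \<noteq> v \<and> e = {u, v})"

definition degree :: "graph \<Rightarrow> nat \<Rightarrow> nat" where
  "degree G v = card {e \<in> edges G. v \<in> e}"

definition max_degree :: "graph \<Rightarrow> nat" where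
  "max_degree G = Max (degree G ` verts G)"

definition delete_vertex :: "graph \<Rightarrow> nat \<Rightarrow> graph" where
  "delete_vertex G v = (verts G - {v}, {e \<in> edges G. v \<notin> e})"

definition delete_edge :: "graph \<Rightarrow> nat set \<Rightarrow> graph" where
  "delete_edge G e = (verts G, edges G - {e})"

definition contract_edge :: "graph \<Rightarrow> nat \<Rightarrow> nat \<Rightarrow> graph" where
  "contract_edge G u v =
     (verts G - {v},
      {e'. \<exists>e\<in>edges G. e' = (\<lambda>x. if x = v then u else x) ` e \<and> card e' = 2})"

definition graph_iso :: "graph \<Rightarrow> graph \<Rightarrow> bool" where
  "graph_iso G H \<longleftrightarrow> (\<exists>f. bij_betw f (verts G) (verts H) \<and>
      (\<forall>u\<in>verts G. \<forall>v\<in>verts G. {u, v} \<in> edges G \<longleftrightarrow> {f u, f v} \<in> edges H))"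

inductive minor :: "graph \<Rightarrow> graph \<Rightarrow> bool" where
  iso: "graph H \<Longrightarrow> graph G \<Longrightarrow> graph_iso H G \<Longrightarrow> minor H G"
| del_v: "minor H (delete_vertex G v) \<Longrightarrow> v \<in> verts G \<Longrightarrow> minor H G"
| del_e: "minor H (delete_edge G e) \<Longrightarrow> e \<in> edges G \<Longrightarrow> minor H G"
| contr: "minor H (contract_edge G u v) \<Longrightarrow> {u, v} \<in> edges G \<Longrightarrow> u \<noteq> v \<Longrightarrow> minor H G"

definition minor_closed :: "graph set \<Rightarrow> bool" where
  "minor_closed F \<longleftrightarrow> (\<forall>G H. G \<in> F \<longrightarrow> minor H G \<longrightarrow> H \<in> F)"

definition laplacian :: "graph \<Rightarrow> real mat" where
  "laplacian G = (let vs = sorted_list_of_set (verts G); n = length vs in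
     mat n n (\<lambda>(i, j). if i = j then real (degree G (vs ! i))
                       else if {vs ! i, vs ! j} \<in> edges G then -1 else 0))"

definition lap_eigenvalues :: "graph \<Rightarrow> real list" where
  "lap_eigenvalues G = (THE xs. sorted xs \<and>
      char_poly (laplacian G) = prod_list (map (\<lambda>x. [:- x, 1:]) xs))"

definition lap_eig :: "graph \<Rightarrow> nat \<Rightarrow> real" where
  "lap_eig G k = lap_eigenvalues G ! (k - 1)"

end

theory Submission
  imports Defs "Jordan_Normal_Form.Spectral_Radius"
begin

text \<open>If the family omits a graph with \<open>h\<close> vertices, no member contains \<open>h\<close> disjoint connected pairwise
  adjacent vertex sets (a \<open>K\<^sub>h\<close> model). Let \<open>r\<close> be about \<open>n / 4 k\<close>. Consider random sets of \<open>r\<close> vertices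
  together with a routing of all their pairs, and let \<open>c v\<close> be the resulting expected congestion. Sampling
  vertices and routed pairs as in the proof of the crossing number inequality yields
  \<open>\<Sum> (c v)\<^sup>2 \<ge> const * r / n\<close>, because linearly many edges that do not cross already force a \<open>K\<^sub>h\<close> model
  (Mader). A nearly norm-minimal congestion vector is, up to scaling, a vertex weight \<open>\<omega>\<close> with
  \<open>\<Sum> (\<omega> v)\<^sup>2 \<le> const * n / r\<close> such that every connected set of \<open>r\<close> vertices contains two points at
  \<open>\<omega>\<close>-distance at least 1. Cutting the graph \<open>h - 1\<close> times into distance layers of small constant width
  (Klein, Plotkin, Rao) therefore leaves pieces with fewer than \<open>r\<close> vertices, and the distance to the cuts,
  restricted to the single pieces, gives disjointly supported test functions of total energy at most
  \<open>const * max_degree G * n / r\<close> and total mass at least \<open>n / 2\<close>. At least \<open>k\<close> of them have Rayleigh quotient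
  \<open>O(max_degree G / r)\<close>, and the min-max principle applies.\<close>

section \<open>Connected vertex sets and clique models\<close>

text \<open>Routing all pairs of vertices would only make the graph as a whole spread out, which is
  enough for one cut and the second eigenvalue. For \<open>k\<close> disjoint test functions,
  spreading is needed inside every large connected set; the adversary in the duality may therefore
  use any family of \<open>r\<close>-sets with any routings. Such a family can concentrate on few
  vertices, and this forces vertex-dependent sampling probabilities. Congestion is measured by its
  sum of squares because this norm is dual to the sum of squares of the weight, and a function that
  is Lipschitz for vertex weights has energy at most a constant times \<open>max_degree G\<close>
  times that sum. The order \<open>n / 4 k\<close> of \<open>r\<close> comes from a count: of the
  mass \<open>n / 2\<close>, at most \<open>n / 4\<close> is lost to functions with a large Rayleigh
  quotient, and each remaining function has mass at most \<open>r\<close>. When this value of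
  \<open>r\<close> falls below a constant of the family, \<open>k / n\<close> is bounded below and
  the bound \<open>2 * max_degree G\<close> suffices.\<close>

definition conn :: "('a \<times> 'a) set \<Rightarrow> 'a set \<Rightarrow> bool" where
  "conn E S \<longleftrightarrow> (\<forall>x\<in>S. \<forall>y\<in>S. (x, y) \<in> (E \<inter> S \<times> S)\<^sup>*)"

definition component :: "('a \<times> 'a) set \<Rightarrow> 'a set \<Rightarrow> 'a \<Rightarrow> 'a set" where
  "component E S x = {y. (x, y) \<in> (E \<inter> S \<times> S)\<^sup>*}"

text \<open>\<open>B 0, \<dots>, B (h - 1)\<close> are the branch sets of a \<open>K\<^sub>h\<close> minor.\<close>

definition kmodel :: "('a \<times> 'a) set \<Rightarrow> 'a set \<Rightarrow> (nat \<Rightarrow> 'a set) \<Rightarrow> nat \<Rightarrow> bool" where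
  "kmodel E V B h \<longleftrightarrow>
     (\<forall>i<h. B i \<noteq> {} \<and> B i \<subseteq> V \<and> conn E (B i)) \<and>
     (\<forall>i<h. \<forall>j<h. i \<noteq> j \<longrightarrow> B i \<inter> B j = {} \<and> (\<exists>x\<in>B i. \<exists>y\<in>B j. (x, y) \<in> E))"

lemma conn_singleton [simp]: "conn E {x}"
  by (simp add: conn_def)

lemma conn_empty [simp]: "conn E {}"
  by (simp add: conn_def)

lemma sym_restrict: "sym E \<Longrightarrow> sym (E \<inter> S \<times> S)"
  by (auto simp: sym_def)

lemma conn_from:
  assumes "sym E" and "\<And>y. y \<in> S \<Longrightarrow> (x, y) \<in> (E \<inter> S \<times> S)\<^sup>*"
  shows "conn E S"
  unfolding conn_def
proof (intro ballI)
  fix u v assume "u \<in> S" "v \<in> S"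
  with assms(2) have "(x, u) \<in> (E \<inter> S \<times> S)\<^sup>*" "(x, v) \<in> (E \<inter> S \<times> S)\<^sup>*" by auto
  moreover have "sym ((E \<inter> S \<times> S)\<^sup>*)" by (intro sym_rtrancl sym_restrict assms)
  ultimately show "(u, v) \<in> (E \<inter> S \<times> S)\<^sup>*" by (meson symE rtrancl_trans)
qed

lemma conn_crossing:
  assumes "conn E S" "x \<in> S" "x \<in> A" "y \<in> S" "y \<notin> A"
  obtains u v where "u \<in> S" "u \<in> A" "v \<in> S" "v \<notin> A" "(u, v) \<in> E"
proof -
  have "(x, y) \<in> (E \<inter> S \<times> S)\<^sup>*" using assms by (auto simp: conn_def)
  then have "y \<in> A \<or> (\<exists>u v. u \<in> S \<and> u \<in> A \<and> v \<in> S \<and> v \<notin> A \<and> (u, v) \<in> E)"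
    by (induction rule: rtrancl_induct) (use assms in blast)+
  then show ?thesis using assms that by blast
qed

text \<open>Takes the place of explicit paths. For a union of connected sets, a cut without crossing
  edges must contain or avoid each member, and overlaps propagate this choice to the whole
  union.\<close>

lemma conn_cutI:
  assumes "sym E"
    and cut: "\<And>A. A \<subseteq> S \<Longrightarrow> A \<noteq> {} \<Longrightarrow> A \<noteq> S \<Longrightarrow> \<exists>u\<in>A. \<exists>v\<in>S - A. (u, v) \<in> E"
  shows "conn E S"
proof (cases "S = {}")
  case False
  then obtain x where x: "x \<in> S" by blast
  define A where "A = {y \<in> S. (x, y) \<in> (E \<inter> S \<times> S)\<^sup>*}"
  have "A = S"
  proof (rule ccontr)
    assume "A \<noteq> S"
    moreover have "A \<noteq> {}" "A \<subseteq> S" using x by (auto simp: A_def)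
    ultimately have "\<exists>u\<in>A. \<exists>v\<in>S - A. (u, v) \<in> E" by (intro cut)
    then obtain u v where uv: "u \<in> A" "v \<in> S - A" "(u, v) \<in> E" by blast
    then have "(x, u) \<in> (E \<inter> S \<times> S)\<^sup>*" "(u, v) \<in> E \<inter> S \<times> S" by (auto simp: A_def)
    then have "(x, v) \<in> (E \<inter> S \<times> S)\<^sup>*" by (rule rtrancl_into_rtrancl)
    with uv show False by (auto simp: A_def)
  qed
  then show ?thesis by (intro conn_from[OF assms(1), of S x]) (auto simp: A_def)
qed simp

lemma conn_mono: "conn E S \<Longrightarrow> E \<inter> S \<times> S \<subseteq> F \<Longrightarrow> conn F S"
  unfolding conn_def by (meson rtrancl_mono Int_greatest Int_lower2 subsetD)

lemma conn_Un:
  assumes "sym E" "conn E S" "conn E T" "S \<inter> T \<noteq> {} \<or> (\<exists>s\<in>S. \<exists>t\<in>T. (s, t) \<in> E)"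
  shows "conn E (S \<union> T)"
proof (rule conn_cutI[OF assms(1)])
  fix A assume A: "A \<subseteq> S \<union> T" "A \<noteq> {}" "A \<noteq> S \<union> T"
  show "\<exists>u\<in>A. \<exists>v\<in>S \<union> T - A. (u, v) \<in> E"
  proof (rule ccontr)
    assume n: "\<not> ?thesis"
    have *: "U \<subseteq> A \<or> U \<inter> A = {}" if "U = S \<or> U = T" for U
    proof (rule ccontr)
      assume "\<not> ?thesis"
      then obtain x y where xy: "x \<in> U" "x \<in> A" "y \<in> U" "y \<notin> A" by blast
      have "conn E U" using that assms by auto
      from conn_crossing[OF this xy] n that show False by blast
    qed
    have "(t, s) \<in> E" if "(s, t) \<in> E" for s t using assms(1) that by (auto simp: sym_def)
    with *[of S] *[of T] A assms(4) n show False by blast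
  qed
qed

lemma conn_insert:
  assumes "sym E" "conn E S" "s \<in> S" "(s, x) \<in> E"
  shows "conn E (insert x S)"
  using conn_Un[OF assms(1,2), of "{x}"] assms by auto

lemma conn_Un_Union:
  assumes "sym E" "conn E S" "\<And>P. P \<in> \<F> \<Longrightarrow> conn E P \<and> P \<inter> S \<noteq> {}"
  shows "conn E (S \<union> \<Union>\<F>)"
proof (rule conn_cutI[OF assms(1)])
  fix A assume A: "A \<subseteq> S \<union> \<Union>\<F>" "A \<noteq> {}" "A \<noteq> S \<union> \<Union>\<F>"
  show "\<exists>u\<in>A. \<exists>v\<in>S \<union> \<Union>\<F> - A. (u, v) \<in> E"
  proof (rule ccontr)
    assume n: "\<not> ?thesis"
    have *: "U \<subseteq> A \<or> U \<inter> A = {}" if "U = S \<or> U \<in> \<F>" for U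
    proof (rule ccontr)
      assume "\<not> ?thesis"
      then obtain x y where xy: "x \<in> U" "x \<in> A" "y \<in> U" "y \<notin> A" by blast
      have "conn E U" using that assms by auto
      from conn_crossing[OF this xy] n that show False by blast
    qed
    have "S \<subseteq> A \<or> S \<inter> A = {}" using * by blast
    then show False
    proof
      assume "S \<subseteq> A"
      then have "P \<subseteq> A" if "P \<in> \<F>" for P using *[of P] assms(3)[OF that] that by blast
      with A \<open>S \<subseteq> A\<close> show False by blast
    next
      assume S: "S \<inter> A = {}"
      then have "P \<inter> A = {}" if "P \<in> \<F>" for P using *[of P] assms(3)[OF that] that by blast
      with A S show False by blast
    qed
  qed
qed

lemma component_subset: "x \<in> S \<Longrightarrow> component E S x \<subseteq> S"
proof
  fix y assume "x \<in> S" "y \<in> component E S x"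
  then have "(x, y) \<in> (E \<inter> S \<times> S)\<^sup>*" by (simp add: component_def)
  then show "y \<in> S" using \<open>x \<in> S\<close> by (induction rule: rtrancl_induct) auto
qed

lemma component_self [simp]: "x \<in> component E S x"
  by (simp add: component_def)

lemma component_step:
  "u \<in> component E S x \<Longrightarrow> x \<in> S \<Longrightarrow> v \<in> S \<Longrightarrow> (u, v) \<in> E \<Longrightarrow> v \<in> component E S x"
proof -
  assume a: "u \<in> component E S x" "x \<in> S" "v \<in> S" "(u, v) \<in> E"
  then have "u \<in> S" using component_subset[of x S E] by blast
  with a have "(u, v) \<in> E \<inter> S \<times> S" by blast
  with a(1) show ?thesis unfolding component_def mem_Collect_eq by (rule rtrancl_into_rtrancl)
qed

lemma conn_component:
  assumes "sym E" "x \<in> S"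
  shows "conn E (component E S x)"
proof (rule conn_from[OF assms(1), of _ x])
  fix y assume "y \<in> component E S x"
  then have "(x, y) \<in> (E \<inter> S \<times> S)\<^sup>*" by (simp add: component_def)
  then show "(x, y) \<in> (E \<inter> component E S x \<times> component E S x)\<^sup>*"
  proof (induction rule: rtrancl_induct)
    case (step y z)
    then have "y \<in> component E S x" "z \<in> component E S x"
      unfolding component_def mem_Collect_eq by (blast, meson rtrancl_into_rtrancl)
    with step have "(y, z) \<in> E \<inter> component E S x \<times> component E S x" by blast
    with step.IH show ?case by (rule rtrancl_into_rtrancl)
  qed simp
qed

lemma conn_subset_component:
  assumes "conn E T" "T \<subseteq> S" "t \<in> T" "t \<in> component E S x"
  shows "T \<subseteq> component E S x"
proof
  fix y assume "y \<in> T"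
  then have "(t, y) \<in> (E \<inter> T \<times> T)\<^sup>*" using assms by (auto simp: conn_def)
  then have "(t, y) \<in> (E \<inter> S \<times> S)\<^sup>*" by (rule rtrancl_mono[THEN subsetD, rotated]) (use assms in blast)
  with assms(4) show "y \<in> component E S x" by (auto simp: component_def)
qed

lemma component_eq:
  assumes "sym E" "x \<in> S" "y \<in> component E S x"
  shows "component E S y = component E S x"
proof -
  have "sym ((E \<inter> S \<times> S)\<^sup>*)" by (intro sym_rtrancl sym_restrict assms)
  with assms(3) have "(x, y) \<in> (E \<inter> S \<times> S)\<^sup>*" "(y, x) \<in> (E \<inter> S \<times> S)\<^sup>*"
    by (auto simp: component_def dest: symD)
  then show ?thesis unfolding component_def by (blast intro: rtrancl_trans)
qed

lemma kmodel_mono: "kmodel E V B h \<Longrightarrow> V \<subseteq> W \<Longrightarrow> kmodel E W B h"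
  by (auto simp: kmodel_def)

section \<open>Dense graphs have clique models\<close>

lemma kmodel_mono_edges:
  assumes "kmodel E' V B h" "E' \<subseteq> E"
  shows "kmodel E V B h"
proof -
  have "conn E (B i)" if "i < h" for i
    using assms that by (intro conn_mono[of E' "B i" E]) (auto simp: kmodel_def)
  with assms show ?thesis unfolding kmodel_def by blast
qed

text \<open>The induction step of Mader's argument, with \<open>N\<close> the neighbourhood of
  \<open>U\<close>: every branch set inside \<open>N\<close> is nonempty and each of its vertices
  has a neighbour in \<open>U\<close>, so \<open>U\<close> itself serves as one more branch
  set.\<close>

lemma kmodel_extend:
  assumes "kmodel E N B h" "sym E" "N \<subseteq> V" "U \<subseteq> V" "U \<noteq> {}" "conn E U" "U \<inter> N = {}"
    and "\<And>x. x \<in> N \<Longrightarrow> \<exists>u\<in>U. (u, x) \<in> E"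
  shows "kmodel E V (B(h := U)) (Suc h)"
proof -
  have *: "B i \<inter> U = {} \<and> (\<exists>x\<in>B i. \<exists>y\<in>U. (x, y) \<in> E)" if "i < h" for i
  proof -
    have "B i \<noteq> {}" and sub: "B i \<subseteq> N" using assms(1) that by (simp_all add: kmodel_def)
    then obtain x where x: "x \<in> B i" by blast
    with sub assms(8)[of x] obtain u where "u \<in> U" "(u, x) \<in> E" by blast
    then have "(x, u) \<in> E" using assms(2) by (simp add: symD)
    with x \<open>u \<in> U\<close> sub assms(7) show ?thesis by blast
  qed
  have **: "\<exists>x\<in>U. \<exists>y\<in>B i. (x, y) \<in> E" if "i < h" for i
    using *[OF that] symD[OF assms(2)] by meson
  show ?thesis using assms(1,3-6) * ** unfolding kmodel_def
    by (auto simp: less_Suc_eq subset_iff)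
qed

text \<open>Removing \<open>x\<close> from the graph outside \<open>U\<close> destroys both
  orientations of each of its edges, hence the factor 2.\<close>

lemma card_insert_neighbourhood:
  assumes "finite V" "sym E" "irrefl E" "x \<in> V - U"
  defines "M \<equiv> {y \<in> V - U. (x, y) \<in> E}"
  shows "card (E \<inter> (V - U) \<times> (V - U)) = card (E \<inter> (V - insert x U) \<times> (V - insert x U)) + 2 * card M"
proof -
  have fin: "finite M" using assms by auto
  have es: "(x, y) \<in> E \<longleftrightarrow> (y, x) \<in> E" for y using assms(2) by (meson symD)
  have finV: "finite (E \<inter> (V - insert x U) \<times> (V - insert x U))" using assms(1) by simp
  have "E \<inter> (V - U) \<times> (V - U) = E \<inter> (V - insert x U) \<times> (V - insert x U) \<union> (Pair x ` M \<union> (\<lambda>y. (y, x)) ` M)"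
    using assms(3,4) es by (auto simp: irrefl_def M_def)
  also have "card \<dots> = card (E \<inter> (V - insert x U) \<times> (V - insert x U)) + card (Pair x ` M \<union> (\<lambda>y. (y, x)) ` M)"
    using fin finV by (intro card_Un_disjoint) auto
  also have "card (Pair x ` M \<union> (\<lambda>y. (y, x)) ` M) = card (Pair x ` M) + card ((\<lambda>y. (y, x)) ` M)"
    using fin assms(3) by (intro card_Un_disjoint) (auto simp: irrefl_def M_def)
  also have "\<dots> = 2 * card M" by (simp add: card_image inj_on_def)
  finally show ?thesis .
qed

text \<open>Edges are counted as ordered pairs. Contract a maximal connected set \<open>U\<close> whose contraction keeps the
  edge density; by maximality the neighbourhood of \<open>U\<close> has minimum degree at least \<open>2 ^ h\<close>.\<close>

lemma mader:
  assumes "finite V" "V \<noteq> {}" "sym E" "irrefl E" "E \<subseteq> V \<times> V" "card E \<ge> 2 ^ h * card V"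
  shows "\<exists>B. kmodel E V B h"
  using assms
proof (induction h arbitrary: V E)
  case 0
  then show ?case by (simp add: kmodel_def)
next
  case (Suc h)
  note outer = Suc.IH
  from Suc.prems show ?case
  proof (induction "card V" arbitrary: V E rule: less_induct)
    case less
    note fin = less.prems(1) and sym = less.prems(3) and irr = less.prems(4)
    \<comment> \<open>Contracting \<open>U\<close> to a single vertex leaves
      \<open>card (V - U) + 1\<close> vertices and \<open>a U\<close> ordered edges: those avoiding
      \<open>U\<close>, and two for every neighbour of \<open>U\<close>. This explains the
      inequality in \<open>P\<close>.\<close>
    define D where "D U = E \<inter> (V - U) \<times> (V - U)" for U
    define N where "N U = {x \<in> V - U. \<exists>u\<in>U. (u, x) \<in> E}" for U
    define a where "a U = card (D U) + 2 * card (N U)" for U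
    define P where "P U \<longleftrightarrow> U \<noteq> {} \<and> U \<subseteq> V \<and> conn E U \<and> 2 ^ Suc h * (card (V - U) + 1) \<le> a U" for U
    obtain v where v: "v \<in> V" using less.prems by blast
    have "P {v}"
    proof -
      have "card (D {}) = card (D {v}) + 2 * card {y \<in> V. (v, y) \<in> E}"
        using card_insert_neighbourhood[OF fin sym irr, of v "{}"] v by (simp add: D_def)
      moreover have "N {v} = {y \<in> V. (v, y) \<in> E}" using irr by (auto simp: N_def irrefl_def)
      moreover have "D {} = E" using less.prems by (auto simp: D_def)
      moreover have "card (V - {v}) + 1 = card V"
        using v fin by (metis Suc_eq_plus1 card_Suc_Diff1)
      ultimately show ?thesis using v less.prems by (simp add: P_def a_def)
    qed
    moreover have "\<forall>U. P U \<longrightarrow> card U \<le> card V" using fin by (auto simp: P_def card_mono)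
    ultimately have "\<exists>U. P U \<and> (\<forall>U'. P U' \<longrightarrow> card U' \<le> card U)"
      by (intro ex_has_greatest_nat[of P "{v}" card "card V + 1"]) (auto simp: less_Suc_eq_le)
    then obtain U where U: "P U" and max: "\<And>U'. P U' \<Longrightarrow> card U' \<le> card U" by auto
    have finU: "finite U" using U fin unfolding P_def by (meson finite_subset)
    have finN: "finite (N U)" using fin by (simp add: N_def)
    show ?case
    proof (cases "N U = {}")
      \<comment> \<open>Here the contracted vertex is isolated. Dropping it leaves a graph on fewer
        vertices that is still dense enough for the inner induction on
        \<open>card V\<close>.\<close>
      case True
      with U have c: "2 ^ Suc h * (card (V - U) + 1) \<le> card (D U)" by (simp add: P_def a_def)
      have ne: "V - U \<noteq> {}"
      proof
        assume "V - U = {}"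
        then have "D U = {}" unfolding D_def by blast
        with c show False by simp
      qed
      have "V - U \<subset> V" using U by (auto simp: P_def)
      then have "card (V - U) < card V" using fin by (rule psubset_card_mono[rotated])
      moreover have "sym (D U)" "irrefl (D U)" using sym irr by (auto simp: D_def sym_def irrefl_def)
      ultimately obtain B where "kmodel (D U) (V - U) B (Suc h)"
        using less.hyps[of "V - U" "D U"] ne fin c by (force simp: D_def)
      then have "kmodel E (V - U) B (Suc h)" by (rule kmodel_mono_edges) (simp add: D_def)
      then show ?thesis using kmodel_mono by blast
    next
      case False
      define E' where "E' = E \<inter> N U \<times> N U"
      \<comment> \<open>Contracting \<open>x\<close> into \<open>U\<close> as well loses one vertex,
        the edge to \<open>x\<close>, and one edge for each common neighbour of \<open>x\<close> and
        \<open>U\<close>. By maximality of \<open>U\<close> more than \<open>2 ^ h\<close> unordered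
        edges are lost, so there are at least \<open>2 ^ h\<close> common neighbours.\<close>
      have deg: "2 ^ h \<le> card {y \<in> N U. (x, y) \<in> E}" if x: "x \<in> N U" for x
      proof -
        define M where "M = {y \<in> V - U. (x, y) \<in> E}"
        have finM: "finite M" using fin by (simp add: M_def)
        have xV: "x \<in> V - U" using x by (simp add: N_def)
        have "conn E (insert x U)"
          using U x sym conn_insert[of E U _ x] unfolding P_def N_def by blast
        moreover have "\<not> P (insert x U)" using max[of "insert x U"] xV finU by auto
        ultimately have "a (insert x U) < 2 ^ Suc h * (card (V - insert x U) + 1)"
          using U xV by (auto simp: P_def)
        also have "card (V - insert x U) + 1 = card (V - U)"
          using card_Suc_Diff1[of "V - U" x] xV fin by (simp flip: Diff_insert)
        finally have 1: "a (insert x U) < 2 ^ Suc h * card (V - U)" .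
        have 2: "2 ^ Suc h * (card (V - U) + 1) \<le> a U" using U by (simp add: P_def)
        have 3: "card (D U) = card (D (insert x U)) + 2 * card M"
          unfolding D_def M_def by (rule card_insert_neighbourhood[OF fin sym irr xV])
        have "N (insert x U) = (N U - {x}) \<union> (M - N U)"
          using irr xV by (auto simp: N_def M_def irrefl_def)
        then have 4: "card (N (insert x U)) = card (N U - {x}) + card (M - N U)"
          using finN finM by (simp add: card_Un_disjoint Int_Diff disjoint_iff)
        have 5: "card (N U) = Suc (card (N U - {x}))" using card_Suc_Diff1[OF finN x] by simp
        have "card M = card (M \<inter> N U) + card (M - N U)"
          using finM by (metis card_Int_Diff)
        moreover have "M \<inter> N U = {y \<in> N U. (x, y) \<in> E}" by (auto simp: M_def N_def)
        ultimately show ?thesis using 1 2 3 4 5 unfolding a_def by simp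
      qed
      have "card E' = (\<Sum>x\<in>N U. card {y \<in> N U. (x, y) \<in> E})"
      proof -
        have "E' = (SIGMA x:N U. {y \<in> N U. (x, y) \<in> E})" by (auto simp: E'_def)
        then show ?thesis using finN by simp
      qed
      also have "\<dots> \<ge> (\<Sum>x\<in>N U. 2 ^ h)" by (intro sum_mono deg)
      finally have "2 ^ h * card (N U) \<le> card E'" by (simp add: mult.commute)
      moreover have "sym E'" "irrefl E'" using sym irr by (auto simp: E'_def sym_def irrefl_def)
      ultimately obtain B where "kmodel E' (N U) B h"
        using outer[of "N U" E'] False finN by (auto simp: E'_def)
      then have "kmodel E (N U) B h" by (rule kmodel_mono_edges) (auto simp: E'_def)
      then have "kmodel E V (B(h := U)) (Suc h)"
        by (rule kmodel_extend[OF _ sym]) (use U in \<open>auto simp: N_def P_def\<close>)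
      then show ?thesis by blast
    qed
  qed
qed

section \<open>Clique models from weak embeddings\<close>

text \<open>The sets \<open>P x y\<close> play the role of the edges of \<open>F\<close>. A cut that
  splits none of them cannot split \<open>W\<close>, since an \<open>F\<close>-edge across the cut
  would have both ends in one unsplit \<open>P x y\<close>.\<close>

lemma conn_transfer:
  assumes "sym E" "conn F W"
    and "\<And>x y. x \<in> W \<Longrightarrow> y \<in> W \<Longrightarrow> (x, y) \<in> F \<Longrightarrow> conn E (P x y) \<and> x \<in> P x y \<and> y \<in> P x y"
  shows "conn E (W \<union> \<Union>{P x y | x y. x \<in> W \<and> y \<in> W \<and> (x, y) \<in> F})" (is "conn E ?S")
proof (rule conn_cutI[OF assms(1)])
  fix A assume A: "A \<subseteq> ?S" "A \<noteq> {}" "A \<noteq> ?S"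
  show "\<exists>u\<in>A. \<exists>v\<in>?S - A. (u, v) \<in> E"
  proof (rule ccontr)
    assume n: "\<not> ?thesis"
    have *: "P x y \<subseteq> A \<or> P x y \<inter> A = {}" if xy: "x \<in> W" "y \<in> W" "(x, y) \<in> F" for x y
    proof (rule ccontr)
      assume "\<not> ?thesis"
      then obtain p q where pq: "p \<in> P x y" "p \<in> A" "q \<in> P x y" "q \<notin> A" by blast
      have "conn E (P x y)" using assms(3)[OF xy] by simp
      from conn_crossing[OF this pq] obtain u v where uv: "u \<in> A" "v \<in> P x y" "v \<notin> A" "(u, v) \<in> E" by metis
      then have "v \<in> ?S - A" using xy by blast
      with uv n show False by blast
    qed
    have W: "W \<subseteq> A \<or> W \<inter> A = {}"
    proof (rule ccontr)
      assume "\<not> ?thesis"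
      then obtain p q where pq: "p \<in> W" "p \<in> A" "q \<in> W" "q \<notin> A" by blast
      from conn_crossing[OF assms(2) pq] obtain u v
        where uv: "u \<in> W" "u \<in> A" "v \<in> W" "v \<notin> A" "(u, v) \<in> F" by metis
      then show False using *[OF uv(1,3,5)] assms(3)[OF uv(1,3,5)] by blast
    qed
    from W show False
    proof
      assume W: "W \<subseteq> A"
      have "P x y \<subseteq> A" if "x \<in> W" "y \<in> W" "(x, y) \<in> F" for x y
        using *[OF that] assms(3)[OF that] that W by blast
      then have "?S \<subseteq> A" using W by blast
      then show False using A by blast
    next
      assume W: "W \<inter> A = {}"
      have "P x y \<inter> A = {}" if "x \<in> W" "y \<in> W" "(x, y) \<in> F" for x y
        using *[OF that] assms(3)[OF that] that W by blast
      then have "?S \<inter> A = {}" using W by blast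
      then show False using A by blast
    qed
  qed
qed

text \<open>Trims a connecting set so that it stops just before \<open>B\<close>: an edge of
  \<open>P\<close> leaving the component of \<open>x\<close> in \<open>P - B\<close> can only end in
  \<open>B\<close>.\<close>

lemma conn_component_Diff_adjacent:
  assumes "conn E P" "x \<in> P" "x \<notin> B" "y \<in> P" "y \<in> B"
  shows "\<exists>u \<in> component E (P - B) x. \<exists>v \<in> B. (u, v) \<in> E"
proof -
  have sub: "component E (P - B) x \<subseteq> P - B" using assms by (intro component_subset) auto
  then have "y \<notin> component E (P - B) x" using assms by blast
  from conn_crossing[OF assms(1,2) component_self assms(4) this] obtain u v
    where uv: "u \<in> P" "u \<in> component E (P - B) x" "v \<in> P" "v \<notin> component E (P - B) x" "(u, v) \<in> E" .
  have "v \<in> B"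
  proof (rule ccontr)
    assume "v \<notin> B"
    then have "v \<in> component E (P - B) x" using uv assms by (intro component_step[OF uv(2)]) auto
    with uv show False by blast
  qed
  with uv show ?thesis by blast
qed

lemma block_index:
  fixes i j i' j' h :: nat
  assumes "j < h" "j' < h" "i * h + j = i' * h + j'"
  shows "i = i'" "j = j'"
proof -
  have "(i * h + j) div h = i" "(i' * h + j') div h = i'" "(i * h + j) mod h = j" "(i' * h + j') mod h = j'"
    using assms(1,2) by auto
  then show "i = i'" "j = j'" using assms(3) by metis+
qed

lemma block_less: "i < h \<Longrightarrow> j < h \<Longrightarrow> i * h + j < h * (h::nat)"
proof -
  assume "i < h" "j < h"
  then have "i * h + j < i * h + h" "Suc i * h \<le> h * h" by (simp, intro mult_le_mono1) auto
  then show ?thesis by simp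
qed

text \<open>The sets \<open>P x y\<close> of two edges with a common endpoint may intersect. This is harmless within a branch
  set, but not between connecting edges. Merging \<open>h * h\<close> branch sets into \<open>h\<close> blocks of \<open>h\<close> allows the
  connecting edges to be chosen pairwise disjoint.\<close>

lemma weak_embedding:
  assumes symE: "sym E" and model: "kmodel F A U (h * h)" and AV: "A \<subseteq> V"
    and P: "\<And>x y. (x, y) \<in> F \<Longrightarrow> conn E (P x y) \<and> x \<in> P x y \<and> y \<in> P x y \<and> P x y \<subseteq> V"
    and disj: "\<And>x y u v. (x, y) \<in> F \<Longrightarrow> (u, v) \<in> F \<Longrightarrow> {x, y} \<inter> {u, v} = {} \<Longrightarrow> P x y \<inter> P u v = {}"
    and symF: "sym F"
  shows "\<exists>B. kmodel E V B h"
proof -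
  \<comment> \<open>For \<open>h >= 2\<close> every block contains at least two branch sets, so each
    vertex of a block has an \<open>F\<close>-neighbour in the same block. \<open>B'mem\<close>
    relies on this.\<close>
  consider "h = 0" | "h = 1" | "h \<ge> 2" by linarith
  then show ?thesis
  proof cases
    case 1
    then show ?thesis by (simp add: kmodel_def)
  next
    case 2
    then have "U 0 \<noteq> {}" "U 0 \<subseteq> A" using model by (auto simp: kmodel_def)
    then obtain x where "x \<in> V" using AV by blast
    then have "kmodel E V (\<lambda>_. {x}) h" using 2 by (auto simp: kmodel_def)
    then show ?thesis by blast
  next
    case 3
    define W where "W i = (\<Union>j<h. U (i * h + j))" for i
    have U: "U k \<noteq> {}" "U k \<subseteq> A" "conn F (U k)" if "k < h * h" for k
      using model that by (auto simp: kmodel_def)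
    have Udis: "U k \<inter> U l = {}" "\<exists>x\<in>U k. \<exists>y\<in>U l. (x, y) \<in> F" if "k < h * h" "l < h * h" "k \<noteq> l" for k l
      using model that by (auto simp: kmodel_def)
    have idx: "\<And>i j. i < h \<Longrightarrow> j < h \<Longrightarrow> i * h + j < h * h" by (rule block_less)
    have connW: "conn F (W i)" if i: "i < h" for i
    proof -
      have i0: "i * h < h * h" using idx[OF i, of 0] 3 by simp
      have "conn F (U (i * h) \<union> \<Union>((\<lambda>j. U (i * h) \<union> U (i * h + j)) ` {..<h}))"
      proof (rule conn_Un_Union[OF symF U(3)[OF i0]])
        fix Q assume "Q \<in> (\<lambda>j. U (i * h) \<union> U (i * h + j)) ` {..<h}"
        then obtain j where j: "j < h" "Q = U (i * h) \<union> U (i * h + j)" by blast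
        have "conn F Q"
        proof (cases "j = 0")
          case True
          then show ?thesis using U(3)[OF i0] j by simp
        next
          case False
          then have "\<exists>x\<in>U (i * h). \<exists>y\<in>U (i * h + j). (x, y) \<in> F"
            using Udis(2)[OF i0 idx[OF i j(1)]] by simp
          then show ?thesis
            unfolding j by (intro conn_Un[OF symF U(3)[OF i0] U(3)[OF idx[OF i j(1)]]]) simp
        qed
        with j U(1)[OF i0] show "conn F Q \<and> Q \<inter> U (i * h) \<noteq> {}" by blast
      qed
      also have "U (i * h) \<union> \<Union>((\<lambda>j. U (i * h) \<union> U (i * h + j)) ` {..<h}) = W i"
      proof -
        have "U (i * h + 0) \<subseteq> W i" unfolding W_def using 3 by (intro UN_upper) simp
        then show ?thesis unfolding W_def by (intro subset_antisym) auto
      qed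
      finally show ?thesis .
    qed
    have WA: "W i \<subseteq> A" if "i < h" for i
      unfolding W_def using U(2)[OF idx[OF that]] by (intro UN_least) simp
    have Wdis: "W i \<inter> W j = {}" if ij: "i < h" "j < h" "i \<noteq> j" for i j
    proof -
      have "U (i * h + k) \<inter> U (j * h + l) = {}" if "k < h" "l < h" for k l
        using block_index(1)[of k h l i j] that ij by (intro Udis(1) idx) auto
      then show ?thesis unfolding W_def by blast
    qed
    define B' where "B' i = W i \<union> \<Union>{P x y | x y. x \<in> W i \<and> y \<in> W i \<and> (x, y) \<in> F}" for i
    have connB': "conn E (B' i)" if "i < h" for i
      unfolding B'_def by (rule conn_transfer[OF symE connW[OF that]]) (use P in blast)
    \<comment> \<open>Also the vertices of \<open>W i\<close> are placed in some
      \<open>P x y\<close> with both ends in \<open>W i\<close>. Disjointness of different blocks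
      thereby reduces to \<open>disj\<close>.\<close>
    have B'mem: "\<exists>x\<in>W i. \<exists>y\<in>W i. (x, y) \<in> F \<and> z \<in> P x y" if z: "z \<in> B' i" and i: "i < h" for i z
    proof (cases "z \<in> W i")
      case True
      then obtain j where j: "j < h" "z \<in> U (i * h + j)" by (auto simp: W_def)
      define j' where "j' = (if j = 0 then 1 else 0 :: nat)"
      have j': "j' < h" "j' \<noteq> j" using 3 by (auto simp: j'_def)
      obtain q where q: "q \<in> U (i * h + j')" using U(1)[OF idx[OF i j'(1)]] by blast
      have "U (i * h + j) \<inter> U (i * h + j') = {}"
        using Udis(1)[OF idx[OF i j(1)] idx[OF i j'(1)]] j' by simp
      then have "q \<notin> {z}" using q j by blast
      moreover have "q \<in> W i" using q j' by (auto simp: W_def)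
      ultimately obtain v where "v \<in> W i" "(z, v) \<in> F"
        using conn_crossing[OF connW[OF i] True, of "{z}" q] by blast
      then show ?thesis using True P by blast
    next
      case False
      then show ?thesis using z by (auto simp: B'_def)
    qed
    have B'dis: "B' i \<inter> B' j = {}" if ij: "i < h" "j < h" "i \<noteq> j" for i j
    proof (rule ccontr)
      assume "B' i \<inter> B' j \<noteq> {}"
      then obtain z where z: "z \<in> B' i" "z \<in> B' j" by blast
      obtain x y where xy: "x \<in> W i" "y \<in> W i" "(x, y) \<in> F" "z \<in> P x y" using B'mem[OF z(1) ij(1)] by blast
      obtain u v where uv: "u \<in> W j" "v \<in> W j" "(u, v) \<in> F" "z \<in> P u v" using B'mem[OF z(2) ij(2)] by blast
      have "{x, y} \<inter> {u, v} = {}" using xy uv Wdis[OF ij] by blast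
      then show False using disj[OF xy(3) uv(3)] xy uv by blast
    qed
    have B'V: "B' i \<subseteq> V" if i: "i < h" for i
    proof
      fix z assume "z \<in> B' i"
      then obtain x y where "(x, y) \<in> F" "z \<in> P x y" using B'mem[of z i] i by metis
      then show "z \<in> V" using P[of x y] by blast
    qed
    \<comment> \<open>The edge for the blocks \<open>i\<close> and \<open>j\<close> joins branch set
      number \<open>i * h + j\<close> to number \<open>j * h + i\<close>. A branch set is thus used
      by one pair of blocks only, and edges chosen for different pairs have disjoint ends.\<close>
    have "\<exists>e. i < h \<and> j < h \<and> i \<noteq> j \<longrightarrow> fst e \<in> U (i * h + j) \<and> snd e \<in> U (j * h + i) \<and> e \<in> F" for i j
    proof (cases "i < h \<and> j < h \<and> i \<noteq> j")
      case True
      then have "i * h + j \<noteq> j * h + i" using block_index(1)[of j h i i j] by auto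
      then obtain x y where "x \<in> U (i * h + j)" "y \<in> U (j * h + i)" "(x, y) \<in> F"
        using Udis(2)[of "i * h + j" "j * h + i"] True idx by blast
      then show ?thesis by (intro exI[of _ "(x, y)"]) simp
    next
      case False
      then show ?thesis by blast
    qed
    then obtain e where e: "\<And>i j. i < h \<Longrightarrow> j < h \<Longrightarrow> i \<noteq> j \<Longrightarrow>
        fst (e i j) \<in> U (i * h + j) \<and> snd (e i j) \<in> U (j * h + i) \<and> e i j \<in> F" by metis
    define PE where "PE i j = P (fst (e i j)) (snd (e i j))" for i j
    have PE: "conn E (PE i j)" "fst (e i j) \<in> PE i j" "snd (e i j) \<in> PE i j" "PE i j \<subseteq> V"
      if "i < h" "j < h" "i \<noteq> j" for i j
      using P[of "fst (e i j)" "snd (e i j)"] e[OF that] by (simp_all add: PE_def)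
    have eW: "fst (e i j) \<in> W i" "snd (e i j) \<in> W j" if "i < h" "j < h" "i \<noteq> j" for i j
      using e[OF that] that by (auto simp: W_def)
    have eB: "fst (e i j) \<in> B' i" "snd (e i j) \<in> B' j" if "i < h" "j < h" "i \<noteq> j" for i j
      using eW[OF that] by (auto simp: B'_def)
    have e_notin: "fst (e i j) \<notin> B' j" if "i < h" "j < h" "i \<noteq> j" for i j
      using eB[OF that] B'dis[OF that] by blast
    \<comment> \<open>Cuts \<open>PE i j\<close> off where it would enter \<open>B' j\<close>. The
      remaining piece is absorbed by block \<open>i\<close>; it may meet \<open>B' i\<close>, which
      is harmless, but no other block, and it ends next to \<open>B' j\<close>.\<close>
    define Z where "Z i j = component E (PE i j - B' j) (fst (e i j))" for i j
    have Zsub: "Z i j \<subseteq> PE i j - B' j" if "i < h" "j < h" "i \<noteq> j" for i j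
      unfolding Z_def using PE[OF that] e_notin[OF that] by (intro component_subset) blast
    have Zconn: "conn E (Z i j)" if "i < h" "j < h" "i \<noteq> j" for i j
      unfolding Z_def using PE[OF that] e_notin[OF that] by (intro conn_component symE) blast
    have Zself: "fst (e i j) \<in> Z i j" for i j by (simp add: Z_def)
    have ZB': "Z i j \<inter> B' l = {}" if ij: "i < h" "j < h" "i \<noteq> j" and l: "l < h" "l \<noteq> i" for i j l
    proof (cases "l = j")
      case True
      then show ?thesis using Zsub[OF ij] by blast
    next
      case False
      show ?thesis
      proof (rule ccontr)
        assume "Z i j \<inter> B' l \<noteq> {}"
        then obtain z where z: "z \<in> PE i j" "z \<in> B' l" using Zsub[OF ij] by blast
        obtain u v where uv: "u \<in> W l" "v \<in> W l" "(u, v) \<in> F" "z \<in> P u v" using B'mem[OF z(2) l(1)] by blast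
        have "{fst (e i j), snd (e i j)} \<inter> {u, v} = {}"
          using uv eW[OF ij] Wdis[of l i] Wdis[of l j] ij l False by blast
        then have "PE i j \<inter> P u v = {}" unfolding PE_def using e[OF ij] uv by (intro disj) auto
        then show False using z uv by blast
      qed
    qed
    have ZZ: "Z i j \<inter> Z i' j' = {}"
      if ij: "i < j" "j < h" "i' < j'" "j' < h" "i \<noteq> i'" for i j i' j'
    proof -
      have ij': "i < h" "i \<noteq> j" "i' < h" "i' \<noteq> j'" using ij by auto
      have Ud: "U (p * h + q) \<inter> U (p' * h + q') = {}"
        if "p < h" "q < h" "p' < h" "q' < h" "p \<noteq> p' \<or> q \<noteq> q'" for p q p' q'
        using that block_index[of q h q' p p'] by (intro Udis(1) idx) auto
      have "{fst (e i j), snd (e i j)} \<inter> {fst (e i' j'), snd (e i' j')} = {}"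
        using e[of i j] e[of i' j'] ij ij' Ud[of i j i' j'] Ud[of i j j' i'] Ud[of j i i' j'] Ud[of j i j' i']
        by auto
      then have "PE i j \<inter> PE i' j' = {}"
        unfolding PE_def using e[of i j] e[of i' j'] ij ij' by (intro disj) auto
      then show ?thesis using Zsub[of i j] Zsub[of i' j'] ij ij' by blast
    qed
    \<comment> \<open>Each pair of blocks is served by its smaller index. Pieces with the same first
      index land in the same branch set, so \<open>ZZ\<close> has to separate only pieces with
      different first indices.\<close>
    define B where "B i = B' i \<union> \<Union>(Z i ` {j. i < j \<and> j < h})" for i
    have "conn E (B i)" if "i < h" for i
      unfolding B_def
    proof (rule conn_Un_Union[OF symE connB'[OF that]])
      fix Q assume "Q \<in> Z i ` {j. i < j \<and> j < h}"
      then obtain j where j: "i < j" "j < h" "Q = Z i j" by blast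
      then show "conn E Q \<and> Q \<inter> B' i \<noteq> {}"
        using Zconn[of i j] Zself[of i j] eB[of i j] by auto
    qed
    moreover have "B i \<noteq> {}" if "i < h" for i
    proof -
      have "U (i * h + 0) \<noteq> {}" using 3 by (intro U(1) idx that) simp
      moreover have "U (i * h + 0) \<subseteq> W i" unfolding W_def using 3 by (intro UN_upper) simp
      ultimately show ?thesis unfolding B_def B'_def by auto
    qed
    moreover have "B i \<subseteq> V" if "i < h" for i
    proof -
      have "Z i j \<subseteq> V" if "i < j" "j < h" for j using Zsub[of i j] PE(4)[of i j] that by auto
      then show ?thesis using B'V[OF that] unfolding B_def by blast
    qed
    moreover have Bdis: "B i \<inter> B j = {}" if ij: "i < h" "j < h" "i \<noteq> j" for i j
    proof -
      have "Z i l \<inter> B' j = {}" if "i < l" "l < h" for l using ZB'[of i l j] that ij by auto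
      moreover have "B' i \<inter> Z j l = {}" if "j < l" "l < h" for l using ZB'[of j l i] that ij by auto
      moreover have "Z i l \<inter> Z j k = {}" if "i < l" "l < h" "j < k" "k < h" for l k
        using ZZ[OF that] ij by auto
      ultimately show ?thesis using B'dis[OF ij] unfolding B_def by blast
    qed
    moreover have adj: "\<exists>x\<in>B i. \<exists>y\<in>B j. (x, y) \<in> E" if ij: "i < j" "j < h" for i j
    proof -
      have ij': "i < h" "j < h" "i \<noteq> j" using ij by auto
      have "\<exists>u\<in>Z i j. \<exists>v\<in>B' j. (u, v) \<in> E"
        unfolding Z_def
        by (rule conn_component_Diff_adjacent[OF PE(1,2)[OF ij'] e_notin[OF ij'] PE(3)[OF ij'] eB(2)[OF ij']])
      then show ?thesis using ij unfolding B_def by blast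
    qed
    moreover have "\<exists>x\<in>B i. \<exists>y\<in>B j. (x, y) \<in> E" if ij: "i < h" "j < h" "i \<noteq> j" for i j
      using adj[of i j] adj[of j i] ij symD[OF symE] by (meson nat_neq_iff)
    ultimately have "kmodel E V B h" unfolding kmodel_def by blast
    then show ?thesis by blast
  qed
qed

section \<open>Crossing pairs of demands\<close>

text \<open>Demands with exactly one common endpoint never form a bad pair, in accordance with the
  hypothesis \<open>disj\<close> of \<open>weak_embedding\<close>. Parallel demands are bad because
  they would yield a single edge of the demand graph.\<close>

definition bad_pair :: "('d \<Rightarrow> 'a) \<Rightarrow> ('d \<Rightarrow> 'a) \<Rightarrow> ('d \<Rightarrow> 'a set) \<Rightarrow> 'd \<Rightarrow> 'd \<Rightarrow> bool" where
  "bad_pair x y P d d' \<longleftrightarrow> {x d, y d} = {x d', y d'} \<or>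
     {x d, y d} \<inter> {x d', y d'} = {} \<and> P d \<inter> P d' \<noteq> {}"

text \<open>Without bad pairs the demands are the edges of a simple graph weakly embedded in
  \<open>E\<close>. Too many of them would give a model of size \<open>h * h\<close> by
  \<open>mader\<close>, and \<open>weak_embedding\<close> turns this into one of size
  \<open>h\<close>; hence the exponent \<open>h * h\<close>.\<close>

lemma uncrossed_demands:
  assumes "sym E" and no: "\<not> (\<exists>B. kmodel E V B h)" and "finite A" "A \<subseteq> V" "finite K"
    and K: "\<And>d. d \<in> K \<Longrightarrow> x d \<in> A \<and> y d \<in> A \<and> x d \<noteq> y d \<and> conn E (P d) \<and> x d \<in> P d \<and> y d \<in> P d \<and> P d \<subseteq> V"
    and good: "\<And>d d'. d \<in> K \<Longrightarrow> d' \<in> K \<Longrightarrow> d \<noteq> d' \<Longrightarrow> \<not> bad_pair x y P d d'"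
  shows "card K \<le> 2 ^ (h * h) * card A"
proof (rule ccontr)
  assume big: "\<not> ?thesis"
  define F1 where "F1 = (\<lambda>d. (x d, y d)) ` K"
  define F2 where "F2 = (\<lambda>d. (y d, x d)) ` K"
  define F where "F = F1 \<union> F2"
  have inj: "d = d'" if "d \<in> K" "d' \<in> K" "{x d, y d} = {x d', y d'}" for d d'
    using good[OF that(1,2)] that(3) by (auto simp: bad_pair_def)
  have "card F1 = card K"
    unfolding F1_def by (intro card_image inj_onI inj) auto
  then have "card K \<le> card F"
    using assms(5) by (metis F_def F1_def F2_def Un_upper1 card_mono finite_UnI finite_imageI)
  then have cF: "2 ^ (h * h) * card A \<le> card F" using big by simp
  have "A \<noteq> {}"
  proof
    assume "A = {}"
    then have "K = {}" using K by blast
    then show False using big by simp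
  qed
  moreover have symF: "sym F" by (auto simp: F_def F1_def F2_def sym_def)
  moreover have "irrefl F"
  proof -
    have "x d \<noteq> y d" "y d \<noteq> x d" if "d \<in> K" for d using K[OF that] by auto
    then show ?thesis unfolding F_def F1_def F2_def irrefl_def by blast
  qed
  moreover have "F \<subseteq> A \<times> A" using K by (auto simp: F_def F1_def F2_def)
  ultimately obtain U where U: "kmodel F A U (h * h)"
    using mader[OF assms(3), of F "h * h"] cF by blast
  define dd where "dd u v = (SOME d. d \<in> K \<and> {x d, y d} = {u, v})" for u v
  have dd: "dd u v \<in> K \<and> {x (dd u v), y (dd u v)} = {u, v}" if "(u, v) \<in> F" for u v
  proof -
    have "\<exists>d. d \<in> K \<and> {x d, y d} = {u, v}" using that by (auto simp: F_def F1_def F2_def)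
    then show ?thesis unfolding dd_def by (rule someI_ex)
  qed
  have "\<exists>B. kmodel E V B h"
  proof (rule weak_embedding[OF assms(1) U assms(4) _ _ symF, of "\<lambda>u v. P (dd u v)"])
    fix u v assume "(u, v) \<in> F"
    obtain d where d: "dd u v = d" by blast
    have dK: "d \<in> K" and uv: "{x d, y d} = {u, v}" using dd[OF \<open>(u, v) \<in> F\<close>] unfolding d by blast+
    have "u = x d \<or> u = y d" "v = x d \<or> v = y d" using uv by blast+
    then show "conn E (P (dd u v)) \<and> u \<in> P (dd u v) \<and> v \<in> P (dd u v) \<and> P (dd u v) \<subseteq> V"
      unfolding d using K[OF dK] by metis
  next
    fix u v u' v' assume h: "(u, v) \<in> F" "(u', v') \<in> F" "{u, v} \<inter> {u', v'} = {}"
    obtain d d' where d: "dd u v = d" "dd u' v' = d'" by blast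
    have dK: "d \<in> K" "d' \<in> K" and uv: "{x d, y d} = {u, v}" "{x d', y d'} = {u', v'}"
      using dd[OF h(1)] dd[OF h(2)] unfolding d by blast+
    have "d \<noteq> d'" using uv h(3) by blast
    then have "\<not> bad_pair x y P d d'" by (rule good[OF dK])
    moreover have "{x d, y d} \<inter> {x d', y d'} = {}" by (simp only: uv h(3))
    ultimately show "P (dd u v) \<inter> P (dd u' v') = {}" unfolding d bad_pair_def by simp
  qed
  then show False using no by blast
qed

text \<open>The deletion step of the crossing number argument: badness is symmetric, so discarding
  the first component of every ordered bad pair leaves no bad pair.\<close>

lemma demands_minus_bad_pairs:
  assumes "sym E" "\<not> (\<exists>B. kmodel E V B h)" "finite A" "A \<subseteq> V" "finite K"
    and K: "\<And>d. d \<in> K \<Longrightarrow> x d \<in> A \<and> y d \<in> A \<and> x d \<noteq> y d \<and> conn E (P d) \<and> x d \<in> P d \<and> y d \<in> P d \<and> P d \<subseteq> V"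
  shows "card K \<le> 2 ^ (h * h) * card A + card {(d, d'). d \<in> K \<and> d' \<in> K \<and> d \<noteq> d' \<and> bad_pair x y P d d'}"
proof -
  define bad where "bad = {(d, d'). d \<in> K \<and> d' \<in> K \<and> d \<noteq> d' \<and> bad_pair x y P d d'}"
  define K' where "K' = {d \<in> K. \<forall>d'\<in>K. d \<noteq> d' \<longrightarrow> \<not> bad_pair x y P d d'}"
  have finb: "finite bad" using assms(5) by (rule_tac finite_subset[of _ "K \<times> K"]) (auto simp: bad_def)
  have "card K' \<le> 2 ^ (h * h) * card A"
  proof (rule uncrossed_demands[OF assms(1-4)])
    show "finite K'" using assms(5) by (simp add: K'_def)
    show "x d \<in> A \<and> y d \<in> A \<and> x d \<noteq> y d \<and> conn E (P d) \<and> x d \<in> P d \<and> y d \<in> P d \<and> P d \<subseteq> V"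
      if "d \<in> K'" for d
      by (rule K) (use that in \<open>simp add: K'_def\<close>)
    show "\<not> bad_pair x y P d d'" if "d \<in> K'" "d' \<in> K'" "d \<noteq> d'" for d d'
      using that unfolding K'_def by blast
  qed
  moreover have "card (K - K') \<le> card bad"
  proof -
    have "K - K' \<subseteq> fst ` bad" by (force simp: K'_def bad_def)
    then have "card (K - K') \<le> card (fst ` bad)" using finb by (intro card_mono) auto
    also have "\<dots> \<le> card bad" using finb by (rule card_image_le)
    finally show ?thesis .
  qed
  moreover have "card K = card K' + card (K - K')"
    using assms(5) by (intro card_Un_disjoint[of K' "K - K'", THEN trans[rotated]] arg_cong[of _ _ card]) (auto simp: K'_def)
  ultimately show ?thesis unfolding bad_def by linarith
qed

section \<open>Independent sampling of vertices and demands\<close>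

definition bern :: "('i \<Rightarrow> real) \<Rightarrow> 'i set \<Rightarrow> 'i set \<Rightarrow> real" where
  "bern p I A = (\<Prod>i\<in>A. p i) * (\<Prod>i\<in>I - A. 1 - p i)"

lemma bern_nonneg: "(\<And>i. i \<in> I \<Longrightarrow> 0 \<le> p i \<and> p i \<le> 1) \<Longrightarrow> A \<subseteq> I \<Longrightarrow> 0 \<le> bern p I A"
  unfolding bern_def by (intro mult_nonneg_nonneg prod_nonneg) auto

text \<open>The probability that a random subset of \<open>I\<close> contains \<open>J\<close>.
  Replacing the factor \<open>1 - p i\<close> by 0 for \<open>i\<close> in \<open>J\<close> kills
  exactly the subsets that miss a point of \<open>J\<close>, and the resulting sum over subsets is
  an expanded product.\<close>

lemma bern_superset:
  assumes "finite I" "J \<subseteq> I"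
  shows "(\<Sum>A\<in>Pow I. if J \<subseteq> A then bern p I A else 0) = (\<Prod>i\<in>J. p i)"
proof -
  have "(\<Prod>i\<in>I. p i + (if i \<in> J then 0 else 1 - p i)) = (\<Sum>A\<in>Pow I. (\<Prod>i\<in>A. p i) * (\<Prod>i\<in>I - A. if i \<in> J then 0 else 1 - p i))"
    by (rule prod_add[OF assms(1)])
  also have "\<dots> = (\<Sum>A\<in>Pow I. if J \<subseteq> A then bern p I A else 0)"
  proof (rule sum.cong[OF refl])
    fix A assume A: "A \<in> Pow I"
    show "(\<Prod>i\<in>A. p i) * (\<Prod>i\<in>I - A. if i \<in> J then 0 else 1 - p i) = (if J \<subseteq> A then bern p I A else 0)"
    proof (cases "J \<subseteq> A")
      case True
      then have "(\<Prod>i\<in>I - A. if i \<in> J then 0 else 1 - p i) = (\<Prod>i\<in>I - A. 1 - p i)"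
        by (intro prod.cong refl) auto
      then show ?thesis using True by (simp add: bern_def)
    next
      case False
      then obtain i where "i \<in> J" "i \<notin> A" by blast
      then have "(\<Prod>i\<in>I - A. if i \<in> J then 0 else 1 - p i) = 0"
        using assms by (intro prod_zero) auto
      then show ?thesis using False by simp
    qed
  qed
  also have "(\<Prod>i\<in>I. p i + (if i \<in> J then 0 else 1 - p i)) = (\<Prod>i\<in>I. if i \<in> J then p i else 1)"
    by (intro prod.cong refl) auto
  also have "\<dots> = (\<Prod>i\<in>J. p i)"
    using assms by (simp add: prod.If_cases Int_absorb1 Int_def[symmetric])
  finally show ?thesis by simp
qed

text \<open>Linearity of expectation, where the object \<open>t\<close> survives iff all of
  \<open>J t\<close> is kept.\<close>

lemma bern_count:
  assumes "finite I" "finite X" "\<And>t. t \<in> X \<Longrightarrow> J t \<subseteq> I"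
  shows "(\<Sum>A\<in>Pow I. bern p I A * real (card {t \<in> X. J t \<subseteq> A})) = (\<Sum>t\<in>X. \<Prod>i\<in>J t. p i)"
proof -
  have "(\<Sum>A\<in>Pow I. bern p I A * real (card {t \<in> X. J t \<subseteq> A})) = (\<Sum>A\<in>Pow I. \<Sum>t\<in>X. if J t \<subseteq> A then bern p I A else 0)"
  proof (rule sum.cong[OF refl])
    fix A
    have "real (card {t \<in> X. J t \<subseteq> A}) = (\<Sum>t\<in>X. if J t \<subseteq> A then 1 else 0)"
      using assms(2) by (simp add: sum.If_cases Int_def)
    then show "bern p I A * real (card {t \<in> X. J t \<subseteq> A}) = (\<Sum>t\<in>X. if J t \<subseteq> A then bern p I A else 0)"
      by (simp add: sum_distrib_left if_distrib cong: if_cong)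
  qed
  also have "\<dots> = (\<Sum>t\<in>X. \<Sum>A\<in>Pow I. if J t \<subseteq> A then bern p I A else 0)" by (rule sum.swap)
  also have "\<dots> = (\<Sum>t\<in>X. \<Prod>i\<in>J t. p i)" using assms by (intro sum.cong refl bern_superset) auto
  finally show ?thesis .
qed

text \<open>Keep every vertex and every demand independently with probabilities \<open>p\<close> and \<open>q\<close> and take expectations in
  the previous inequality, applied to the demands that are kept together with both endpoints.\<close>

lemma sampled_demands:
  fixes x y :: "'d \<Rightarrow> 'a"
  assumes "sym E" "\<not> (\<exists>B. kmodel E V B h)" "finite V" "finite D"
    and D: "\<And>d. d \<in> D \<Longrightarrow> x d \<in> V \<and> y d \<in> V \<and> x d \<noteq> y d \<and> conn E (P d) \<and> x d \<in> P d \<and> y d \<in> P d \<and> P d \<subseteq> V"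
    and p: "\<And>v. v \<in> V \<Longrightarrow> 0 \<le> p v \<and> p v \<le> 1" and q: "\<And>d. d \<in> D \<Longrightarrow> 0 \<le> q d \<and> q d \<le> (1 :: real)"
  shows "(\<Sum>d\<in>D. p (x d) * p (y d) * q d) \<le> 2 ^ (h * h) * (\<Sum>v\<in>V. p v) +
     (\<Sum>(d, d')\<in>{(d, d'). d \<in> D \<and> d' \<in> D \<and> {x d, y d} = {x d', y d'}}. p (x d) * p (y d) * q d * q d') +
     (\<Sum>(d, d')\<in>{(d, d'). d \<in> D \<and> d' \<in> D \<and> P d \<inter> P d' \<noteq> {}}. (p (x d) * p (y d) * q d) * (p (x d') * p (y d') * q d'))"
proof -
  define I :: "('a + 'd) set" where "I = Inl ` V \<union> Inr ` D"
  define pr :: "'a + 'd \<Rightarrow> real" where "pr = case_sum p q"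
  have finI: "finite I" using assms by (simp add: I_def)
  have pr: "0 \<le> pr i \<and> pr i \<le> 1" if "i \<in> I" for i using that p q by (auto simp: I_def pr_def)
  define Jd where "Jd d = {Inl (x d), Inl (y d), Inr d :: 'a + 'd}" for d
  define Jv where "Jv v = {Inl v :: 'a + 'd}" for v
  define Jp where "Jp t = Jd (fst t) \<union> Jd (snd t)" for t
  \<comment> \<open>The two kinds of bad pairs survive with different probabilities. Parallel
    demands share both endpoints, so each vertex factor occurs once; crossing pairs have four
    different endpoints, and their probability is the product of those of the two demands.\<close>
  define par where "par = {(d, d'). d \<in> D \<and> d' \<in> D \<and> d \<noteq> d' \<and> {x d, y d} = {x d', y d'}}"
  define cr where "cr = {(d, d'). d \<in> D \<and> d' \<in> D \<and> d \<noteq> d' \<and> {x d, y d} \<inter> {x d', y d'} = {} \<and> P d \<inter> P d' \<noteq> {}}"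
  have fin: "finite par" "finite cr"
    by (rule finite_subset[of _ "D \<times> D"]; use assms(4) in \<open>auto simp: par_def cr_def\<close>)+
  have JI: "Jd d \<subseteq> I" if "d \<in> D" for d using D[OF that] that by (auto simp: Jd_def I_def)
  have JpI: "Jp t \<subseteq> I" if "fst t \<in> D" "snd t \<in> D" for t
    unfolding Jp_def by (intro Un_least JI that)
  have step: "real (card {d \<in> D. Jd d \<subseteq> A}) \<le> 2 ^ (h * h) * real (card {v \<in> V. Jv v \<subseteq> A}) +
      real (card {t \<in> par. Jp t \<subseteq> A}) + real (card {t \<in> cr. Jp t \<subseteq> A})" if "A \<subseteq> I" for A
  proof -
    define K where "K = {d \<in> D. Jd d \<subseteq> A}"
    define B where "B = {v \<in> V. Jv v \<subseteq> A}"
    have "card K \<le> 2 ^ (h * h) * card B + card {(d, d'). d \<in> K \<and> d' \<in> K \<and> d \<noteq> d' \<and> bad_pair x y P d d'}"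
      using D assms(3,4) by (intro demands_minus_bad_pairs[OF assms(1,2)]) (auto simp: K_def B_def Jd_def Jv_def)
    also have "{(d, d'). d \<in> K \<and> d' \<in> K \<and> d \<noteq> d' \<and> bad_pair x y P d d'} = {t \<in> par. Jp t \<subseteq> A} \<union> {t \<in> cr. Jp t \<subseteq> A}"
      unfolding K_def par_def cr_def Jp_def bad_pair_def by (intro Set.set_eqI) (simp only: mem_Collect_eq case_prod_beta Un_iff Un_subset_iff fst_conv snd_conv, blast)
    also have "card \<dots> \<le> card {t \<in> par. Jp t \<subseteq> A} + card {t \<in> cr. Jp t \<subseteq> A}" by (rule card_Un_le)
    finally have "card K \<le> 2 ^ (h * h) * card B + (card {t \<in> par. Jp t \<subseteq> A} + card {t \<in> cr. Jp t \<subseteq> A})" by simp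
    then have "real (card K) \<le> real (2 ^ (h * h) * card B + (card {t \<in> par. Jp t \<subseteq> A} + card {t \<in> cr. Jp t \<subseteq> A}))"
      by (rule of_nat_mono)
    then show ?thesis by (simp add: K_def B_def)
  qed
  have "(\<Sum>A\<in>Pow I. bern pr I A * real (card {d \<in> D. Jd d \<subseteq> A})) \<le>
     (\<Sum>A\<in>Pow I. bern pr I A * (2 ^ (h * h) * real (card {v \<in> V. Jv v \<subseteq> A}) +
      real (card {t \<in> par. Jp t \<subseteq> A}) + real (card {t \<in> cr. Jp t \<subseteq> A})))"
    using pr by (intro sum_mono mult_left_mono step bern_nonneg) auto
  also have "\<dots> = 2 ^ (h * h) * (\<Sum>A\<in>Pow I. bern pr I A * real (card {v \<in> V. Jv v \<subseteq> A})) +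
      (\<Sum>A\<in>Pow I. bern pr I A * real (card {t \<in> par. Jp t \<subseteq> A})) + (\<Sum>A\<in>Pow I. bern pr I A * real (card {t \<in> cr. Jp t \<subseteq> A}))"
    by (simp add: sum.distrib sum_distrib_left algebra_simps)
  also have "(\<Sum>A\<in>Pow I. bern pr I A * real (card {v \<in> V. Jv v \<subseteq> A})) = (\<Sum>v\<in>V. p v)"
    using bern_count[OF finI assms(3), of Jv pr] by (simp add: Jv_def I_def pr_def)
  also have "(\<Sum>A\<in>Pow I. bern pr I A * real (card {t \<in> par. Jp t \<subseteq> A})) = (\<Sum>t\<in>par. \<Prod>i\<in>Jp t. pr i)"
    by (rule bern_count[OF finI fin(1)]) (rule JpI; auto simp: par_def)
  also have "(\<Sum>A\<in>Pow I. bern pr I A * real (card {t \<in> cr. Jp t \<subseteq> A})) = (\<Sum>t\<in>cr. \<Prod>i\<in>Jp t. pr i)"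
    by (rule bern_count[OF finI fin(2)]) (rule JpI; auto simp: cr_def)
  also have "(\<Sum>A\<in>Pow I. bern pr I A * real (card {d \<in> D. Jd d \<subseteq> A})) = (\<Sum>d\<in>D. \<Prod>i\<in>Jd d. pr i)"
    by (rule bern_count[OF finI assms(4) JI])
  also have "(\<Sum>d\<in>D. \<Prod>i\<in>Jd d. pr i) = (\<Sum>d\<in>D. p (x d) * p (y d) * q d)"
    using D by (intro sum.cong refl) (simp add: Jd_def pr_def)
  finally have main: "(\<Sum>d\<in>D. p (x d) * p (y d) * q d) \<le> 2 ^ (h * h) * (\<Sum>v\<in>V. p v) +
      (\<Sum>t\<in>par. \<Prod>i\<in>Jp t. pr i) + (\<Sum>t\<in>cr. \<Prod>i\<in>Jp t. pr i)" .
  have "(\<Sum>t\<in>par. \<Prod>i\<in>Jp t. pr i) = (\<Sum>(d, d')\<in>par. p (x d) * p (y d) * q d * q d')"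
  proof (rule sum.cong[OF refl])
    fix t assume "t \<in> par"
    then obtain d d' where t: "t = (d, d')" "d \<in> D" "d' \<in> D" "d \<noteq> d'" "{x d, y d} = {x d', y d'}" by (auto simp: par_def)
    have "Jp t = {Inl (x d), Inl (y d), Inr d, Inr d'}" using t by (auto simp: Jp_def Jd_def)
    then show "(\<Prod>i\<in>Jp t. pr i) = (case t of (d, d') \<Rightarrow> p (x d) * p (y d) * q d * q d')"
      using t D[OF t(2)] by (simp add: pr_def)
  qed
  \<comment> \<open>Admitting further pairs, such as the diagonal ones, only enlarges the sum, since
    all terms are nonnegative.\<close>
  also have "\<dots> \<le> (\<Sum>(d, d')\<in>{(d, d'). d \<in> D \<and> d' \<in> D \<and> {x d, y d} = {x d', y d'}}. p (x d) * p (y d) * q d * q d')"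
  proof (rule sum_mono2)
    show "finite {(d, d'). d \<in> D \<and> d' \<in> D \<and> {x d, y d} = {x d', y d'}}"
      by (rule finite_subset[of _ "D \<times> D"]) (use assms(4) in auto)
  qed (use D p q in \<open>auto simp: par_def\<close>)
  finally have 1: "(\<Sum>t\<in>par. \<Prod>i\<in>Jp t. pr i) \<le> \<dots>" .
  have "(\<Sum>t\<in>cr. \<Prod>i\<in>Jp t. pr i) = (\<Sum>(d, d')\<in>cr. (p (x d) * p (y d) * q d) * (p (x d') * p (y d') * q d'))"
  proof (rule sum.cong[OF refl])
    fix t assume "t \<in> cr"
    then obtain d d' where t: "t = (d, d')" "d \<in> D" "d' \<in> D" "d \<noteq> d'" "{x d, y d} \<inter> {x d', y d'} = {}" by (auto simp: cr_def)
    have "(\<Prod>i\<in>Jd d \<union> Jd d'. pr i) = (\<Prod>i\<in>Jd d. pr i) * (\<Prod>i\<in>Jd d'. pr i)"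
      using t by (intro prod.union_disjoint) (auto simp: Jd_def)
    then show "(\<Prod>i\<in>Jp t. pr i) = (case t of (d, d') \<Rightarrow> (p (x d) * p (y d) * q d) * (p (x d') * p (y d') * q d'))"
      using t D[OF t(2)] D[OF t(3)] by (simp add: Jp_def Jd_def pr_def)
  qed
  also have "\<dots> \<le> (\<Sum>(d, d')\<in>{(d, d'). d \<in> D \<and> d' \<in> D \<and> P d \<inter> P d' \<noteq> {}}. (p (x d) * p (y d) * q d) * (p (x d') * p (y d') * q d'))"
  proof (rule sum_mono2)
    show "finite {(d, d'). d \<in> D \<and> d' \<in> D \<and> P d \<inter> P d' \<noteq> {}}"
      by (rule finite_subset[of _ "D \<times> D"]) (use assms(4) in auto)
  qed (use D p q in \<open>auto simp: cr_def\<close>)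
  finally have 2: "(\<Sum>t\<in>cr. \<Prod>i\<in>Jp t. pr i) \<le> \<dots>" .
  show ?thesis using main 1 2 by linarith
qed

section \<open>Congestion of routings\<close>

lemma card_ordered_pairs:
  fixes T :: "'a :: linorder set"
  assumes "finite T"
  shows "2 * card {(u, v). u \<in> T \<and> v \<in> T \<and> u < v} = card T * (card T - 1)"
proof -
  define L where "L = {(u, v). u \<in> T \<and> v \<in> T \<and> u < v}"
  have fin: "finite L" by (rule finite_subset[of _ "T \<times> T"]) (use assms in \<open>auto simp: L_def\<close>)
  have "T \<times> T = (L \<union> prod.swap ` L) \<union> (\<lambda>v. (v, v)) ` T"
    by (auto simp: L_def image_iff)
  moreover have "card ((L \<union> prod.swap ` L) \<union> (\<lambda>v. (v, v)) ` T) = card (L \<union> prod.swap ` L) + card ((\<lambda>v. (v, v)) ` T)"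
    using fin assms by (intro card_Un_disjoint) (auto simp: L_def)
  moreover have "card (L \<union> prod.swap ` L) = card L + card (prod.swap ` L)"
    using fin by (intro card_Un_disjoint) (auto simp: L_def)
  moreover have "card (prod.swap ` L) = card L" by (intro card_image) auto
  moreover have "card ((\<lambda>v. (v, v)) ` T) = card T" by (intro card_image) (auto simp: inj_on_def)
  ultimately have "card T * card T = 2 * card L + card T" by (metis card_cartesian_product mult_2)
  then show ?thesis unfolding L_def[symmetric] by (simp add: diff_mult_distrib2)
qed

text \<open>Vertices are sampled with probability \<open>sqrt (\<sigma> * a v)\<close>, where \<open>a v\<close> counts the sets containing \<open>v\<close>. Where
  this exceeds 1, the endpoints of the demands alone already cause enough congestion.\<close>

lemma congestion:
  fixes S :: "nat \<Rightarrow> 'a :: linorder set" and P :: "nat \<Rightarrow> 'a \<Rightarrow> 'a \<Rightarrow> 'a set"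
  assumes "sym E" "\<not> (\<exists>B. kmodel E V B h)" "finite V" and r: "2 \<le> r" and N: "0 < N"
    and S: "\<And>i. i < N \<Longrightarrow> S i \<subseteq> V \<and> card (S i) = r"
    and P: "\<And>i u v. i < N \<Longrightarrow> u \<in> S i \<Longrightarrow> v \<in> S i \<Longrightarrow> u < v \<Longrightarrow>
        conn E (P i u v) \<and> u \<in> P i u v \<and> v \<in> P i u v \<and> P i u v \<subseteq> V"
  defines "D \<equiv> {(i, u, v). i < N \<and> u \<in> S i \<and> v \<in> S i \<and> u < v}"
  shows "2 * card D = N * (r * (r - 1))"
    and "(real (card D))\<^sup>2 * (real r / (8192 * (2 ^ (h * h))\<^sup>2 * real (card V))) \<le>
      (\<Sum>v\<in>V. (real (card {(i, u, u'). (i, u, u') \<in> D \<and> v \<in> P i u u'}))\<^sup>2)"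
proof -
  define x where "x d = fst (snd d)" for d :: "nat \<times> 'a \<times> 'a"
  define y where "y d = snd (snd d)" for d :: "nat \<times> 'a \<times> 'a"
  define PP where "PP d = P (fst d) (x d) (y d)" for d
  define a where "a v = card {i. i < N \<and> v \<in> S i}" for v
  define m where "m = card D"
  define n where "n = card V"
  define C :: real where "C = 2 ^ (h * h)"
  define c where "c v = card {d \<in> D. v \<in> PP d}" for v
  define e where "e v = card {d \<in> D. v = x d \<or> v = y d}" for v
  define X where "X = (\<Sum>v\<in>V. (real (c v))\<^sup>2)"
  have finS: "finite (S i)" if "i < N" for i using S[OF that] assms(3) finite_subset by blast
  have Dmem: "fst d < N" "x d \<in> S (fst d)" "y d \<in> S (fst d)" "x d < y d" if "d \<in> D" for d
    using that by (auto simp: D_def x_def y_def)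
  have finD: "finite D"
  proof (rule finite_subset)
    show "D \<subseteq> {..<N} \<times> V \<times> V" using S by (auto simp: D_def)
  qed (use assms(3) in auto)
  have DP: "x d \<in> V \<and> y d \<in> V \<and> x d \<noteq> y d \<and> conn E (PP d) \<and> x d \<in> PP d \<and> y d \<in> PP d \<and> PP d \<subseteq> V"
    if "d \<in> D" for d
    using P[OF Dmem[OF that]] conjunct1[OF S[OF Dmem(1)[OF that]]] Dmem(2,3)[OF that]
      less_imp_neq[OF Dmem(4)[OF that]] unfolding PP_def by blast
  have D_Sigma: "D = (SIGMA i:{..<N}. {(u, v). u \<in> S i \<and> v \<in> S i \<and> u < v})"
    by (auto simp: D_def)
  have "finite {(u, v). u \<in> S i \<and> v \<in> S i \<and> u < v}" if "i < N" for i
    by (rule finite_subset[of _ "S i \<times> S i"]) (use finS[OF that] in auto)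
  then have "card D = (\<Sum>i<N. card {(u, v). u \<in> S i \<and> v \<in> S i \<and> u < v})"
    unfolding D_Sigma by (intro card_SigmaI) auto
  then have "2 * card D = (\<Sum>i<N. 2 * card {(u, v). u \<in> S i \<and> v \<in> S i \<and> u < v})"
    by (simp add: sum_distrib_left)
  also have "\<dots> = (\<Sum>i<N. r * (r - 1))"
    using S finS by (intro sum.cong refl) (simp add: card_ordered_pairs)
  finally show cD: "2 * card D = N * (r * (r - 1))" by simp
  then have m_eq: "real m = real N * real r * (real r - 1) / 2"
  proof -
    have "real (2 * card D) = real (N * (r * (r - 1)))" by (simp only: cD)
    then show ?thesis using r by (simp add: m_def of_nat_diff)
  qed
  have m_pos: "0 < real m" unfolding m_eq using r N by simp
  have m_ge: "real N * real r * real r / 4 \<le> real m"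
  proof -
    have "real N * real r * (real r / 2) \<le> real N * real r * (real r - 1)"
      using r by (intro mult_left_mono) auto
    then show ?thesis by (simp add: m_eq)
  qed
  have n_ge: "r \<le> n" using S[OF N] assms(3) by (metis card_mono n_def)
  have n_pos: "0 < real n" using n_ge r by simp
  have C_pos: "1 \<le> C" by (simp add: C_def)
  \<comment> \<open>By Cauchy-Schwarz the vertex term is at most
    \<open>C * sqrt (\<sigma> * n * N * r)\<close>; this value of \<open>\<sigma>\<close> makes that
    equal to \<open>\<sigma> * m / 32\<close>.\<close>
  define \<sigma> where "\<sigma> = 1024 * C\<^sup>2 * real n * real N * real r / (real m)\<^sup>2"
  have \<sigma>: "0 < \<sigma>" using n_pos N r m_pos C_pos by (simp add: \<sigma>_def)
  have sum_a: "(\<Sum>v\<in>V. real (a v)) = real N * real r"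
  proof -
    have "(\<Sum>v\<in>V. real (a v)) = (\<Sum>v\<in>V. \<Sum>i<N. if v \<in> S i then 1 else 0)"
    proof (rule sum.cong[OF refl])
      fix v
      have "{i. i < N \<and> v \<in> S i} = {..<N} \<inter> {i. v \<in> S i}" by auto
      then show "real (a v) = (\<Sum>i<N. if v \<in> S i then 1 else 0)" by (simp add: a_def sum.If_cases)
    qed
    also have "\<dots> = (\<Sum>i<N. \<Sum>v\<in>V. if v \<in> S i then 1 else 0)" by (rule sum.swap)
    also have "\<dots> = (\<Sum>i<N. real r)"
    proof (rule sum.cong[OF refl])
      fix i assume "i \<in> {..<N}"
      then have "V \<inter> S i = S i" "card (S i) = r" using S by auto
      then show "(\<Sum>v\<in>V. if v \<in> S i then 1 else 0) = real r" using assms(3) by (simp add: sum.If_cases)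
    qed
    finally show ?thesis by simp
  qed
  have e_c: "e v \<le> c v" for v
    unfolding e_def c_def using finD DP by (intro card_mono) auto
  have e_a: "a v * (r - 1) \<le> e v" for v
  proof -
    define W where "W = (SIGMA i:{i. i < N \<and> v \<in> S i}. S i - {v})"
    define f where "f = (\<lambda>(i :: nat, u). (i, min u v, max u v))"
    have "card W = (\<Sum>i\<in>{i. i < N \<and> v \<in> S i}. card (S i - {v}))"
      unfolding W_def using finS by (intro card_SigmaI) auto
    also have "\<dots> = (\<Sum>i\<in>{i. i < N \<and> v \<in> S i}. r - 1)"
      using S finS by (intro sum.cong refl) (auto simp: card_Diff_singleton)
    also have "\<dots> = a v * (r - 1)" by (simp add: a_def)
    finally have cW: "card W = a v * (r - 1)" .
    have "inj_on f W" by (auto simp: inj_on_def f_def W_def min_def max_def split: if_splits)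
    moreover have "f ` W \<subseteq> {d \<in> D. v = x d \<or> v = y d}"
      by (auto simp: f_def W_def D_def x_def y_def min_def max_def)
    ultimately have "card W \<le> e v" unfolding e_def using finD by (intro card_inj_on_le) auto
    then show ?thesis using cW by simp
  qed
  have "real m / (2 * \<sigma>) \<le> X"
  proof -
    define heavy where "heavy = {v \<in> V. 1 < \<sigma> * real (a v)}"
    define DL where "DL = {d \<in> D. x d \<notin> heavy \<and> y d \<notin> heavy}"
    have finL: "finite DL" using finD by (simp add: DL_def)
    have DLD: "d \<in> D" if "d \<in> DL" for d using that by (simp add: DL_def)
    show ?thesis
    proof (cases "real (card DL) < real m / 2")
      \<comment> \<open>At least half of the demands end in a heavy vertex. There
        \<open>c v >= e v >= a v >= 1 / \<sigma>\<close>, so the square of \<open>c v\<close> is at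
        least \<open>e v / \<sigma>\<close>, and summing over heavy vertices suffices.\<close>
      case True
      have "D - DL \<subseteq> (\<Union>v\<in>heavy. {d \<in> D. v = x d \<or> v = y d})" by (auto simp: DL_def)
      then have "card (D - DL) \<le> card (\<Union>v\<in>heavy. {d \<in> D. v = x d \<or> v = y d})"
        using finD assms(3) by (intro card_mono) (auto simp: heavy_def)
      also have "\<dots> \<le> (\<Sum>v\<in>heavy. e v)" unfolding e_def using assms(3) by (intro card_UN_le) (auto simp: heavy_def)
      finally have "real (card (D - DL)) \<le> (\<Sum>v\<in>heavy. real (e v))" by (simp flip: of_nat_sum)
      moreover have "card DL + card (D - DL) = m"
        using finD finL card_Un_disjoint[of DL "D - DL"] DLD unfolding m_def
        by (metis Diff_disjoint Un_Diff_cancel Un_absorb1 finite_Diff subsetI)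
      ultimately have he: "real m / 2 \<le> (\<Sum>v\<in>heavy. real (e v))" using True by linarith
      have "(real m / 2) / \<sigma> \<le> (\<Sum>v\<in>heavy. real (e v)) / \<sigma>" using he \<sigma> by (intro divide_right_mono) auto
      also have "\<dots> = (\<Sum>v\<in>heavy. real (e v) * (1 / \<sigma>))" by (simp add: sum_divide_distrib)
      also have "\<dots> \<le> (\<Sum>v\<in>heavy. (real (c v))\<^sup>2)"
      proof (rule sum_mono)
        fix v assume "v \<in> heavy"
        then have "1 / \<sigma> \<le> real (a v)" using \<sigma> by (simp add: heavy_def pos_divide_le_eq mult.commute)
        also have "a v * 1 \<le> a v * (r - 1)" using r by (intro mult_le_mono2) auto
        then have "real (a v) \<le> real (e v)" using e_a[of v] by linarith
        finally have "1 / \<sigma> \<le> real (c v)" "real (e v) \<le> real (c v)" using e_c[of v] by linarith+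
        then show "real (e v) * (1 / \<sigma>) \<le> (real (c v))\<^sup>2"
          unfolding power2_eq_square using \<sigma> by (intro mult_mono) auto
      qed
      also have "\<dots> \<le> X" unfolding X_def using assms(3) by (intro sum_mono2) (auto simp: heavy_def)
      finally show ?thesis by (simp add: mult.commute)
    next
      case False
      define p where "p v = (if v \<in> heavy then 0 else sqrt (\<sigma> * real (a v)))" for v
      define sq where "sq d = sqrt (real (a (x d)) * real (a (y d)))" for d
      \<comment> \<open>The demand probability compensates the vertex probabilities, so that all
        demands of \<open>DL\<close> survive with the same probability \<open>\<sigma> / 4\<close>.
        At most \<open>sq d\<close> demands share the endpoints of \<open>d\<close>; the factor 1/4
        therefore keeps the parallel term below a quarter of the main term.\<close>
      define q where "q d = 1 / (4 * sq d)" for d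
      have a1: "1 \<le> a (x d)" "1 \<le> a (y d)" if "d \<in> D" for d
      proof -
        have "fst d \<in> {i. i < N \<and> x d \<in> S i}" "fst d \<in> {i. i < N \<and> y d \<in> S i}" using Dmem[OF that] by auto
        then have "a (x d) \<noteq> 0" "a (y d) \<noteq> 0" unfolding a_def by (auto simp: card_eq_0_iff)
        then show "1 \<le> a (x d)" "1 \<le> a (y d)" by auto
      qed
      have p01: "0 \<le> p v \<and> p v \<le> 1" if "v \<in> V" for v
        using that \<sigma> by (auto simp: p_def heavy_def real_sqrt_le_1_iff)
      have sq1: "1 \<le> sq d" if "d \<in> D" for d
      proof -
        have "1 * 1 \<le> real (a (x d)) * real (a (y d))" using a1[OF that] by (intro mult_mono) auto
        then show ?thesis by (simp add: sq_def)
      qed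
      have q01: "0 \<le> q d \<and> q d \<le> 1" if "d \<in> DL" for d
        using sq1[OF DLD[OF that]] by (simp add: q_def divide_le_eq_1)
      have ppq: "p (x d) * p (y d) * q d = \<sigma> / 4" if "d \<in> DL" for d
      proof -
        have "p (x d) * p (y d) = \<sigma> * sq d"
          using that \<sigma> by (simp add: DL_def p_def sq_def real_sqrt_mult)
        then show ?thesis using sq1[OF DLD[OF that]] by (simp add: q_def)
      qed
      have main: "(\<Sum>d\<in>DL. p (x d) * p (y d) * q d) \<le> 2 ^ (h * h) * (\<Sum>v\<in>V. p v) +
         (\<Sum>(d, d')\<in>{(d, d'). d \<in> DL \<and> d' \<in> DL \<and> {x d, y d} = {x d', y d'}}. p (x d) * p (y d) * q d * q d') +
         (\<Sum>(d, d')\<in>{(d, d'). d \<in> DL \<and> d' \<in> DL \<and> PP d \<inter> PP d' \<noteq> {}}. (p (x d) * p (y d) * q d) * (p (x d') * p (y d') * q d'))"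
        by (rule sampled_demands[OF assms(1-3) finL DP[OF DLD] p01 q01])
      have L: "(\<Sum>d\<in>DL. p (x d) * p (y d) * q d) = real (card DL) * (\<sigma> / 4)"
        using sum.cong[OF refl ppq, of DL] by simp
      have par: "(\<Sum>(d, d')\<in>{(d, d'). d \<in> DL \<and> d' \<in> DL \<and> {x d, y d} = {x d', y d'}}. p (x d) * p (y d) * q d * q d')
          \<le> real (card DL) * (\<sigma> / 16)"
      proof -
        have "{(d, d'). d \<in> DL \<and> d' \<in> DL \<and> {x d, y d} = {x d', y d'}} = (SIGMA d:DL. {d' \<in> DL. {x d, y d} = {x d', y d'}})"
          by auto
        then have "(\<Sum>(d, d')\<in>{(d, d'). d \<in> DL \<and> d' \<in> DL \<and> {x d, y d} = {x d', y d'}}. p (x d) * p (y d) * q d * q d')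
          = (\<Sum>d\<in>DL. \<Sum>d'\<in>{d' \<in> DL. {x d, y d} = {x d', y d'}}. p (x d) * p (y d) * q d * q d')"
          using finL by (simp add: sum.Sigma)
        also have "\<dots> \<le> (\<Sum>d\<in>DL. \<sigma> / 16)"
        proof (rule sum_mono)
          fix d assume d: "d \<in> DL"
          define T where "T = {d' \<in> DL. {x d, y d} = {x d', y d'}}"
          have Teq: "x d' = x d \<and> y d' = y d" if "d' \<in> T" for d'
            using that Dmem(4)[OF DLD[OF d]] Dmem(4)[OF DLD[of d']] by (auto simp: T_def doubleton_eq_iff)
          have cT: "card T \<le> a (x d)" "card T \<le> a (y d)"
          proof -
            have inj: "inj_on fst T"
              using Teq by (auto simp: inj_on_def x_def y_def prod_eq_iff)
            have fin: "finite {i. i < N \<and> v \<in> S i}" for v by simp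
            have "fst ` T \<subseteq> {i. i < N \<and> x d \<in> S i}" "fst ` T \<subseteq> {i. i < N \<and> y d \<in> S i}"
              using Teq Dmem DLD by (fastforce simp: T_def)+
            then show "card T \<le> a (x d)" "card T \<le> a (y d)"
              unfolding a_def using card_inj_on_le[OF inj] fin by blast+
          qed
          have "real (card T) * real (card T) \<le> real (a (x d)) * real (a (y d))"
            using cT by (intro mult_mono) auto
          then have "real (card T) \<le> sq d"
            unfolding sq_def by (intro real_le_rsqrt) (simp add: power2_eq_square)
          then have cTq: "real (card T) * q d \<le> 1 / 4"
            using sq1[OF DLD[OF d]] by (simp add: q_def pos_divide_le_eq)
          have "(\<Sum>d'\<in>T. p (x d) * p (y d) * q d * q d') = (\<Sum>d'\<in>T. \<sigma> / 4 * q d)"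
          proof (rule sum.cong[OF refl])
            fix d' assume "d' \<in> T"
            then have "q d' = q d" using Teq by (simp add: q_def sq_def)
            then show "p (x d) * p (y d) * q d * q d' = \<sigma> / 4 * q d" by (simp only: ppq[OF d])
          qed
          also have "\<dots> = \<sigma> / 4 * (real (card T) * q d)" by simp
          also have "\<dots> \<le> \<sigma> / 4 * (1 / 4)" using cTq \<sigma> by (intro mult_left_mono) auto
          finally show "(\<Sum>d'\<in>{d' \<in> DL. {x d, y d} = {x d', y d'}}. p (x d) * p (y d) * q d * q d') \<le> \<sigma> / 16"
            by (simp add: T_def)
        qed
        finally show ?thesis by simp
      qed
      have cross: "(\<Sum>(d, d')\<in>{(d, d'). d \<in> DL \<and> d' \<in> DL \<and> PP d \<inter> PP d' \<noteq> {}}. (p (x d) * p (y d) * q d) * (p (x d') * p (y d') * q d'))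
          \<le> \<sigma>\<^sup>2 / 16 * X"
      proof -
        define T where "T = {(d, d'). d \<in> DL \<and> d' \<in> DL \<and> PP d \<inter> PP d' \<noteq> {}}"
        have "(\<Sum>(d, d')\<in>T. (p (x d) * p (y d) * q d) * (p (x d') * p (y d') * q d')) = (\<Sum>t\<in>T. \<sigma>\<^sup>2 / 16)"
        proof (intro sum.cong refl)
          fix t assume "t \<in> T"
          then obtain d d' where t: "t = (d, d')" "d \<in> DL" "d' \<in> DL" by (auto simp: T_def)
          show "(case t of (d, d') \<Rightarrow> (p (x d) * p (y d) * q d) * (p (x d') * p (y d') * q d')) = \<sigma>\<^sup>2 / 16"
            unfolding t(1) prod.case ppq[OF t(2)] ppq[OF t(3)] by (simp add: power2_eq_square)
        qed
        also have "\<dots> = \<sigma>\<^sup>2 / 16 * real (card T)" by simp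
        \<comment> \<open>Two intersecting routes share a vertex, so the pairs are counted by the
          squared congestion.\<close>
        also have "card T \<le> card (\<Union>v\<in>V. {d \<in> D. v \<in> PP d} \<times> {d \<in> D. v \<in> PP d})"
          using DP DLD finD assms(3) by (intro card_mono) (fastforce simp: T_def)+
        then have "card T \<le> (\<Sum>v\<in>V. card ({d \<in> D. v \<in> PP d} \<times> {d \<in> D. v \<in> PP d}))"
          using card_UN_le[OF assms(3)] by (rule order_trans)
        then have "real (card T) \<le> X"
          by (simp add: X_def c_def power2_eq_square card_cartesian_product flip: of_nat_mult of_nat_sum)
        then have "\<sigma>\<^sup>2 / 16 * real (card T) \<le> \<sigma>\<^sup>2 / 16 * X" by (intro mult_left_mono) auto
        finally show ?thesis by (simp add: T_def)
      qed
      have sum_p: "C * (\<Sum>v\<in>V. p v) \<le> \<sigma> * real m / 32"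
      proof -
        \<comment> \<open>AM-GM with the optimal parameter \<open>l = sqrt (\<sigma> * N * r / n)\<close>\<close>
        define l where "l = 32 * C * real N * real r / real m"
        have l: "0 < l" using C_pos N r m_pos by (simp add: l_def)
        have "(\<Sum>v\<in>V. p v) \<le> (\<Sum>v\<in>V. \<sigma> / (2 * l) * real (a v) + l / 2)"
        proof (rule sum_mono)
          fix v
          define s where "s = sqrt (\<sigma> * real (a v))"
          have s2: "s * s = \<sigma> * real (a v)" using \<sigma> by (simp add: s_def)
          have "0 \<le> (s - l) * (s - l)" by simp
          then have "2 * l * s \<le> \<sigma> * real (a v) + l * l" using s2 by (simp add: algebra_simps)
          then have "s \<le> \<sigma> / (2 * l) * real (a v) + l / 2" using l by (simp add: field_simps)
          moreover have "p v \<le> s" using \<sigma> by (simp add: p_def s_def)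
          ultimately show "p v \<le> \<sigma> / (2 * l) * real (a v) + l / 2" by linarith
        qed
        also have "\<dots> = \<sigma> / (2 * l) * (real N * real r) + real n * (l / 2)"
          by (simp only: sum.distrib sum_distrib_left[symmetric] sum_a) (simp add: n_def)
        finally have "C * (\<Sum>v\<in>V. p v) \<le> C * (\<sigma> / (2 * l) * (real N * real r) + real n * (l / 2))"
          using C_pos by (intro mult_left_mono) auto
        also have "\<dots> = \<sigma> * real m / 32"
          using C_pos N r m_pos by (simp add: l_def \<sigma>_def field_simps power2_eq_square)
        finally show ?thesis .
      qed
      \<comment> \<open>As \<open>card DL\<close> is at least \<open>m / 2\<close>, the main term
        minus the parallel term is at least \<open>3 * \<sigma> * m / 32\<close>. The vertex term
        takes a third of this, and \<open>\<sigma> * m / 16\<close> is left for the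
        crossings.\<close>
      have "real (card DL) * (\<sigma> / 4) \<le> \<sigma> * real m / 32 + real (card DL) * (\<sigma> / 16) + \<sigma>\<^sup>2 / 16 * X"
        using main L par cross sum_p unfolding C_def by linarith
      moreover have "real m / 2 * (\<sigma> * 3 / 16) \<le> real (card DL) * (\<sigma> * 3 / 16)"
        using False \<sigma> by (intro mult_right_mono) auto
      ultimately have "\<sigma> * real m \<le> \<sigma> * (\<sigma> * X)" by (simp add: power2_eq_square field_simps)
      then have "real m \<le> \<sigma> * X" using \<sigma> by simp
      then have "real m / \<sigma> \<le> X" using \<sigma> by (simp add: pos_divide_le_eq mult.commute)
      moreover have "real m / (2 * \<sigma>) \<le> real m / \<sigma>" using \<sigma> m_pos by (intro divide_left_mono) auto
      ultimately show ?thesis by linarith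
    qed
  qed
  \<comment> \<open>By the choice of \<open>\<sigma>\<close> the right-hand side is cubic in
    \<open>m\<close>. Trading one factor for \<open>N * r * r / 4\<close> makes the bound quadratic
    and free of \<open>N\<close>, which is the form required for averages over families of any
    length.\<close>
  moreover have "(real m)\<^sup>2 * (real r / (8192 * C\<^sup>2 * real n)) \<le> real m / (2 * \<sigma>)"
  proof -
    have "(real m)\<^sup>2 * (real r / (8192 * C\<^sup>2 * real n)) = (real m)\<^sup>2 / (2048 * C\<^sup>2 * real n * real N * real r) * (real N * real r * real r / 4)"
      using C_pos N r n_pos by (simp add: field_simps)
    also have "\<dots> \<le> (real m)\<^sup>2 / (2048 * C\<^sup>2 * real n * real N * real r) * real m"
      using m_ge C_pos by (intro mult_left_mono) auto
    also have "\<dots> = real m / (2 * \<sigma>)"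
      using C_pos N r n_pos m_pos by (simp add: \<sigma>_def field_simps power2_eq_square)
    finally show ?thesis .
  qed
  ultimately have "(real m)\<^sup>2 * (real r / (8192 * C\<^sup>2 * real n)) \<le> X" by linarith
  moreover have "c v = card {(i, u, u'). (i, u, u') \<in> D \<and> v \<in> P i u u'}" for v
    unfolding c_def PP_def x_def y_def by (intro arg_cong[of _ _ card]) auto
  ultimately show "(real (card D))\<^sup>2 * (real r / (8192 * (2 ^ (h * h))\<^sup>2 * real (card V))) \<le>
      (\<Sum>v\<in>V. (real (card {(i, u, u'). (i, u, u') \<in> D \<and> v \<in> P i u u'}))\<^sup>2)"
    by (simp add: m_def C_def n_def X_def)
qed

section \<open>Spreading weights\<close>

lemma sum_list_replicate_concat:
  "sum_list (map f (concat (replicate n xs))) = real n * sum_list (map f xs)" for f :: "'b \<Rightarrow> real"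
  by (induction n) (auto simp: algebra_simps)

lemma sum_list_bounds:
  assumes "\<And>z. z \<in> set zs \<Longrightarrow> 0 \<le> f z \<and> f z \<le> (1 :: real)"
  shows "0 \<le> sum_list (map f zs)" "sum_list (map f zs) \<le> real (length zs)"
  using assms by (induction zs) (auto simp: add_nonneg_nonneg intro: add_mono)

text \<open>\<open>\<omega>\<close> is a multiple of a point of almost minimal norm in the convex hull of \<open>Z\<close>. Averages of finite lists
  stand in for convex combinations, and an approximate minimiser makes compactness unnecessary.\<close>

lemma min_norm_duality:
  fixes Z :: "('a \<Rightarrow> real) set" and \<beta> :: real
  assumes V: "finite V" and \<beta>: "0 < \<beta>"
    and Z01: "\<And>z v. z \<in> Z \<Longrightarrow> v \<in> V \<Longrightarrow> 0 \<le> z v \<and> z v \<le> 1"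
    and lower: "\<And>zs. zs \<noteq> [] \<Longrightarrow> set zs \<subseteq> Z \<Longrightarrow> \<beta> * (real (length zs))\<^sup>2 \<le> (\<Sum>v\<in>V. (\<Sum>z\<leftarrow>zs. z v)\<^sup>2)"
  shows "\<exists>\<omega>. (\<forall>v. 0 \<le> \<omega> v) \<and> (\<Sum>v\<in>V. (\<omega> v)\<^sup>2) \<le> 4 / \<beta> \<and> (\<forall>z\<in>Z. 1 \<le> (\<Sum>v\<in>V. \<omega> v * z v))"
proof (cases "Z = {}")
  case True
  then show ?thesis using \<beta> by (intro exI[of _ "\<lambda>_. 0"]) simp
next
  case False
  then obtain z0 where z0: "z0 \<in> Z" by blast
  define avg where "avg zs v = (\<Sum>z\<leftarrow>zs. z v) / real (length zs)" for zs :: "('a \<Rightarrow> real) list" and v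
  define N where "N zs = (\<Sum>v\<in>V. (avg zs v)\<^sup>2)" for zs
  define L where "L = {zs. zs \<noteq> [] \<and> set zs \<subseteq> Z}"
  have N\<beta>: "\<beta> \<le> N zs" if "zs \<in> L" for zs
  proof -
    have "N zs = (\<Sum>v\<in>V. (\<Sum>z\<leftarrow>zs. z v)\<^sup>2) / (real (length zs))\<^sup>2"
      by (simp add: N_def avg_def power_divide sum_divide_distrib)
    then show ?thesis using lower[of zs] that by (simp add: L_def pos_le_divide_eq)
  qed
  have bdd: "bdd_below (N ` L)" using N\<beta> by (intro bdd_belowI[of _ \<beta>]) auto
  define I where "I = Inf (N ` L)"
  have Ile: "I \<le> N zs" if "zs \<in> L" for zs unfolding I_def using that bdd by (intro cInf_lower) auto
  have neL: "N ` L \<noteq> {}" using z0 by (auto simp: L_def intro!: exI[of _ "[z0]"])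
  obtain M where M: "2 * real (card V) / \<beta> \<le> real M" using real_arch_simple by blast
  \<comment> \<open>The step size is the reciprocal of an integer so that
    \<open>(1 - s) * c + s * z\<close> is again the average of a list: \<open>M\<close> copies of
    \<open>zs\<close> followed by \<open>length zs\<close> copies of \<open>z\<close>.\<close>
  define s where "s = 1 / (real M + 1)"
  have s: "0 < s" "s \<le> 1" by (auto simp: s_def)
  have sn: "s * real (card V) \<le> \<beta> / 2"
  proof -
    have "2 * real (card V) \<le> real M * \<beta>" using M \<beta> by (simp add: pos_divide_le_eq)
    also have "\<dots> \<le> (real M + 1) * \<beta>" using \<beta> by simp
    finally show ?thesis by (simp add: s_def field_simps)
  qed
  \<comment> \<open>The slack is proportional to \<open>s\<close>. After division by
    \<open>s\<close>, it and the second-order term of the step contribute at most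
    \<open>\<beta> / 2\<close> each, and \<open>\<beta>\<close> is at most the squared norm of
    \<open>c\<close>.\<close>
  have "I < I + s * \<beta> / 2" using s \<beta> by simp
  then obtain zs where zs: "zs \<in> L" "N zs < I + s * \<beta> / 2"
    using cInf_lessD[OF neL, of "I + s * \<beta> / 2"] by (auto simp: I_def)
  define c where "c v = avg zs v" for v
  have len: "0 < length zs" using zs by (simp add: L_def)
  have c01: "0 \<le> c v" "c v \<le> 1" if "v \<in> V" for v
  proof -
    have "\<And>z. z \<in> set zs \<Longrightarrow> 0 \<le> z v \<and> z v \<le> 1" using zs Z01 that by (auto simp: L_def)
    then have "0 \<le> (\<Sum>z\<leftarrow>zs. z v)" "(\<Sum>z\<leftarrow>zs. z v) \<le> real (length zs)"
      using sum_list_bounds[of zs "\<lambda>z. z v"] by auto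
    then show "0 \<le> c v" "c v \<le> 1" using len by (auto simp: c_def avg_def)
  qed
  have aux: "0 \<le> 2 * (a - b) + \<beta> \<Longrightarrow> \<beta> \<le> b \<Longrightarrow> b / 2 \<le> a" for a b by (simp add: field_simps)
  have main: "(\<Sum>v\<in>V. (c v)\<^sup>2) / 2 \<le> (\<Sum>v\<in>V. c v * z v)" if z: "z \<in> Z" for z
  proof -
    define ys where "ys = concat (replicate M zs) @ replicate (length zs) z"
    have ysL: "ys \<in> L" using z zs len by (auto simp: ys_def L_def)
    have lys: "length ys = length zs * (M + 1)" by (simp add: ys_def length_concat sum_list_replicate)
    have avg_ys: "avg ys v = c v + s * (z v - c v)" for v
    proof -
      have "(\<Sum>z\<leftarrow>ys. z v) = real M * (\<Sum>z\<leftarrow>zs. z v) + real (length zs) * z v"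
        by (simp add: ys_def sum_list_replicate_concat sum_list_replicate map_replicate)
      also have "(\<Sum>z\<leftarrow>zs. z v) = real (length zs) * c v" using len by (simp add: c_def avg_def)
      finally have "avg ys v = (real (length zs) * (real M * c v + z v)) / (real (length zs) * (real M + 1))"
        unfolding avg_def lys by (simp add: algebra_simps)
      also have "\<dots> = (real M * c v + z v) / (real M + 1)" using len by simp
      also have "\<dots> = c v + s * (z v - c v)" by (simp add: s_def field_simps)
      finally show ?thesis .
    qed
    have "I \<le> N ys" by (rule Ile[OF ysL])
    also have "N ys = (\<Sum>v\<in>V. (c v)\<^sup>2 + 2 * s * (c v * z v - (c v)\<^sup>2) + s\<^sup>2 * (z v - c v)\<^sup>2)"
      unfolding N_def avg_ys by (intro sum.cong refl) (simp add: power2_eq_square algebra_simps)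
    also have "\<dots> \<le> (\<Sum>v\<in>V. (c v)\<^sup>2 + 2 * s * (c v * z v - (c v)\<^sup>2) + s\<^sup>2 * 1)"
    proof (intro sum_mono add_left_mono mult_left_mono)
      fix v assume "v \<in> V"
      then have "\<bar>z v - c v\<bar> \<le> 1" using Z01[OF z] c01 by (simp add: abs_le_iff) (smt (verit))
      then show "(z v - c v)\<^sup>2 \<le> 1" by (simp add: abs_square_le_1)
    qed simp
    also have "\<dots> = N zs + 2 * s * ((\<Sum>v\<in>V. c v * z v) - (\<Sum>v\<in>V. (c v)\<^sup>2)) + s\<^sup>2 * real (card V)"
      by (simp add: N_def c_def sum.distrib sum_distrib_left sum_subtractf right_diff_distrib)
    finally have "I \<le> N zs + 2 * s * ((\<Sum>v\<in>V. c v * z v) - (\<Sum>v\<in>V. (c v)\<^sup>2)) + s * (s * real (card V))"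
      by (simp add: power2_eq_square)
    moreover have "s * (s * real (card V)) \<le> s * (\<beta> / 2)" using sn s by (intro mult_left_mono) auto
    ultimately have "0 \<le> s * (2 * ((\<Sum>v\<in>V. c v * z v) - (\<Sum>v\<in>V. (c v)\<^sup>2)) + \<beta>)"
      using zs(2) by (simp add: algebra_simps)
    then have "0 \<le> 2 * ((\<Sum>v\<in>V. c v * z v) - (\<Sum>v\<in>V. (c v)\<^sup>2)) + \<beta>"
      using s by (simp add: zero_le_mult_iff)
    moreover have "\<beta> \<le> (\<Sum>v\<in>V. (c v)\<^sup>2)" using N\<beta>[OF zs(1)] by (simp add: N_def c_def)
    ultimately show ?thesis using aux by blast
  qed
  define n where "n = (\<Sum>v\<in>V. (c v)\<^sup>2)"
  have n: "\<beta> \<le> n" "0 < n" using N\<beta>[OF zs(1)] \<beta> by (simp_all add: N_def c_def n_def)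
  \<comment> \<open>Scaling by \<open>2 / n\<close> turns the lower bound \<open>n / 2\<close> from
    \<open>main\<close> into 1, and the squared norm \<open>n\<close> of \<open>c\<close> into
    \<open>4 / n\<close>.\<close>
  define \<omega> where "\<omega> v = (if v \<in> V then 2 * c v / n else 0)" for v
  have "(\<Sum>v\<in>V. (\<omega> v)\<^sup>2) = (\<Sum>v\<in>V. 4 / n\<^sup>2 * (c v)\<^sup>2)"
    by (intro sum.cong refl) (simp add: \<omega>_def power2_eq_square)
  also have "\<dots> = 4 / n\<^sup>2 * n" by (simp only: sum_distrib_left[symmetric] n_def)
  also have "\<dots> = 4 / n" using n by (simp add: power2_eq_square)
  also have "\<dots> \<le> 4 / \<beta>" using n \<beta> by (simp add: frac_le)
  finally have "(\<Sum>v\<in>V. (\<omega> v)\<^sup>2) \<le> 4 / \<beta>" .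
  moreover have "1 \<le> (\<Sum>v\<in>V. \<omega> v * z v)" if "z \<in> Z" for z
  proof -
    have "(\<Sum>v\<in>V. \<omega> v * z v) = 2 / n * (\<Sum>v\<in>V. c v * z v)"
      unfolding sum_distrib_left by (intro sum.cong refl) (simp add: \<omega>_def)
    moreover have "2 / n * (n / 2) \<le> 2 / n * (\<Sum>v\<in>V. c v * z v)"
      using main[OF that] n by (intro mult_left_mono) (auto simp: n_def)
    ultimately show ?thesis using n by simp
  qed
  moreover have "0 \<le> \<omega> v" for v using c01 n by (simp add: \<omega>_def)
  ultimately show ?thesis by blast
qed

text \<open>Duality is applied to the congestion vectors of single \<open>r\<close>-sets with a
  routing; lists of these are the families treated in \<open>congestion\<close>. If all pairs in
  \<open>Q\<close> were joined by sets of weight below 1, routing \<open>r\<close> vertices of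
  \<open>Q\<close> along these sets would give a congestion vector whose pairing with
  \<open>\<omega>\<close> is below 1.\<close>

lemma spreading_weight:
  fixes V :: "'a :: linorder set"
  assumes symE: "sym E" and no: "\<not> (\<exists>B. kmodel E V B h)" and fin: "finite V" and r: "2 \<le> r"
  shows "\<exists>\<omega>. (\<forall>v. 0 \<le> \<omega> v) \<and> (\<Sum>v\<in>V. (\<omega> v)\<^sup>2) \<le> 32768 * (2 ^ (h * h))\<^sup>2 * real (card V) / real r \<and>
     (\<forall>Q\<subseteq>V. conn E Q \<longrightarrow> r \<le> card Q \<longrightarrow>
        (\<exists>x\<in>Q. \<exists>y\<in>Q. \<forall>P. P \<subseteq> V \<and> conn E P \<and> x \<in> P \<and> y \<in> P \<longrightarrow> (1 :: real) \<le> sum \<omega> P))"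
proof (cases "V = {}")
  case True
  then have "\<not> r \<le> card Q" if "Q \<subseteq> V" for Q using that r by simp
  then show ?thesis using True by (intro exI[of _ "\<lambda>_. 0"]) auto
next
  case False
  define n where "n = card V"
  have n: "0 < real n" using False fin by (simp add: n_def card_gt_0_iff)
  define pr where "pr S = {(u, u'). u \<in> S \<and> u' \<in> S \<and> u < u'}" for S :: "'a set"
  define p where "p = real (r * (r - 1)) / 2"
  have p0: "0 < p" using r by (simp add: p_def)
  define adm where "adm S P \<longleftrightarrow> S \<subseteq> V \<and> card S = r \<and>
    (\<forall>u\<in>S. \<forall>v\<in>S. u < v \<longrightarrow> conn E (P u v) \<and> u \<in> P u v \<and> v \<in> P u v \<and> P u v \<subseteq> V)" for S :: "'a set" and P
  have finp: "finite (pr S)" if "finite S" for S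
    by (rule finite_subset[of _ "S \<times> S"]) (use that in \<open>auto simp: pr_def\<close>)
  have cardp: "real (card (pr S)) = p" if "finite S" "card S = r" for S
  proof -
    have "real (2 * card (pr S)) = real (r * (r - 1))"
      using card_ordered_pairs[OF that(1)] that(2) by (simp only: pr_def)
    then show ?thesis by (simp add: p_def)
  qed
  \<comment> \<open>Division by the number \<open>p\<close> of pairs keeps the entries in the unit
    interval and makes the total demand of each vector 1.\<close>
  define zf where "zf S P v = real (card {(u, u'). (u, u') \<in> pr S \<and> v \<in> P u u'}) / p"
    for S :: "'a set" and P :: "'a \<Rightarrow> 'a \<Rightarrow> 'a set" and v
  define Z where "Z = {z. \<exists>S P. adm S P \<and> z = zf S P}"
  define \<beta> where "\<beta> = real r / (8192 * (2 ^ (h * h))\<^sup>2 * real n)"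
  have \<beta>: "0 < \<beta>" using r n by (simp add: \<beta>_def)
  have Z01: "0 \<le> z v \<and> z v \<le> 1" if z: "z \<in> Z" for z v
  proof -
    obtain S P where S: "adm S P" "z = zf S P" using z unfolding Z_def by blast
    have finS: "finite S" using S(1) fin finite_subset by (auto simp: adm_def)
    have "card {(u, u'). (u, u') \<in> pr S \<and> v \<in> P u u'} \<le> card (pr S)"
      using finp[OF finS] by (intro card_mono) auto
    then have "real (card {(u, u'). (u, u') \<in> pr S \<and> v \<in> P u u'}) \<le> real (card (pr S))"
      by (rule of_nat_mono)
    also have "\<dots> = p" using cardp[OF finS] S(1) by (simp add: adm_def)
    finally have "real (card {(u, u'). (u, u') \<in> pr S \<and> v \<in> P u u'}) \<le> p" .
    then show ?thesis using p0 by (simp add: S(2) zf_def)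
  qed
  have lower: "\<beta> * (real (length zs))\<^sup>2 \<le> (\<Sum>v\<in>V. (\<Sum>z\<leftarrow>zs. z v)\<^sup>2)"
    if zs: "zs \<noteq> []" "set zs \<subseteq> Z" for zs
  proof -
    define N where "N = length zs"
    have N: "0 < N" using zs by (simp add: N_def)
    have "\<forall>i. \<exists>SP. i < N \<longrightarrow> adm (fst SP) (snd SP) \<and> zs ! i = zf (fst SP) (snd SP)"
    proof
      fix i
      show "\<exists>SP. i < N \<longrightarrow> adm (fst SP) (snd SP) \<and> zs ! i = zf (fst SP) (snd SP)"
      proof (cases "i < N")
        case True
        then have "zs ! i \<in> Z" using zs by (auto simp: N_def)
        then obtain S P where "adm S P" "zs ! i = zf S P" unfolding Z_def by blast
        then show ?thesis by (intro exI[of _ "(S, P)"]) simp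
      qed simp
    qed
    then obtain SP where SP: "\<And>i. i < N \<Longrightarrow> adm (fst (SP i)) (snd (SP i)) \<and> zs ! i = zf (fst (SP i)) (snd (SP i))"
      by metis
    define S where "S i = fst (SP i)" for i
    define P where "P i = snd (SP i)" for i
    have adm: "adm (S i) (P i)" and zi: "zs ! i = zf (S i) (P i)" if "i < N" for i
      using SP[OF that] by (simp_all add: S_def P_def)
    have finS: "finite (S i)" if "i < N" for i using adm[OF that] fin finite_subset by (auto simp: adm_def)
    define D where "D = {(i, u, v). i < N \<and> u \<in> S i \<and> v \<in> S i \<and> u < v}"
    have cong: "2 * card D = N * (r * (r - 1))"
      "(real (card D))\<^sup>2 * (real r / (8192 * (2 ^ (h * h))\<^sup>2 * real (card V))) \<le>
      (\<Sum>v\<in>V. (real (card {(i, u, u'). (i, u, u') \<in> D \<and> v \<in> P i u u'}))\<^sup>2)"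
    proof -
      have aS: "S i \<subseteq> V \<and> card (S i) = r" if "i < N" for i using adm[OF that] by (simp add: adm_def)
      have aP: "conn E (P i u v) \<and> u \<in> P i u v \<and> v \<in> P i u v \<and> P i u v \<subseteq> V"
        if "i < N" "u \<in> S i" "v \<in> S i" "u < v" for i u v
        using adm[OF that(1)] that(2-4) unfolding adm_def by blast
      show "2 * card D = N * (r * (r - 1))"
        unfolding D_def by (rule congestion(1)[OF symE no fin r N]) (erule aS, erule (3) aP)
      show "(real (card D))\<^sup>2 * (real r / (8192 * (2 ^ (h * h))\<^sup>2 * real (card V))) \<le>
        (\<Sum>v\<in>V. (real (card {(i, u, u'). (i, u, u') \<in> D \<and> v \<in> P i u u'}))\<^sup>2)"
        unfolding D_def by (rule congestion(2)[OF symE no fin r N]) (erule aS, erule (3) aP)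
    qed
    have "real (2 * card D) = real (N * (r * (r - 1)))" by (simp only: cong(1))
    then have cD: "real (card D) = real N * p" by (simp add: p_def)
    have cc: "real (card {(i, u, u'). (i, u, u') \<in> D \<and> v \<in> P i u u'}) = p * (\<Sum>z\<leftarrow>zs. z v)" for v
    proof -
      have "{(i, u, u'). (i, u, u') \<in> D \<and> v \<in> P i u u'} = (SIGMA i:{..<N}. {(u, u'). (u, u') \<in> pr (S i) \<and> v \<in> P i u u'})"
        by (auto simp: D_def pr_def)
      moreover have "finite {(u, u'). (u, u') \<in> pr (S i) \<and> v \<in> P i u u'}" if "i < N" for i
        by (rule finite_subset[OF _ finp[OF finS[OF that]]]) auto
      ultimately have "card {(i, u, u'). (i, u, u') \<in> D \<and> v \<in> P i u u'} = (\<Sum>i<N. card {(u, u'). (u, u') \<in> pr (S i) \<and> v \<in> P i u u'})"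
        by simp
      then have "real (card {(i, u, u'). (i, u, u') \<in> D \<and> v \<in> P i u u'}) = (\<Sum>i<N. p * (zs ! i) v)"
        using p0 zi by (simp add: zf_def)
      also have "\<dots> = p * (\<Sum>i<N. map (\<lambda>z. z v) zs ! i)" by (simp add: sum_distrib_left N_def)
      also have "(\<Sum>i<N. map (\<lambda>z. z v) zs ! i) = (\<Sum>z\<leftarrow>zs. z v)"
        by (simp add: sum_list_sum_nth N_def atLeast0LessThan)
      finally show ?thesis .
    qed
    have "(real N * p)\<^sup>2 * \<beta> \<le> (\<Sum>v\<in>V. (p * (\<Sum>z\<leftarrow>zs. z v))\<^sup>2)"
      using cong(2) unfolding cc cD \<beta>_def n_def .
    also have "\<dots> = p\<^sup>2 * (\<Sum>v\<in>V. (\<Sum>z\<leftarrow>zs. z v)\<^sup>2)" by (simp add: power_mult_distrib sum_distrib_left)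
    finally have "p\<^sup>2 * (\<beta> * (real N)\<^sup>2) \<le> p\<^sup>2 * (\<Sum>v\<in>V. (\<Sum>z\<leftarrow>zs. z v)\<^sup>2)" by (simp add: power_mult_distrib mult_ac)
    then show ?thesis using p0 by (simp add: N_def)
  qed
  have "\<exists>\<omega>. (\<forall>v. 0 \<le> \<omega> v) \<and> (\<Sum>v\<in>V. (\<omega> v)\<^sup>2) \<le> 4 / \<beta> \<and> (\<forall>z\<in>Z. 1 \<le> (\<Sum>v\<in>V. \<omega> v * z v))"
    by (rule min_norm_duality[OF fin \<beta>]) (erule Z01, erule (1) lower)
  then obtain \<omega> where \<omega>: "\<forall>v. 0 \<le> \<omega> v" "(\<Sum>v\<in>V. (\<omega> v)\<^sup>2) \<le> 4 / \<beta>" "\<forall>z\<in>Z. 1 \<le> (\<Sum>v\<in>V. \<omega> v * z v)"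
    by blast
  have "\<exists>x\<in>Q. \<exists>y\<in>Q. \<forall>P. P \<subseteq> V \<and> conn E P \<and> x \<in> P \<and> y \<in> P \<longrightarrow> 1 \<le> sum \<omega> P"
    if Q: "Q \<subseteq> V" "conn E Q" "r \<le> card Q" for Q
  proof (rule ccontr)
    assume "\<not> ?thesis"
    then have "\<forall>x. \<forall>y. \<exists>P. x \<in> Q \<and> y \<in> Q \<longrightarrow> P \<subseteq> V \<and> conn E P \<and> x \<in> P \<and> y \<in> P \<and> sum \<omega> P < 1"
      by (metis not_le)
    then obtain P where P: "\<And>x y. x \<in> Q \<Longrightarrow> y \<in> Q \<Longrightarrow> P x y \<subseteq> V \<and> conn E (P x y) \<and> x \<in> P x y \<and> y \<in> P x y \<and> sum \<omega> (P x y) < 1"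
      by metis
    obtain S where S: "S \<subseteq> Q" "card S = r" "finite S" using obtain_subset_with_card_n[OF Q(3)] by blast
    have "adm S P" unfolding adm_def using S Q(1) P by blast
    then have "1 \<le> (\<Sum>v\<in>V. \<omega> v * zf S P v)" using \<omega>(3) by (auto simp: Z_def)
    then have "p \<le> p * (\<Sum>v\<in>V. \<omega> v * zf S P v)" using p0 by simp
    also have "\<dots> = (\<Sum>v\<in>V. \<omega> v * real (card {(u, u'). (u, u') \<in> pr S \<and> v \<in> P u u'}))"
      unfolding sum_distrib_left using p0 by (intro sum.cong refl) (simp add: zf_def)
    also have "\<dots> = (\<Sum>v\<in>V. \<Sum>t\<in>pr S. if v \<in> P (fst t) (snd t) then \<omega> v else 0)"
    proof (rule sum.cong[OF refl])
      fix v
      have "{(u, u'). (u, u') \<in> pr S \<and> v \<in> P u u'} = pr S \<inter> {t. v \<in> P (fst t) (snd t)}" by auto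
      then show "\<omega> v * real (card {(u, u'). (u, u') \<in> pr S \<and> v \<in> P u u'}) = (\<Sum>t\<in>pr S. if v \<in> P (fst t) (snd t) then \<omega> v else 0)"
        using finp[OF S(3)] by (simp add: sum.If_cases)
    qed
    also have "\<dots> = (\<Sum>t\<in>pr S. \<Sum>v\<in>V. if v \<in> P (fst t) (snd t) then \<omega> v else 0)" by (rule sum.swap)
    also have "\<dots> < (\<Sum>t\<in>pr S. 1)"
    proof (rule sum_strict_mono)
      show "finite (pr S)" by (rule finp[OF S(3)])
      show "pr S \<noteq> {}" using cardp[OF S(3,2)] p0 by auto
      fix t assume "t \<in> pr S"
      then have t: "fst t \<in> Q" "snd t \<in> Q" using S(1) by (auto simp: pr_def)
      have "V \<inter> P (fst t) (snd t) = P (fst t) (snd t)" using P[OF t] by blast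
      then show "(\<Sum>v\<in>V. if v \<in> P (fst t) (snd t) then \<omega> v else 0) < 1"
        using P[OF t] fin by (simp add: sum.If_cases)
    qed
    also have "\<dots> = p" using cardp[OF S(3,2)] by simp
    finally show False by simp
  qed
  moreover have "4 / \<beta> = 32768 * (2 ^ (h * h))\<^sup>2 * real (card V) / real r"
    using r n by (simp add: \<beta>_def n_def field_simps)
  ultimately show ?thesis using \<omega>(1,2) by (intro exI[of _ \<omega>]) simp
qed

section \<open>Iterated distance layers\<close>

text \<open>Strict positivity makes the distance drop strictly from a vertex to its predecessor;
  \<open>pot_induct\<close> and the descents depend on it.\<close>

locale weighted =
  fixes E :: "('a \<times> 'a) set" and w :: "'a \<Rightarrow> real"
  assumes sym: "sym E" and pos: "\<And>v. 0 < w v"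
begin

text \<open>The distance of \<open>x\<close> and \<open>y\<close> in \<open>Q\<close> is the least weight of a connected subset of \<open>Q\<close> containing both
  (so \<open>x\<close> has distance \<open>w x\<close> from itself); \<open>pot Q x \<rho>\<close> characterises \<open>\<rho>\<close> as the distance from \<open>x\<close> in \<open>Q\<close>.\<close>

definition far :: "'a set \<Rightarrow> real \<Rightarrow> 'a \<Rightarrow> 'a \<Rightarrow> bool" where
  "far Q s x y \<longleftrightarrow> (\<forall>P. P \<subseteq> Q \<and> conn E P \<and> x \<in> P \<and> y \<in> P \<longrightarrow> s \<le> sum w P)"

definition pot :: "'a set \<Rightarrow> 'a \<Rightarrow> ('a \<Rightarrow> real) \<Rightarrow> bool" where
  "pot Q x \<rho> \<longleftrightarrow> finite Q \<and> x \<in> Q \<and> \<rho> x = w x \<and>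
     (\<forall>v\<in>Q. v \<noteq> x \<longrightarrow> (\<exists>u\<in>Q. (u, v) \<in> E \<and> \<rho> v = \<rho> u + w v)) \<and>
     (\<forall>u\<in>Q. \<forall>v\<in>Q. (u, v) \<in> E \<longrightarrow> \<rho> v \<le> \<rho> u + w v)"

lemma edge_sym: "(u, v) \<in> E \<Longrightarrow> (v, u) \<in> E"
  using sym by (rule symD)

lemma conn_Un_meet: "conn E A \<Longrightarrow> conn E B \<Longrightarrow> A \<inter> B \<noteq> {} \<Longrightarrow> conn E (A \<union> B)"
  by (rule conn_Un[OF sym]) auto

lemma sum_w_Un: "finite A \<Longrightarrow> finite B \<Longrightarrow> sum w (A \<union> B) \<le> sum w A + sum w B"
  using pos sum_nonneg[of "A \<inter> B" w] by (simp add: sum_Un less_imp_le)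

lemma sum_w_mono: "A \<subseteq> B \<Longrightarrow> finite B \<Longrightarrow> sum w A \<le> sum w B"
  using pos by (intro sum_mono2) (auto simp: less_imp_le)

text \<open>For the predecessor of \<open>v\<close>, take a cheapest connected set \<open>P\<close>
  for \<open>v\<close> and the component of \<open>x\<close> in \<open>P - {v}\<close>. It contains
  a neighbour of \<open>v\<close> and weighs at most \<open>\<rho> v - w v\<close>.\<close>

lemma pot_exists:
  assumes "finite Q" "conn E Q" "x \<in> Q"
  obtains \<rho> where "pot Q x \<rho>"
proof -
  define \<P> where "\<P> v = {P. P \<subseteq> Q \<and> conn E P \<and> x \<in> P \<and> v \<in> P}" for v
  define \<rho> where "\<rho> v = Min (sum w ` \<P> v)" for v
  have fin: "finite (\<P> v)" for v using assms(1) by (simp add: \<P>_def)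
  have Q: "Q \<in> \<P> v" if "v \<in> Q" for v using that assms by (simp add: \<P>_def)
  have le: "\<rho> v \<le> sum w P" if "P \<in> \<P> v" for v P
    unfolding \<rho>_def using that fin by (intro Min_le) auto
  have ex: "\<exists>P\<in>\<P> v. \<rho> v = sum w P" if "v \<in> Q" for v
  proof -
    have "\<rho> v \<in> sum w ` \<P> v" unfolding \<rho>_def using fin Q[OF that] by (intro Min_in) auto
    then show ?thesis by blast
  qed
  have finP: "finite P" "v \<in> P" "x \<in> P" "conn E P" "P \<subseteq> Q" if "P \<in> \<P> v" for P v
    using that assms(1) finite_subset by (auto simp: \<P>_def)
  have edge: "\<rho> v \<le> \<rho> u + w v" if uv: "u \<in> Q" "v \<in> Q" "(u, v) \<in> E" for u v
  proof -
    obtain P where P: "P \<in> \<P> u" "\<rho> u = sum w P" using ex[OF uv(1)] by blast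
    note fP = finP[OF P(1)]
    have "conn E (insert v P)" by (rule conn_insert[OF sym fP(4,2) uv(3)])
    then have "insert v P \<in> \<P> v" using fP uv by (simp add: \<P>_def)
    then have "\<rho> v \<le> sum w (insert v P)" by (rule le)
    also have "\<dots> \<le> sum w P + w v" using sum_w_Un[of P "{v}"] fP by simp
    finally show ?thesis using P by simp
  qed
  have "\<rho> x = w x"
  proof -
    have "{x} \<in> \<P> x" using assms by (simp add: \<P>_def)
    then have 1: "\<rho> x \<le> w x" using le by fastforce
    obtain P where P: "P \<in> \<P> x" "\<rho> x = sum w P" using ex[OF assms(3)] by blast
    have "sum w {x} \<le> sum w P" using finP[OF P(1)] by (intro sum_w_mono) auto
    then show ?thesis using 1 P by simp
  qed
  moreover have "\<exists>u\<in>Q. (u, v) \<in> E \<and> \<rho> v = \<rho> u + w v" if v: "v \<in> Q" "v \<noteq> x" for v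
  proof -
    obtain P where P: "P \<in> \<P> v" "\<rho> v = sum w P" using ex[OF v(1)] by blast
    note fP = finP[OF P(1)]
    define Z where "Z = component E (P - {v}) x"
    have xP: "x \<in> P - {v}" using fP v by simp
    have ZP: "Z \<subseteq> P - {v}" unfolding Z_def by (rule component_subset[OF xP])
    have Zc: "conn E Z" unfolding Z_def by (rule conn_component[OF sym xP])
    have xZ: "x \<in> Z" by (simp add: Z_def)
    obtain a b where ab: "a \<in> P" "a \<in> Z" "b \<in> P" "b \<notin> Z" "(a, b) \<in> E"
      using conn_crossing[OF fP(4,3) xZ fP(2)] ZP by blast
    have "b = v"
    proof (rule ccontr)
      assume "b \<noteq> v"
      then have "b \<in> component E (P - {v}) x"
        using component_step[of a E "P - {v}" x b] ab xP unfolding Z_def by blast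
      then show False using ab by (simp add: Z_def)
    qed
    have "Z \<in> \<P> a" using ZP Zc xZ ab fP by (auto simp: \<P>_def)
    then have "\<rho> a \<le> sum w Z" by (rule le)
    also have "\<dots> \<le> sum w (P - {v})" using ZP fP by (intro sum_w_mono) auto
    also have "\<dots> = \<rho> v - w v" using P fP by (simp add: sum_diff1)
    finally have "\<rho> a \<le> \<rho> v - w v" .
    moreover have "a \<in> Q" using ab fP by blast
    moreover have "(a, v) \<in> E" using ab \<open>b = v\<close> by simp
    moreover have "\<rho> v \<le> \<rho> a + w v" using edge calculation v by blast
    ultimately show ?thesis by (intro bexI[of _ a]) auto
  qed
  ultimately have "pot Q x \<rho>" using assms edge by (simp add: pot_def)
  then show ?thesis by (rule that)
qed

lemma pot_edge_abs:
  assumes "pot Q x \<rho>" "u \<in> Q" "v \<in> Q" "(u, v) \<in> E"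
  shows "\<bar>\<rho> u - \<rho> v\<bar> \<le> max (w u) (w v)"
proof -
  have "\<rho> v \<le> \<rho> u + w v" "\<rho> u \<le> \<rho> v + w u"
    using assms edge_sym[of u v] by (auto simp: pot_def)
  then show ?thesis by linarith
qed

text \<open>A largest subset \<open>T\<close> of \<open>P\<close> on which \<open>\<rho>\<close>
  stays below \<open>\<rho> x + sum w T\<close> must contain \<open>y\<close>: any further vertex
  adjacent to \<open>T\<close> raises the potential by at most its own weight and could be
  added.\<close>

lemma pot_lip:
  assumes "pot Q x0 \<rho>" "P \<subseteq> Q" "conn E P" "x \<in> P" "y \<in> P"
  shows "\<rho> y \<le> \<rho> x + sum w P"
proof -
  define \<Phi> where "\<Phi> T \<longleftrightarrow> T \<subseteq> P \<and> x \<in> T \<and> (\<forall>z\<in>T. \<rho> z \<le> \<rho> x + sum w T)" for T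
  have finP: "finite P" using assms(1,2) unfolding pot_def by (meson finite_subset)
  have "\<Phi> {x}" using assms pos[of x] by (simp add: \<Phi>_def)
  moreover have "\<forall>T. \<Phi> T \<longrightarrow> card T < card P + 1"
    using finP by (auto simp: \<Phi>_def card_mono less_Suc_eq_le)
  ultimately have "\<exists>T. \<Phi> T \<and> (\<forall>T'. \<Phi> T' \<longrightarrow> card T' \<le> card T)"
    by (rule ex_has_greatest_nat)
  then obtain T where T: "\<Phi> T" and max: "\<And>T'. \<Phi> T' \<Longrightarrow> card T' \<le> card T" by auto
  have sub: "T \<subseteq> P" "x \<in> T" using T by (auto simp: \<Phi>_def)
  have finT: "finite T" using sub finP finite_subset by blast
  have "y \<in> T"
  proof (rule ccontr)
    assume "y \<notin> T"
    then obtain u v where uv: "u \<in> P" "u \<in> T" "v \<in> P" "v \<notin> T" "(u, v) \<in> E"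
      using conn_crossing[OF assms(3,4) sub(2) assms(5)] by metis
    have "\<rho> v \<le> \<rho> u + w v" using assms(1,2) uv unfolding pot_def by blast
    moreover have "\<rho> u \<le> \<rho> x + sum w T" using T uv by (simp add: \<Phi>_def)
    moreover have "sum w (insert v T) = w v + sum w T" using finT uv by simp
    ultimately have "\<Phi> (insert v T)"
      using T uv pos[of v] by (fastforce simp: \<Phi>_def)
    from max[OF this] show False using finT uv by simp
  qed
  then have "\<rho> y \<le> \<rho> x + sum w T" using T by (simp add: \<Phi>_def)
  also have "sum w T \<le> sum w P" using sub finP by (intro sum_w_mono)
  finally show ?thesis by simp
qed

lemma pot_pred:
  assumes "pot Q x \<rho>" "v \<in> Q" "v \<noteq> x"
  obtains u where "u \<in> Q" "(u, v) \<in> E" "\<rho> v = \<rho> u + w v" "\<rho> u < \<rho> v"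
proof -
  obtain u where "u \<in> Q" "(u, v) \<in> E" "\<rho> v = \<rho> u + w v" using assms unfolding pot_def by blast
  moreover from this have "\<rho> u < \<rho> v" using pos[of v] by simp
  ultimately show ?thesis by (rule that)
qed

lemma pot_induct [consumes 2, case_names step]:
  assumes "pot Q x \<rho>" "v \<in> Q"
    and step: "\<And>v. v \<in> Q \<Longrightarrow> (\<And>u. u \<in> Q \<Longrightarrow> \<rho> u < \<rho> v \<Longrightarrow> P u) \<Longrightarrow> P v"
  shows "P v"
  using assms(2)
proof (induction "card {u \<in> Q. \<rho> u < \<rho> v}" arbitrary: v rule: less_induct)
  case less
  have finQ: "finite Q" using assms(1) by (simp add: pot_def)
  show ?case
  proof (rule step[OF less.prems])
    fix u assume u: "u \<in> Q" "\<rho> u < \<rho> v"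
    have "{t \<in> Q. \<rho> t < \<rho> u} \<subset> {t \<in> Q. \<rho> t < \<rho> v}" using u by auto
    then have "card {t \<in> Q. \<rho> t < \<rho> u} < card {t \<in> Q. \<rho> t < \<rho> v}"
      using finQ by (intro psubset_card_mono) auto
    then show "P u" using less.hyps u by blast
  qed
qed

lemma pot_short:
  assumes "pot Q x \<rho>" "v \<in> Q"
  shows "\<exists>P. P \<subseteq> Q \<and> conn E P \<and> x \<in> P \<and> v \<in> P \<and> sum w P \<le> \<rho> v"
  using assms(1,2)
proof (induction rule: pot_induct)
  case (step v)
  show ?case
  proof (cases "v = x")
    case True
    then show ?thesis using assms(1) step(1) by (intro exI[of _ "{x}"]) (auto simp: pot_def)
  next
    case False
    obtain u where u: "u \<in> Q" "(u, v) \<in> E" "\<rho> v = \<rho> u + w v" "\<rho> u < \<rho> v"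
      using pot_pred[OF assms(1) step(1) False] .
    obtain P where P: "P \<subseteq> Q" "conn E P" "x \<in> P" "u \<in> P" "sum w P \<le> \<rho> u" using step(2)[OF u(1,4)] by blast
    have finP: "finite P" using P assms(1) finite_subset by (auto simp: pot_def)
    have "conn E (insert v P)" by (rule conn_insert[OF sym P(2,4) u(2)])
    moreover have "sum w (insert v P) \<le> \<rho> v" using sum_w_Un[of P "{v}"] finP P u by simp
    ultimately show ?thesis using P step(1) by (intro exI[of _ "insert v P"]) auto
  qed
qed

lemma pot_sublevel_conn:
  assumes "pot Q x \<rho>"
  shows "conn E {v \<in> Q. \<rho> v < b}" (is "conn E ?S")
proof -
  have *: "(x, v) \<in> (E \<inter> ?S \<times> ?S)\<^sup>*" if "v \<in> Q" "\<rho> v < b" for v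
    using assms that(1) that(2)
  proof (induction rule: pot_induct)
    case (step v)
    show ?case
    proof (cases "v = x")
      case False
      obtain u where u: "u \<in> Q" "(u, v) \<in> E" "\<rho> v = \<rho> u + w v" "\<rho> u < \<rho> v"
        using pot_pred[OF assms step(1) False] .
      then have "(x, u) \<in> (E \<inter> ?S \<times> ?S)\<^sup>*" "(u, v) \<in> E \<inter> ?S \<times> ?S" using step by auto
      then show ?thesis by (rule rtrancl_into_rtrancl)
    qed simp
  qed
  show ?thesis by (rule conn_from[OF sym, of _ x]) (use * in simp)
qed

text \<open>Follows predecessors from \<open>v\<close> until the level falls below \<open>b\<close>.
  \<open>T\<close> collects the vertices before that, \<open>z\<close> is the last of them and
  \<open>u\<close> the first one below. The weights telescope, and
  \<open>b <= \<rho> u + w z\<close> bounds the overshoot by one vertex weight. The condition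
  \<open>w x < b\<close> prevents the chain from ending too early.\<close>

lemma pot_descend:
  assumes "pot Q x \<rho>" "v \<in> Q" "b \<le> \<rho> v" "w x < b"
  shows "\<exists>T u z. T \<subseteq> Q \<and> conn E T \<and> v \<in> T \<and> (\<forall>t\<in>T. b \<le> \<rho> t \<and> \<rho> t \<le> \<rho> v) \<and> u \<in> Q \<and> \<rho> u < b \<and>
           z \<in> T \<and> (z, u) \<in> E \<and> b \<le> \<rho> u + w z \<and> sum w T = \<rho> v - \<rho> u"
  using assms(1,2,3)
proof (induction rule: pot_induct)
  case (step v)
  have "v \<noteq> x" using step assms by (auto simp: pot_def)
  then obtain u where u: "u \<in> Q" "(u, v) \<in> E" "\<rho> v = \<rho> u + w v" "\<rho> u < \<rho> v"
    using pot_pred[OF assms(1) step(1)] by metis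
  show ?case
  proof (cases "\<rho> u < b")
    case True
    then show ?thesis using u step(1,3) edge_sym[OF u(2)]
      by (intro exI[of _ "{v}"] exI[of _ u] exI[of _ v]) auto
  next
    case False
    then obtain T u' z where T: "T \<subseteq> Q" "conn E T" "u \<in> T" "\<forall>t\<in>T. b \<le> \<rho> t \<and> \<rho> t \<le> \<rho> u" "u' \<in> Q" "\<rho> u' < b"
        "z \<in> T" "(z, u') \<in> E" "b \<le> \<rho> u' + w z" "sum w T = \<rho> u - \<rho> u'"
      using step(2)[OF u(1,4)] by (auto simp: not_less)
    have "finite T" using T assms(1) finite_subset by (auto simp: pot_def)
    moreover have "v \<notin> T" using T u by force
    ultimately have "sum w (insert v T) = \<rho> v - \<rho> u'" using T u by simp
    moreover have "conn E (insert v T)" by (rule conn_insert[OF sym T(2,3) u(2)])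
    moreover have "\<forall>t\<in>insert v T. b \<le> \<rho> t \<and> \<rho> t \<le> \<rho> v" using T u step(3) by force
    ultimately show ?thesis using T step(1)
      by (intro exI[of _ "insert v T"] exI[of _ u'] exI[of _ z]) auto
  qed
qed

text \<open>The closure clause makes \<open>Q1\<close> a union of components of the layer of width
  \<open>R\<close> above level \<open>a\<close>, so a connected subset of the layer that meets
  \<open>Q1\<close> stays in \<open>Q1\<close>.\<close>

definition chop :: "real \<Rightarrow> 'a set \<Rightarrow> 'a set \<Rightarrow> bool" where
  "chop R Q Q1 \<longleftrightarrow> (\<exists>x \<rho> a. pot Q x \<rho> \<and> Q1 \<subseteq> {v \<in> Q. a \<le> \<rho> v \<and> \<rho> v < a + R} \<and>
     (\<forall>u\<in>Q1. \<forall>v\<in>Q. (u, v) \<in> E \<and> a \<le> \<rho> v \<and> \<rho> v < a + R \<longrightarrow> v \<in> Q1))"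

text \<open>Each round uses a new root and distances measured inside the set left by the previous
  round.\<close>

primrec chops :: "real \<Rightarrow> nat \<Rightarrow> 'a set \<Rightarrow> 'a set \<Rightarrow> bool" where
  "chops R 0 Q Q' \<longleftrightarrow> Q' = Q"
| "chops R (Suc m) Q Q' \<longleftrightarrow> (\<exists>Q1. chop R Q Q1 \<and> chops R m Q1 Q')"

lemma chop_subset: "chop R Q Q1 \<Longrightarrow> Q1 \<subseteq> Q"
  by (auto simp: chop_def)

lemma chops_subset: "chops R m Q Q' \<Longrightarrow> Q' \<subseteq> Q"
  by (induction m arbitrary: Q) (auto dest!: chop_subset)

text \<open>Three consecutive descents, to the levels \<open>a\<close>, \<open>a - 4 * R\<close> and
  \<open>a - 8 * R\<close>. The first part stays in \<open>Q1\<close>, the last part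
  \<open>T2\<close> ends next to the vertices below \<open>a - 8 * R\<close>, and its top
  \<open>z\<close> is well away from both. Starting below \<open>a + R\<close> and overshooting by
  at most \<open>R\<close> at the end, the tail weighs at most \<open>10 * R\<close>.\<close>

lemma pot_tail:
  assumes pot: "pot Q x \<rho>" and Q1: "Q1 \<subseteq> {v \<in> Q. a \<le> \<rho> v \<and> \<rho> v < a + R}"
    and closed: "\<And>u v. u \<in> Q1 \<Longrightarrow> v \<in> Q \<Longrightarrow> (u, v) \<in> E \<Longrightarrow> a \<le> \<rho> v \<Longrightarrow> \<rho> v < a + R \<Longrightarrow> v \<in> Q1"
    and v: "v \<in> Q1" and small: "\<And>u. u \<in> Q \<Longrightarrow> w u \<le> R" and a: "w x < a - 8 * R" and R: "0 < R"
  shows "\<exists>T0 T2 T z. T0 \<subseteq> Q1 \<and> conn E T0 \<and> v \<in> T0 \<and> sum w T0 \<le> 2 * R \<and>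
     T \<subseteq> Q \<and> conn E T \<and> v \<in> T \<and> sum w T \<le> 10 * R \<and> T2 \<subseteq> T \<and> conn E T2 \<and>
     (\<forall>t\<in>T - T0. \<rho> t < a) \<and> (\<forall>t\<in>T. a - 8 * R \<le> \<rho> t) \<and> (\<forall>t\<in>T2. \<rho> t < a) \<and>
     z \<in> T2 \<and> a - 5 * R \<le> \<rho> z \<and> \<rho> z < a - 4 * R \<and>
     (\<exists>t\<in>T2. \<exists>u\<in>Q. \<rho> u < a - 8 * R \<and> (t, u) \<in> E)"
proof -
  have finQ: "finite Q" using pot by (simp add: pot_def)
  have vQ: "v \<in> Q" "a \<le> \<rho> v" "\<rho> v < a + R" using v Q1 by auto
  obtain T0 u0 z0 where T0: "T0 \<subseteq> Q" "conn E T0" "v \<in> T0" "\<forall>t\<in>T0. a \<le> \<rho> t \<and> \<rho> t \<le> \<rho> v" "u0 \<in> Q" "\<rho> u0 < a"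
      "z0 \<in> T0" "(z0, u0) \<in> E" "a \<le> \<rho> u0 + w z0" "sum w T0 = \<rho> v - \<rho> u0"
    using pot_descend[OF pot vQ(1,2)] a R by auto
  have w0: "w z0 \<le> R" using T0 by (intro small) blast
  obtain T1 u1 z1 where T1: "T1 \<subseteq> Q" "conn E T1" "u0 \<in> T1" "\<forall>t\<in>T1. a - 4 * R \<le> \<rho> t \<and> \<rho> t \<le> \<rho> u0" "u1 \<in> Q"
      "\<rho> u1 < a - 4 * R" "z1 \<in> T1" "(z1, u1) \<in> E" "a - 4 * R \<le> \<rho> u1 + w z1" "sum w T1 = \<rho> u0 - \<rho> u1"
    using pot_descend[OF pot T0(5), of "a - 4 * R"] a R w0 T0(9) by auto
  have w1: "w z1 \<le> R" using T1 by (intro small) blast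
  obtain T2 u2 z2 where T2: "T2 \<subseteq> Q" "conn E T2" "u1 \<in> T2" "\<forall>t\<in>T2. a - 8 * R \<le> \<rho> t \<and> \<rho> t \<le> \<rho> u1" "u2 \<in> Q"
      "\<rho> u2 < a - 8 * R" "z2 \<in> T2" "(z2, u2) \<in> E" "a - 8 * R \<le> \<rho> u2 + w z2" "sum w T2 = \<rho> u1 - \<rho> u2"
    using pot_descend[OF pot T1(5), of "a - 8 * R"] a R w1 T1(9) by auto
  have w2: "w z2 \<le> R" using T2 by (intro small) blast
  have fins: "finite T0" "finite T1" "finite T2"
    using finite_subset[OF T0(1) finQ] finite_subset[OF T1(1) finQ] finite_subset[OF T2(1) finQ] .
  have "T0 \<subseteq> Q1"
  proof (rule ccontr)
    assume "\<not> ?thesis"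
    then obtain y where "y \<in> T0" "y \<notin> Q1" by blast
    then obtain s t where st: "s \<in> T0" "s \<in> Q1" "t \<in> T0" "t \<notin> Q1" "(s, t) \<in> E"
      using conn_crossing[OF T0(2,3) v] by metis
    have "t \<in> Q" "a \<le> \<rho> t" "\<rho> t < a + R" using st T0(1,4) vQ by force+
    with closed[OF st(2) _ st(5)] st show False by blast
  qed
  moreover define T where "T = T0 \<union> T1 \<union> T2"
  moreover have "conn E T"
  proof -
    have "conn E (T0 \<union> T1)" by (rule conn_Un[OF sym T0(2) T1(2)]) (use T0(7,8) T1(3) in blast)
    then show ?thesis unfolding T_def by (rule conn_Un[OF sym _ T2(2)]) (use T1(7,8) T2(3) in blast)
  qed
  moreover have "sum w T \<le> sum w T0 + sum w T1 + sum w T2"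
    unfolding T_def using sum_w_Un[of "T0 \<union> T1" T2] sum_w_Un[of T0 T1] fins by simp
  then have "sum w T \<le> 10 * R" using T0(10) T1(10) T2(10,9) w2 vQ by linarith
  moreover have "sum w T0 \<le> 2 * R" using T0(9,10) w0 vQ by linarith
  moreover have "\<forall>t\<in>T - T0. \<rho> t < a"
  proof
    fix t assume "t \<in> T - T0"
    then consider "t \<in> T1" | "t \<in> T2" by (auto simp: T_def)
    then show "\<rho> t < a"
    proof cases
      case 1 then show ?thesis using T1(4) T0(6) by force
    next
      case 2 then show ?thesis using T2(4) T1(6) R by force
    qed
  qed
  moreover have "\<forall>t\<in>T. a - 8 * R \<le> \<rho> t"
    using T0(4) T1(4) T2(4) R by (fastforce simp: T_def)
  moreover have "\<forall>t\<in>T2. \<rho> t < a" using T2(4) T1(6) R by force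
  moreover have "T \<subseteq> Q" using T0 T1 T2 by (simp add: T_def)
  moreover have "a - 5 * R \<le> \<rho> u1" using T1(9) w1 by linarith
  moreover have "T2 \<subseteq> T" "v \<in> T" using T0 by (auto simp: T_def)
  ultimately show ?thesis using T0(2,3) T1(6) T2(2,3,5,6,7,8)
    by - (rule exI[of _ T0], rule exI[of _ T2], rule exI[of _ T], rule exI[of _ u1], intro conjI,
        (assumption | blast)+)
qed

text \<open>The sublevel set below the layer \<open>Q1\<close> serves as a new branch set, reached by descending from the tips \<open>u i\<close>.
  Distances in \<open>Q\<close> may be shorter than in \<open>Q1\<close>, so the separation of the old tips from the branch sets is lost in
  \<open>Q\<close>; the new tips are therefore moved to a level well between \<open>Q1\<close> and the new branch set.\<close>

lemma chop_extend:
  fixes B :: "nat \<Rightarrow> 'a set" and u s :: "nat \<Rightarrow> 'a"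
  assumes pot: "pot Q x \<rho>" and Q1: "Q1 \<subseteq> {v \<in> Q. a \<le> \<rho> v \<and> \<rho> v < a + R}"
    and closed: "\<And>u v. u \<in> Q1 \<Longrightarrow> v \<in> Q \<Longrightarrow> (u, v) \<in> E \<Longrightarrow> a \<le> \<rho> v \<Longrightarrow> \<rho> v < a + R \<Longrightarrow> v \<in> Q1"
    and small: "\<And>u. u \<in> Q \<Longrightarrow> w u \<le> R" and R: "0 < R" and QV: "Q \<subseteq> V" and finV: "finite V"
    and model: "kmodel E Q1 B (Suc m)"
    and uB: "\<And>i. i \<le> m \<Longrightarrow> u i \<in> B i"
    and near: "\<And>i. i \<le> Suc m \<Longrightarrow> N i \<subseteq> V \<and> conn E (N i) \<and> s i \<in> N i \<and> u i \<in> N i \<and> sum w (N i) \<le> D"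
    and sep: "\<And>i j P. i \<le> m \<Longrightarrow> j \<le> m \<Longrightarrow> i \<noteq> j \<Longrightarrow> P \<subseteq> Q1 \<Longrightarrow> conn E P \<Longrightarrow> u i \<in> P \<Longrightarrow> P \<inter> B j \<noteq> {} \<Longrightarrow> 3 * R \<le> sum w P"
    and uS: "u (Suc m) \<in> Q1"
    and far: "\<And>i j. i \<le> Suc m \<Longrightarrow> j \<le> Suc m \<Longrightarrow> i \<noteq> j \<Longrightarrow> far V \<Lambda> (s i) (s j)"
    and \<Lambda>: "2 * D + 40 * R \<le> \<Lambda>"
  shows "\<exists>B' u' N'. kmodel E Q B' (Suc (Suc m)) \<and> (\<forall>i\<le>Suc m. u' i \<in> B' i) \<and>
     (\<forall>i\<le>Suc m. N' i \<subseteq> V \<and> conn E (N' i) \<and> s i \<in> N' i \<and> u' i \<in> N' i \<and> sum w (N' i) \<le> D + 10 * R) \<and>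
     (\<forall>i\<le>Suc m. \<forall>j\<le>Suc m. i \<noteq> j \<longrightarrow> (\<forall>P. P \<subseteq> Q \<and> conn E P \<and> u' i \<in> P \<and> P \<inter> B' j \<noteq> {} \<longrightarrow> 3 * R \<le> sum w P))"
proof -
  have finQ: "finite Q" using pot by (simp add: pot_def)
  have Q1Q: "Q1 \<subseteq> Q" using Q1 by blast
  have Q1\<rho>: "a \<le> \<rho> v" if "v \<in> Q1" for v using Q1 that by blast
  have B: "B i \<noteq> {}" "B i \<subseteq> Q1" "conn E (B i)" if "i \<le> m" for i
    using model that by (auto simp: kmodel_def less_Suc_eq_le)
  have Bdis: "B i \<inter> B j = {}" "\<exists>x\<in>B i. \<exists>y\<in>B j. (x, y) \<in> E" if "i \<le> m" "j \<le> m" "i \<noteq> j" for i j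
    using model that by (auto simp: kmodel_def less_Suc_eq_le)
  have uQ1: "u i \<in> Q1" if "i \<le> Suc m" for i
    using that uS uB[of i] B(2)[of i] by (cases "i = Suc m") auto
  \<comment> \<open>A set \<open>S\<close> meeting both \<open>N i\<close> and \<open>N j\<close>
    joins them to a connected set containing \<open>s i\<close> and \<open>s j\<close>, so
    \<open>far\<close> bounds its weight from below.\<close>
  have linked: "\<Lambda> \<le> sum w (N i) + sum w S + sum w (N j)"
    if "i \<le> Suc m" "j \<le> Suc m" "i \<noteq> j" "S \<subseteq> V" "conn E S" "S \<inter> N i \<noteq> {}" "S \<inter> N j \<noteq> {}" for i j S
  proof -
    have fin: "finite (N i)" "finite (N j)" "finite S"
      using near[OF that(1)] near[OF that(2)] that(4) finV finite_subset by auto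
    have "conn E (N i \<union> S)" by (rule conn_Un_meet) (use near[OF that(1)] that in auto)
    then have "conn E (N i \<union> S \<union> N j)" by (rule conn_Un_meet) (use near[OF that(2)] that in auto)
    then have "\<Lambda> \<le> sum w (N i \<union> S \<union> N j)"
      using far[OF that(1-3)] near[OF that(1)] near[OF that(2)] that(4) unfolding far_def by auto
    then show ?thesis using sum_w_Un[of "N i \<union> S" "N j"] sum_w_Un[of "N i" S] fin by simp
  qed
  \<comment> \<open>There is room for the descents: otherwise every tip is within
    \<open>10 * R\<close> of \<open>x\<close>, and the tips \<open>0\<close> and
    \<open>Suc m\<close> would be joined through \<open>x\<close> at cost \<open>20 * R\<close>,
    which \<open>linked\<close> excludes.\<close>
  have a: "w x < a - 8 * R"
  proof (rule ccontr)
    assume "\<not> ?thesis"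
    moreover have "w x \<le> R" using pot by (intro small) (simp add: pot_def)
    ultimately have a9: "a \<le> 9 * R" by linarith
    have "\<exists>P. P \<subseteq> Q \<and> conn E P \<and> x \<in> P \<and> u i \<in> P \<and> sum w P \<le> 10 * R" if i: "i \<le> Suc m" for i
    proof -
      have "u i \<in> Q" "\<rho> (u i) \<le> 10 * R" using uQ1[OF i] Q1 a9 by auto
      moreover from this obtain P where "P \<subseteq> Q \<and> conn E P \<and> x \<in> P \<and> u i \<in> P \<and> sum w P \<le> \<rho> (u i)"
        using pot_short[OF pot, of "u i"] by blast
      ultimately show ?thesis by (intro exI[of _ P]) auto
    qed
    from this[of 0] this[of "Suc m"] obtain P P' where
      P: "P \<subseteq> Q" "conn E P" "x \<in> P" "u 0 \<in> P" "sum w P \<le> 10 * R" and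
      P': "P' \<subseteq> Q" "conn E P'" "x \<in> P'" "u (Suc m) \<in> P'" "sum w P' \<le> 10 * R" by auto
    have "conn E (P \<union> P')" by (rule conn_Un_meet) (use P P' in auto)
    then have "\<Lambda> \<le> sum w (N 0) + sum w (P \<union> P') + sum w (N (Suc m))"
      using near[of 0] near[of "Suc m"] P P' QV by (intro linked) auto
    moreover have "sum w (P \<union> P') \<le> 20 * R"
      using sum_w_Un[of P P'] finite_subset[OF P(1) finQ] finite_subset[OF P'(1) finQ] P P' by simp
    moreover have "sum w (N 0) \<le> D" "sum w (N (Suc m)) \<le> D" using near by auto
    ultimately show False using \<Lambda> R by linarith
  qed
  define tl where "tl v t \<longleftrightarrow> (case t of (T0, T2, T, z) \<Rightarrow> T0 \<subseteq> Q1 \<and> conn E T0 \<and> v \<in> T0 \<and> sum w T0 \<le> 2 * R \<and>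
     T \<subseteq> Q \<and> conn E T \<and> v \<in> T \<and> sum w T \<le> 10 * R \<and> T2 \<subseteq> T \<and> conn E T2 \<and>
     (\<forall>t\<in>T - T0. \<rho> t < a) \<and> (\<forall>t\<in>T. a - 8 * R \<le> \<rho> t) \<and> (\<forall>t\<in>T2. \<rho> t < a) \<and>
     z \<in> T2 \<and> a - 5 * R \<le> \<rho> z \<and> \<rho> z < a - 4 * R \<and>
     (\<exists>t\<in>T2. \<exists>u\<in>Q. \<rho> u < a - 8 * R \<and> (t, u) \<in> E))" for v t
  define tt where "tt i = (SOME t. tl (u i) t)" for i
  define T0 where "T0 i = fst (tt i)" for i
  define T2 where "T2 i = fst (snd (tt i))" for i
  define T where "T i = fst (snd (snd (tt i)))" for i
  define z where "z i = snd (snd (snd (tt i)))" for i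
  have tt: "tl (u i) (T0 i, T2 i, T i, z i)" if "i \<le> Suc m" for i
  proof -
    have "\<exists>T0 T2 T z. tl (u i) (T0, T2, T, z)"
      unfolding tl_def prod.case
      by (rule pot_tail[OF pot Q1 _ uQ1[OF that] _ a R]) (erule (4) closed, erule small)
    then have "\<exists>t. tl (u i) t" by blast
    then have "tl (u i) (tt i)" unfolding tt_def by (rule someI_ex)
    then show ?thesis by (simp add: T0_def T2_def T_def z_def)
  qed
  have T0: "T0 i \<subseteq> Q1" "conn E (T0 i)" "u i \<in> T0 i" "sum w (T0 i) \<le> 2 * R"
    and T: "T i \<subseteq> Q" "conn E (T i)" "u i \<in> T i" "sum w (T i) \<le> 10 * R" "T2 i \<subseteq> T i"
    and T2: "conn E (T2 i)" "z i \<in> T2 i" "\<exists>t\<in>T2 i. \<exists>u\<in>Q. \<rho> u < a - 8 * R \<and> (t, u) \<in> E"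
    and T\<rho>: "\<And>t. t \<in> T i \<Longrightarrow> t \<notin> T0 i \<Longrightarrow> \<rho> t < a" "\<And>t. t \<in> T i \<Longrightarrow> a - 8 * R \<le> \<rho> t" "\<And>t. t \<in> T2 i \<Longrightarrow> \<rho> t < a"
    and z: "a - 5 * R \<le> \<rho> (z i)" "\<rho> (z i) < a - 4 * R"
    if "i \<le> Suc m" for i
    using tt[OF that] unfolding tl_def by auto
  have TV: "T i \<subseteq> V" if "i \<le> Suc m" for i using T(1)[OF that] QV by blast
  have finT: "finite (T i)" if "i \<le> Suc m" for i using T(1)[OF that] finQ by (rule finite_subset)
  have Tsep: "3 * R \<le> sum w P"
    if ij: "i \<le> Suc m" "j \<le> Suc m" "i \<noteq> j" and P: "P \<subseteq> V" "conn E P" "P \<inter> T i \<noteq> {}" "P \<inter> T j \<noteq> {}" for i j P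
  proof -
    have finP: "finite P" using P finV finite_subset by blast
    have "conn E (T i \<union> P)" by (rule conn_Un_meet) (use P T(2)[OF ij(1)] in auto)
    then have "conn E (T i \<union> P \<union> T j)" by (rule conn_Un_meet) (use P T(2)[OF ij(2)] in auto)
    then have "\<Lambda> \<le> sum w (N i) + sum w (T i \<union> P \<union> T j) + sum w (N j)"
      using ij P TV[OF ij(1)] TV[OF ij(2)] T(3)[OF ij(1)] T(3)[OF ij(2)] near[OF ij(1)] near[OF ij(2)]
      by (intro linked) auto
    moreover have "sum w (T i \<union> P \<union> T j) \<le> sum w (T i) + sum w P + sum w (T j)"
      using sum_w_Un[of "T i \<union> P" "T j"] sum_w_Un[of "T i" P] finT[OF ij(1)] finT[OF ij(2)] finP by simp
    ultimately show ?thesis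
      using near[OF ij(1)] near[OF ij(2)] T(4)[OF ij(1)] T(4)[OF ij(2)] \<Lambda> R by linarith
  qed
  have Tdis: "T i \<inter> T j = {}" if ij: "i \<le> Suc m" "j \<le> Suc m" "i \<noteq> j" for i j
  proof (rule ccontr)
    assume "T i \<inter> T j \<noteq> {}"
    then obtain y where y: "y \<in> T i" "y \<in> T j" by blast
    then have "3 * R \<le> sum w {y}" using TV[OF ij(1)] by (intro Tsep[OF ij]) auto
    moreover have "w y \<le> R" using y T(1)[OF ij(1)] by (intro small) blast
    ultimately show False using R by simp
  qed
  \<comment> \<open>Here the old separation is consumed. \<open>B i\<close> lies at level
    \<open>a\<close> or higher, so a common vertex must belong to \<open>T0 j\<close>; but that is a
    connected subset of \<open>Q1\<close> of weight at most \<open>2 * R\<close> containing the tip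
    \<open>u j\<close>.\<close>
  have BT: "B i \<inter> T j = {}" if ij: "i \<le> m" "j \<le> m" "i \<noteq> j" for i j
  proof (rule ccontr)
    assume "B i \<inter> T j \<noteq> {}"
    then obtain y where y: "y \<in> B i" "y \<in> T j" by blast
    have j: "j \<le> Suc m" using ij by simp
    have ya: "a \<le> \<rho> y" using y B(2)[OF ij(1)] Q1\<rho> by blast
    then have y0: "y \<in> T0 j" using T\<rho>(1)[OF j y(2)] by force
    have "3 * R \<le> sum w (T0 j)"
      by (rule sep[of j i]) (use ij y y0 T0[OF j] in auto)
    then show False using T0(4)[OF j] R by linarith
  qed
  define X where "X = {v \<in> Q. \<rho> v < a - 8 * R}"
  have connX: "conn E X" unfolding X_def by (rule pot_sublevel_conn[OF pot])
  \<comment> \<open>An old branch set receives its whole tail and so touches \<open>X\<close>. The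
    new one takes only the lower part \<open>T2\<close> of its tail, because \<open>T0\<close> runs
    through \<open>Q1\<close>, where the old branch sets live.\<close>
  define B' where "B' i = (if i \<le> m then B i \<union> T i else X \<union> T2 i)" for i
  have B'_low: "B' i = B i \<union> T i" if "i \<le> m" for i using that by (simp add: B'_def)
  have B'_top: "B' (Suc m) = X \<union> T2 (Suc m)" by (simp add: B'_def)
  have cases: "i \<le> m \<or> i = Suc m" if "i \<le> Suc m" for i using that by auto
  have zB': "z i \<in> B' i" if i: "i \<le> Suc m" for i
    using T2(2)[OF i] T(5)[OF i] unfolding B'_def by auto
  have B'Q: "B' i \<subseteq> Q" if i: "i \<le> Suc m" for i
    using cases[OF i] B(2)[of i] Q1Q T(1)[OF i] T(5)[OF i] unfolding B'_def X_def by auto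
  have connB': "conn E (B' i)" if i: "i \<le> Suc m" for i
    using cases[OF i]
  proof
    assume im: "i \<le> m"
    show ?thesis unfolding B'_low[OF im]
      by (rule conn_Un_meet[OF B(3)[OF im] T(2)[OF i]]) (use uB[OF im] T(3)[OF i] in blast)
  next
    assume im: "i = Suc m"
    obtain t v where "t \<in> T2 i" "v \<in> Q" "\<rho> v < a - 8 * R" "(t, v) \<in> E" using T2(3)[OF i] by blast
    then have "v \<in> X" "t \<in> T2 i" "(v, t) \<in> E" using edge_sym by (auto simp: X_def)
    then have "conn E (X \<union> T2 i)" using conn_Un[OF sym connX T2(1)[OF i]] by blast
    then show ?thesis using im B'_top by simp
  qed
  have B'lt: "B' i \<inter> B' j = {} \<and> (\<exists>x\<in>B' i. \<exists>y\<in>B' j. (x, y) \<in> E)" if ij: "i < j" "j \<le> Suc m" for i j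
    using cases[OF ij(2)]
  proof
    assume jm: "j \<le> m"
    have im: "i \<le> m" "i \<noteq> j" using ij jm by auto
    have "T i \<inter> T j = {}" using Tdis[of i j] ij by auto
    then show ?thesis
      unfolding B'_low[OF im(1)] B'_low[OF jm]
      using Bdis[OF im(1) jm im(2)] BT[OF im(1) jm im(2)] BT[OF jm im(1)] im(2) by blast
  next
    assume jm: "j = Suc m"
    have im: "i \<le> m" "i \<le> Suc m" "i \<noteq> j" using ij jm by auto
    have "B i \<inter> X = {}" using B(2)[OF im(1)] Q1\<rho> R by (fastforce simp: X_def)
    moreover have "B i \<inter> T2 j = {}" using B(2)[OF im(1)] Q1\<rho> T\<rho>(3)[OF ij(2)] by fastforce
    moreover have "T i \<inter> X = {}" using T\<rho>(2)[OF im(2)] by (fastforce simp: X_def)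
    moreover have "T i \<inter> T2 j = {}" using Tdis[OF im(2) ij(2) im(3)] T(5)[OF ij(2)] by blast
    moreover obtain t v where "t \<in> T2 i" "v \<in> Q" "\<rho> v < a - 8 * R" "(t, v) \<in> E" using T2(3)[OF im(2)] by blast
    then have "v \<in> X" "t \<in> T i" "(t, v) \<in> E" using T(5)[OF im(2)] by (auto simp: X_def)
    ultimately show ?thesis
      unfolding B'_low[OF im(1)] jm B'_top by blast
  qed
  have B'ne: "B' i \<inter> B' j = {} \<and> (\<exists>x\<in>B' i. \<exists>y\<in>B' j. (x, y) \<in> E)" if ij: "i \<le> Suc m" "j \<le> Suc m" "i \<noteq> j" for i j
  proof (cases "i < j")
    case True
    then show ?thesis using B'lt ij by simp
  next
    case False
    then have "j < i" using ij by simp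
    from B'lt[OF this ij(1)] show ?thesis using edge_sym by blast
  qed
  \<comment> \<open>Either \<open>P\<close> meets the tail of \<open>j\<close>, or it climbs from
    below \<open>a - 4 * R\<close> to \<open>a\<close>, or it drops from \<open>a - 5 * R\<close> to
    below \<open>a - 8 * R\<close>. The last case determines the value \<open>3 * R\<close>.\<close>
  have sep': "3 * R \<le> sum w P"
    if ij: "i \<le> Suc m" "j \<le> Suc m" "i \<noteq> j" and P: "P \<subseteq> Q" "conn E P" "z i \<in> P" "P \<inter> B' j \<noteq> {}" for i j P
  proof -
    have PT: "3 * R \<le> sum w P" if "P \<inter> T j \<noteq> {}"
      using that P QV T2(2)[OF ij(1)] T(5)[OF ij(1)] by (intro Tsep[OF ij]) auto
    obtain y where y: "y \<in> P" "y \<in> B' j" using P by blast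
    have lip: "\<rho> y \<le> \<rho> (z i) + sum w P" "\<rho> (z i) \<le> \<rho> y + sum w P"
      using pot_lip[OF pot P(1,2,3) y(1)] pot_lip[OF pot P(1,2) y(1) P(3)] .
    show ?thesis using cases[OF ij(2)]
    proof
      assume jm: "j \<le> m"
      show ?thesis
      proof (cases "y \<in> T j")
        case True
        then show ?thesis using PT y by blast
      next
        case False
        then have "a \<le> \<rho> y" using y B(2)[OF jm] Q1\<rho> unfolding B'_low[OF jm] by blast
        then show ?thesis using lip(1) z(2)[OF ij(1)] R by linarith
      qed
    next
      assume jm: "j = Suc m"
      show ?thesis
      proof (cases "y \<in> T j")
        case True
        then show ?thesis using PT y by blast
      next
        case False
        then have "y \<in> X" using y T(5)[OF ij(2)] unfolding jm B'_top by blast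
        then show ?thesis using lip(2) z(1)[OF ij(1)] by (simp add: X_def)
      qed
    qed
  qed
  define N' where "N' i = N i \<union> T i" for i
  have near': "N' i \<subseteq> V \<and> conn E (N' i) \<and> s i \<in> N' i \<and> z i \<in> N' i \<and> sum w (N' i) \<le> D + 10 * R"
    if i: "i \<le> Suc m" for i
  proof -
    have "conn E (N' i)" unfolding N'_def
      by (rule conn_Un_meet) (use near[OF i] T(2,3)[OF i] in auto)
    moreover have "finite (N i)" using near[OF i] finV finite_subset by blast
    then have "sum w (N' i) \<le> D + 10 * R"
      unfolding N'_def using sum_w_Un[of "N i" "T i"] finT[OF i] near[OF i] T(4)[OF i] by auto
    moreover have "z i \<in> N' i" using T2(2)[OF i] T(5)[OF i] by (auto simp: N'_def)
    moreover have "N' i \<subseteq> V" "s i \<in> N' i" using near[OF i] TV[OF i] by (auto simp: N'_def)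
    ultimately show ?thesis by blast
  qed
  have "kmodel E Q B' (Suc (Suc m))"
    unfolding kmodel_def less_Suc_eq_le using zB' B'Q connB' B'ne by blast
  moreover have "\<forall>i\<le>Suc m. z i \<in> B' i" using zB' by blast
  moreover have "\<forall>i\<le>Suc m. N' i \<subseteq> V \<and> conn E (N' i) \<and> s i \<in> N' i \<and> z i \<in> N' i \<and> sum w (N' i) \<le> D + 10 * R"
    using near' by blast
  moreover have "\<forall>i\<le>Suc m. \<forall>j\<le>Suc m. i \<noteq> j \<longrightarrow>
      (\<forall>P. P \<subseteq> Q \<and> conn E P \<and> z i \<in> P \<and> P \<inter> B' j \<noteq> {} \<longrightarrow> 3 * R \<le> sum w P)"
    by (intro allI impI, elim conjE, rule sep')
  ultimately show ?thesis
    by - (rule exI[of _ B'], rule exI[of _ z], rule exI[of _ N'], intro conjI)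
qed

text \<open>Works from the innermost set outwards. Each round adds a branch set, with
  \<open>s (Suc m)\<close> as its fresh tip, and lengthens the link from every \<open>s i\<close> to
  its current tip by at most \<open>10 * R\<close>. The bound on \<open>\<Lambda>\<close> covers two
  such links and the extra \<open>40 * R\<close> required by \<open>chop_extend\<close>.\<close>

lemma chops_kmodel:
  assumes finV: "finite V" and R: "0 < R"
    and chops: "chops R m Q Q'" and QV: "Q \<subseteq> V"
    and small: "\<And>u. u \<in> Q \<Longrightarrow> w u \<le> R"
    and s: "\<And>i. i \<le> m \<Longrightarrow> s i \<in> Q'"
    and far: "\<And>i j. i \<le> m \<Longrightarrow> j \<le> m \<Longrightarrow> i \<noteq> j \<Longrightarrow> far V \<Lambda> (s i) (s j)"
    and \<Lambda>: "30 * (real m + 1) * R \<le> \<Lambda>"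
  shows "\<exists>B u N. kmodel E Q B (Suc m) \<and> (\<forall>i\<le>m. u i \<in> B i) \<and>
     (\<forall>i\<le>m. N i \<subseteq> V \<and> conn E (N i) \<and> s i \<in> N i \<and> u i \<in> N i \<and> sum w (N i) \<le> 10 * real m * R + R) \<and>
     (\<forall>i\<le>m. \<forall>j\<le>m. i \<noteq> j \<longrightarrow> (\<forall>P. P \<subseteq> Q \<and> conn E P \<and> u i \<in> P \<and> P \<inter> B j \<noteq> {} \<longrightarrow> 3 * R \<le> sum w P))"
  using chops QV small s far \<Lambda>
proof (induction m arbitrary: Q)
  case 0
  then have "s 0 \<in> Q" "w (s 0) \<le> R" by auto
  then show ?case using 0
    by (intro exI[of _ "\<lambda>_. {s 0}"] exI[of _ s]) (auto simp: kmodel_def)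
next
  case (Suc m)
  obtain Q1 where Q1: "chop R Q Q1" "chops R m Q1 Q'" using Suc.prems(1) by auto
  have sub: "Q1 \<subseteq> Q" "Q' \<subseteq> Q1" using Q1 chop_subset chops_subset by auto
  have "30 * (real m + 1) * R \<le> \<Lambda>"
  proof -
    have "30 * (real m + 1) * R \<le> 30 * (real (Suc m) + 1) * R" using R by (intro mult_right_mono) auto
    then show ?thesis using Suc.prems(6) by linarith
  qed
  then obtain B u N where IH: "kmodel E Q1 B (Suc m)" "\<forall>i\<le>m. u i \<in> B i"
     "\<forall>i\<le>m. N i \<subseteq> V \<and> conn E (N i) \<and> s i \<in> N i \<and> u i \<in> N i \<and> sum w (N i) \<le> 10 * real m * R + R"
     "\<forall>i\<le>m. \<forall>j\<le>m. i \<noteq> j \<longrightarrow> (\<forall>P. P \<subseteq> Q1 \<and> conn E P \<and> u i \<in> P \<and> P \<inter> B j \<noteq> {} \<longrightarrow> 3 * R \<le> sum w P)"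
    using Suc.IH[OF Q1(2)] sub Suc.prems(2-5) by (auto simp: subset_iff)
  obtain x \<rho> a where pot: "pot Q x \<rho>" and slice: "Q1 \<subseteq> {v \<in> Q. a \<le> \<rho> v \<and> \<rho> v < a + R}"
    and closed: "\<And>u v. u \<in> Q1 \<Longrightarrow> v \<in> Q \<Longrightarrow> (u, v) \<in> E \<Longrightarrow> a \<le> \<rho> v \<Longrightarrow> \<rho> v < a + R \<Longrightarrow> v \<in> Q1"
    using Q1(1) unfolding chop_def by blast
  define s' where "s' = s (Suc m)"
  have s': "s' \<in> Q1" "w s' \<le> R" using Suc.prems(4)[of "Suc m"] Suc.prems(3) sub by (auto simp: s'_def)
  define u' where "u' = u(Suc m := s')"
  define N' where "N' = N(Suc m := {s'})"
  define D where "D = 10 * real m * R + R"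
  have D0: "R \<le> D" using R by (simp add: D_def)
  have near: "N' i \<subseteq> V \<and> conn E (N' i) \<and> s i \<in> N' i \<and> u' i \<in> N' i \<and> sum w (N' i) \<le> D" if "i \<le> Suc m" for i
  proof (cases "i = Suc m")
    case True
    then show ?thesis using s' sub Suc.prems(2) D0 by (auto simp: N'_def u'_def s'_def)
  next
    case False
    then show ?thesis using IH(3) that by (auto simp: N'_def u'_def D_def)
  qed
  have "\<exists>B' u' N'. kmodel E Q B' (Suc (Suc m)) \<and> (\<forall>i\<le>Suc m. u' i \<in> B' i) \<and>
     (\<forall>i\<le>Suc m. N' i \<subseteq> V \<and> conn E (N' i) \<and> s i \<in> N' i \<and> u' i \<in> N' i \<and> sum w (N' i) \<le> D + 10 * R) \<and>
     (\<forall>i\<le>Suc m. \<forall>j\<le>Suc m. i \<noteq> j \<longrightarrow> (\<forall>P. P \<subseteq> Q \<and> conn E P \<and> u' i \<in> P \<and> P \<inter> B' j \<noteq> {} \<longrightarrow> 3 * R \<le> sum w P))"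
  proof (rule chop_extend[OF pot slice _ Suc.prems(3) R Suc.prems(2) finV IH(1) _ near])
    show "v \<in> Q1" if "u \<in> Q1" "v \<in> Q" "(u, v) \<in> E" "a \<le> \<rho> v" "\<rho> v < a + R" for u v
      using closed[OF that] .
    show "u' i \<in> B i" if "i \<le> m" for i using IH(2) that by (simp add: u'_def)
    show "3 * R \<le> sum w P" if "i \<le> m" "j \<le> m" "i \<noteq> j" "P \<subseteq> Q1" "conn E P" "u' i \<in> P" "P \<inter> B j \<noteq> {}" for i j P
      using IH(4) that by (simp add: u'_def)
    show "u' (Suc m) \<in> Q1" using s' by (simp add: u'_def)
    show "far V \<Lambda> (s i) (s j)" if "i \<le> Suc m" "j \<le> Suc m" "i \<noteq> j" for i j using Suc.prems(5) that by simp
    have "2 * D + 40 * R \<le> 30 * (real (Suc m) + 1) * R"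
      using R by (simp add: D_def algebra_simps)
    then show "2 * D + 40 * R \<le> \<Lambda>" using Suc.prems(6) by linarith
  qed auto
  moreover have "D + 10 * R = 10 * real (Suc m) * R + R" by (simp add: D_def algebra_simps)
  ultimately show ?case by simp
qed

text \<open>If \<open>x\<close> and \<open>y\<close> were so far apart in \<open>V\<close>, the
  connected set \<open>Q'\<close> would contain \<open>m + 1\<close> vertices pairwise far apart in
  \<open>V\<close>, and \<open>chops_kmodel\<close> would give a model. The levels are those of the
  component of \<open>x\<close> in \<open>V\<close>, since separation must hold for connecting sets
  that leave \<open>Q'\<close>.\<close>

lemma chops_diameter:
  assumes finV: "finite V" and R: "0 < R"
    and chops: "chops R m Q Q'" and QV: "Q \<subseteq> V"
    and small: "\<And>u. u \<in> V \<Longrightarrow> w u \<le> R"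
    and no: "\<not> (\<exists>B. kmodel E Q B (Suc m))"
    and Q': "conn E Q'" "x \<in> Q'" "y \<in> Q'"
  shows "\<not> far V ((real m + 2) * (30 * (real m + 1) * R + R)) x y"
proof
  define \<Lambda> where "\<Lambda> = 30 * (real m + 1) * R"
  define c where "c = \<Lambda> + R"
  assume f: "far V ((real m + 2) * (30 * (real m + 1) * R + R)) x y"
  have sub: "Q' \<subseteq> V" using chops_subset[OF chops] QV by blast
  have xV: "x \<in> V" using sub Q' by blast
  define K where "K = component E V x"
  have KV: "K \<subseteq> V" unfolding K_def by (rule component_subset[OF xV])
  have Kc: "conn E K" unfolding K_def by (rule conn_component[OF sym xV])
  have KS: "S \<subseteq> K" if "conn E S" "S \<subseteq> V" "S \<inter> K \<noteq> {}" for S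
    using that conn_subset_component[of E S V _ x] unfolding K_def by blast
  have "x \<in> K" by (simp add: K_def)
  then have Q'K: "Q' \<subseteq> K" using KS[OF Q'(1) sub] Q'(2) by blast
  obtain \<rho> where pot: "pot K x \<rho>"
    using pot_exists[of K x] finite_subset[OF KV finV] Kc by (auto simp: K_def)
  have \<Lambda>0: "R \<le> \<Lambda>"
  proof -
    have "1 * R \<le> 30 * (real m + 1) * R" using R by (intro mult_right_mono) auto
    then show ?thesis by (simp add: \<Lambda>_def)
  qed
  have \<rho>y: "(real m + 2) * c \<le> \<rho> y"
  proof -
    obtain P where P: "P \<subseteq> K" "conn E P" "x \<in> P" "y \<in> P" "sum w P \<le> \<rho> y"
      using pot_short[OF pot, of y] Q'K Q'(3) by blast
    then have "(real m + 2) * c \<le> sum w P" using f KV unfolding far_def c_def \<Lambda>_def by blast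
    then show ?thesis using P by linarith
  qed
  have \<rho>x: "\<rho> x \<le> R" using pot small[OF xV] by (simp add: pot_def)
  \<comment> \<open>Being connected, \<open>Q'\<close> crosses every level between those of
    \<open>x\<close> and \<open>y\<close>, overshooting by at most one vertex weight. The spacing
    \<open>c = \<Lambda> + R\<close> absorbs this overshoot.\<close>
  have "\<exists>v\<in>Q'. (real i + 1) * c \<le> \<rho> v \<and> \<rho> v < (real i + 1) * c + R" if i: "i \<le> m" for i
  proof -
    have "1 * c \<le> (real i + 1) * c" using \<Lambda>0 R by (intro mult_right_mono) (auto simp: c_def)
    then have 1: "\<rho> x < (real i + 1) * c" using \<rho>x \<Lambda>0 R c_def by linarith
    have "(real i + 1) * c \<le> (real m + 2) * c" using i \<Lambda>0 R by (intro mult_right_mono) (auto simp: c_def)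
    then have 2: "\<not> \<rho> y < (real i + 1) * c" using \<rho>y by linarith
    obtain a b where ab: "a \<in> Q'" "\<rho> a < (real i + 1) * c" "b \<in> Q'" "\<not> \<rho> b < (real i + 1) * c" "(a, b) \<in> E"
      using conn_crossing[OF Q'(1,2), of "{v. \<rho> v < (real i + 1) * c}" y] 1 2 Q'(3) by blast
    have "\<rho> b \<le> \<rho> a + w b" using pot ab Q'K unfolding pot_def by blast
    moreover have "w b \<le> R" using ab sub small by blast
    ultimately show ?thesis using ab by (intro bexI[of _ b]) auto
  qed
  then obtain s where s: "\<And>i. i \<le> m \<Longrightarrow> s i \<in> Q' \<and> (real i + 1) * c \<le> \<rho> (s i) \<and> \<rho> (s i) < (real i + 1) * c + R"
    by metis
  have lt: "far V \<Lambda> (s i) (s j) \<and> far V \<Lambda> (s j) (s i)" if ij: "i < j" "j \<le> m" for i j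
  proof -
    have "\<Lambda> \<le> sum w P" if P: "P \<subseteq> V" "conn E P" "s i \<in> P" "s j \<in> P" for P
    proof -
      have "P \<inter> K \<noteq> {}" using P s[of i] ij Q'K by auto
      then have "P \<subseteq> K" using KS P by blast
      then have "\<rho> (s j) \<le> \<rho> (s i) + sum w P" using pot_lip[OF pot _ P(2-4)] by blast
      moreover have "(real i + 1) * c + c \<le> (real j + 1) * c"
      proof -
        have "(real i + 2) * c \<le> (real j + 1) * c" using ij \<Lambda>0 R by (intro mult_right_mono) (auto simp: c_def)
        then show ?thesis by (simp add: algebra_simps)
      qed
      ultimately show ?thesis using s[of i] s[of j] ij unfolding c_def by auto
    qed
    then show ?thesis unfolding far_def by blast
  qed
  have "far V \<Lambda> (s i) (s j)" if "i \<le> m" "j \<le> m" "i \<noteq> j" for i j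
    using lt[of i j] lt[of j i] that by (cases "i < j") auto
  then have "\<exists>B. kmodel E Q B (Suc m)"
    using chops_kmodel[OF finV R chops QV, of s \<Lambda>] small QV s unfolding \<Lambda>_def by blast
  then show False using no by blast
qed

end

section \<open>Padded partitions\<close>

context weighted
begin

text \<open>\<open>cl v\<close> is the piece containing \<open>v\<close>, and \<open>\<phi>\<close>
  behaves like the distance to the boundary of the pieces, measured in units of
  \<open>\<gamma>\<close> and capped at 1. Layers have width \<open>2 * \<gamma> * K\<close>, with a
  margin \<open>\<gamma>\<close> at either end; a suitable offset loses a fraction of at most
  \<open>1 / K\<close> of the vertices per round.\<close>

definition padded :: "real \<Rightarrow> nat \<Rightarrow> nat \<Rightarrow> 'a set \<Rightarrow> ('a \<Rightarrow> real) \<Rightarrow> ('a \<Rightarrow> 'a set) \<Rightarrow> bool" where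
  "padded \<gamma> K m Q \<phi> cl \<longleftrightarrow>
     (\<forall>v\<in>Q. v \<in> cl v \<and> cl v \<subseteq> Q \<and> conn E (cl v) \<and> chops (2 * \<gamma> * real K) m Q (cl v) \<and> (\<forall>u\<in>cl v. cl u = cl v)) \<and>
     (\<forall>v\<in>Q. 0 \<le> \<phi> v \<and> \<phi> v \<le> 1) \<and>
     (\<forall>u\<in>Q. \<forall>v\<in>Q. (u, v) \<in> E \<longrightarrow> cl u = cl v \<longrightarrow> \<bar>\<phi> u - \<phi> v\<bar> * \<gamma> \<le> max (w u) (w v)) \<and>
     (\<forall>u\<in>Q. \<forall>v\<in>Q. (u, v) \<in> E \<longrightarrow> cl u \<noteq> cl v \<longrightarrow> \<phi> u * \<gamma> \<le> max (w u) (w v) \<and> \<phi> v * \<gamma> \<le> max (w u) (w v)) \<and>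
     real K * real (card {v \<in> Q. \<phi> v < 1}) \<le> real m * real (card Q)"

text \<open>Averaging over \<open>K\<close> shifts of the layering. A vertex is bad for shift
  \<open>k\<close> only if \<open>\<rho> v\<close> is within \<open>\<gamma>\<close> of some
  \<open>2 * \<gamma> * z\<close> with \<open>z\<close> congruent to \<open>k\<close> modulo
  \<open>K\<close>. These neighbourhoods are disjoint, so each vertex is bad for at most one
  shift.\<close>

lemma slice_offset:
  fixes \<rho> :: "'a \<Rightarrow> real"
  assumes "finite Q" "0 < \<gamma>" "0 < K"
  defines "j \<equiv> \<lambda>k v. \<lfloor>(\<rho> v - 2 * \<gamma> * real k) / (2 * \<gamma> * real K)\<rfloor>"
  defines "a \<equiv> \<lambda>k v. 2 * \<gamma> * real k + 2 * \<gamma> * real K * of_int (j k v)"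
  shows "\<exists>k<K. real K * real (card {v \<in> Q. min (\<rho> v - a k v) (a k v + 2 * \<gamma> * real K - \<rho> v) < \<gamma>}) \<le> real (card Q)"
proof -
  define bad where "bad k = {v \<in> Q. min (\<rho> v - a k v) (a k v + 2 * \<gamma> * real K - \<rho> v) < \<gamma>}" for k
  have R: "0 < 2 * \<gamma> * real K" using assms by simp
  have a: "a k v \<le> \<rho> v" "\<rho> v < a k v + 2 * \<gamma> * real K" for k v
  proof -
    have "of_int (j k v) \<le> (\<rho> v - 2 * \<gamma> * real k) / (2 * \<gamma> * real K)"
      "(\<rho> v - 2 * \<gamma> * real k) / (2 * \<gamma> * real K) < of_int (j k v) + 1"
      unfolding j_def by linarith+
    then have "of_int (j k v) * (2 * \<gamma> * real K) \<le> \<rho> v - 2 * \<gamma> * real k"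
      "\<rho> v - 2 * \<gamma> * real k < (of_int (j k v) + 1) * (2 * \<gamma> * real K)"
      using R by (simp_all only: pos_le_divide_eq pos_divide_less_eq)
    then show "a k v \<le> \<rho> v" "\<rho> v < a k v + 2 * \<gamma> * real K" by (simp_all add: a_def algebra_simps)
  qed
  have mult: "\<exists>z. \<bar>\<rho> v - 2 * \<gamma> * of_int z\<bar> < \<gamma> \<and> z mod int K = int k" if "v \<in> bad k" "k < K" for v k
  proof -
    have "\<rho> v - a k v < \<gamma> \<or> a k v + 2 * \<gamma> * real K - \<rho> v < \<gamma>" using that by (auto simp: bad_def)
    then show ?thesis
    proof
      assume h: "\<rho> v - a k v < \<gamma>"
      have "2 * \<gamma> * of_int (int k + int K * j k v) = a k v" by (simp add: a_def algebra_simps)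
      then have "\<bar>\<rho> v - 2 * \<gamma> * of_int (int k + int K * j k v)\<bar> < \<gamma>" using h a(1)[of k v] by simp
      moreover have "(int k + int K * j k v) mod int K = int k" using that by simp
      ultimately show ?thesis by blast
    next
      assume h: "a k v + 2 * \<gamma> * real K - \<rho> v < \<gamma>"
      have "2 * \<gamma> * of_int (int k + int K * (j k v + 1)) = a k v + 2 * \<gamma> * real K" by (simp add: a_def algebra_simps)
      then have "\<bar>\<rho> v - 2 * \<gamma> * of_int (int k + int K * (j k v + 1))\<bar> < \<gamma>" using h a(2)[of v k] by simp
      moreover have "(int k + int K * (j k v + 1)) mod int K = int k" using that by (simp only: mod_mult_self2) simp
      ultimately show ?thesis by blast
    qed
  qed
  have dis: "bad k \<inter> bad l = {}" if kl: "k < K" "l < K" "k \<noteq> l" for k l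
  proof (rule ccontr)
    assume "bad k \<inter> bad l \<noteq> {}"
    then obtain v where "v \<in> bad k" "v \<in> bad l" by blast
    then obtain z z' where z: "\<bar>\<rho> v - 2 * \<gamma> * of_int z\<bar> < \<gamma>" "z mod int K = int k"
      "\<bar>\<rho> v - 2 * \<gamma> * of_int z'\<bar> < \<gamma>" "z' mod int K = int l" using mult kl by meson
    have "\<bar>2 * \<gamma> * (of_int z - of_int z')\<bar> < 2 * \<gamma>" using z(1,3) by (simp add: algebra_simps)
    then have "2 * \<gamma> * \<bar>of_int z - of_int z'\<bar> < 2 * \<gamma> * (1 :: real)" using assms(2) by (simp add: abs_mult)
    then have "\<bar>of_int z - of_int z'\<bar> < (1 :: real)" using assms(2) by (simp only: mult_less_cancel_left_pos)
    then have "z = z'" by linarith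
    then show False using z kl by simp
  qed
  have "(\<Sum>k<K. card (bad k)) = card (\<Union>k<K. bad k)"
    using assms(1) dis by (intro card_UN_disjoint[symmetric]) (auto simp: bad_def)
  also have "\<dots> \<le> card Q" using assms(1) by (intro card_mono) (auto simp: bad_def)
  finally have le: "(\<Sum>k<K. real (card (bad k))) \<le> real (card Q)" by (simp flip: of_nat_sum)
  have "\<exists>k<K. real K * real (card (bad k)) \<le> real (card Q)"
  proof (rule ccontr)
    assume "\<not> ?thesis"
    then have "(\<Sum>k<K. real (card Q)) < (\<Sum>k<K. real K * real (card (bad k)))"
      using assms(3) by (intro sum_strict_mono) auto
    also have "\<dots> = real K * (\<Sum>k<K. real (card (bad k)))" by (simp add: sum_distrib_left)
    also have "\<dots> \<le> real K * real (card Q)" using le by (intro mult_left_mono) auto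
    finally show False by simp
  qed
  then show ?thesis by (simp add: bad_def)
qed

lemma partition_count:
  fixes C :: "'a \<Rightarrow> 'a set" and \<psi> :: "'a \<Rightarrow> real"
  assumes fin: "finite Q" and C: "\<And>v. v \<in> Q \<Longrightarrow> v \<in> C v \<and> C v \<subseteq> Q"
    and eq: "\<And>u v. v \<in> Q \<Longrightarrow> u \<in> C v \<Longrightarrow> C u = C v"
    and cnt: "\<And>v. v \<in> Q \<Longrightarrow> b * real (card {u \<in> C v. \<psi> u < 1}) \<le> c * real (card (C v))"
  shows "b * real (card {u \<in> Q. \<psi> u < 1}) \<le> c * real (card Q)"
proof -
  have part: "{v \<in> Q. C v = Z} = Z" if "Z \<in> C ` Q" for Z
  proof -
    obtain t where t: "t \<in> Q" "Z = C t" using \<open>Z \<in> C ` Q\<close> by blast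
    show ?thesis
    proof (intro subset_antisym subsetI)
      fix v assume "v \<in> {v \<in> Q. C v = Z}"
      then show "v \<in> Z" using C[of v] by simp
    next
      fix v assume "v \<in> Z"
      then show "v \<in> {v \<in> Q. C v = Z}" using eq[OF t(1), of v] C[OF t(1)] t(2) by blast
    qed
  qed
  have sumQ: "(\<Sum>v\<in>Q. f v) = (\<Sum>Z\<in>C ` Q. sum f Z)" for f :: "'a \<Rightarrow> real"
  proof -
    have "(\<Sum>v\<in>Q. f v) = (\<Sum>Z\<in>C ` Q. sum f {v \<in> Q. C v = Z})" by (rule sum.image_gen[OF fin])
    also have "\<dots> = (\<Sum>Z\<in>C ` Q. sum f Z)" by (intro sum.cong refl) (simp add: part)
    finally show ?thesis .
  qed
  have "real (card {v \<in> Q. \<psi> v < 1}) = (\<Sum>v\<in>Q. if \<psi> v < 1 then 1 else 0)"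
    using fin by (simp add: sum.If_cases Int_def)
  also have "\<dots> = (\<Sum>Z\<in>C ` Q. \<Sum>v\<in>Z. if \<psi> v < 1 then 1 else 0)" by (rule sumQ)
  finally have "b * real (card {v \<in> Q. \<psi> v < 1}) = (\<Sum>Z\<in>C ` Q. b * (\<Sum>v\<in>Z. if \<psi> v < 1 then 1 else 0))"
    by (simp add: sum_distrib_left)
  also have "\<dots> \<le> (\<Sum>Z\<in>C ` Q. c * (\<Sum>v\<in>Z. 1))"
  proof (rule sum_mono)
    fix Z assume "Z \<in> C ` Q"
    then obtain t where t: "t \<in> Q" "Z = C t" by blast
    have finZ: "finite Z" using t C[OF t(1)] fin finite_subset by blast
    have "b * real (card {v \<in> Z. \<psi> v < 1}) \<le> c * real (card Z)" using cnt[OF t(1)] t(2) by simp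
    then show "b * (\<Sum>v\<in>Z. if \<psi> v < 1 then 1 else 0) \<le> c * (\<Sum>v\<in>Z. 1)"
      using finZ by (simp add: sum.If_cases Int_def)
  qed
  also have "\<dots> = c * (\<Sum>Z\<in>C ` Q. \<Sum>v\<in>Z. 1)" by (simp add: sum_distrib_left)
  also have "(\<Sum>Z\<in>C ` Q. \<Sum>v\<in>Z. 1) = real (card Q)" using sumQ[of "\<lambda>_. 1"] by simp
  finally show ?thesis .
qed

lemma abs_min_diff: "\<bar>min a b - min c d\<bar> \<le> max \<bar>a - c\<bar> \<bar>b - (d :: real)\<bar>"
  by (auto simp: min_def max_def)

text \<open>One round cuts \<open>Q\<close> into layers at a good offset and recurses into the
  components of the layers. Taking the minimum with the capped distance to the ends of the layer
  preserves the Lipschitz bound inside pieces and makes \<open>\<phi>\<close> small at edges between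
  layers.\<close>

lemma padded_exists:
  assumes "finite Q" "conn E Q" "0 < \<gamma>" "0 < K"
  shows "\<exists>\<phi> cl. padded \<gamma> K m Q \<phi> cl"
  using assms(1,2)
proof (induction m arbitrary: Q)
  case 0
  have "padded \<gamma> K 0 Q (\<lambda>_. 1) (\<lambda>_. Q)"
    using 0 pos by (auto simp: padded_def less_imp_le le_max_iff_disj)
  then show ?case by blast
next
  case (Suc m)
  show ?case
  proof (cases "Q = {}")
    case True
    then have "padded \<gamma> K (Suc m) Q (\<lambda>_. 1) (\<lambda>_. Q)" by (simp add: padded_def)
    then show ?thesis by blast
  next
    case False
    then obtain x \<rho> where pot: "pot Q x \<rho>" using pot_exists[OF Suc.prems] by blast
    define R where "R = 2 * \<gamma> * real K"
    have R: "0 < R" using assms by (simp add: R_def)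
    obtain k where k: "real K * real (card {v \<in> Q. min (\<rho> v - (2 * \<gamma> * real k + R * of_int \<lfloor>(\<rho> v - 2 * \<gamma> * real k) / R\<rfloor>))
         (2 * \<gamma> * real k + R * of_int \<lfloor>(\<rho> v - 2 * \<gamma> * real k) / R\<rfloor> + R - \<rho> v) < \<gamma>}) \<le> real (card Q)"
      using slice_offset[OF Suc.prems(1) assms(3,4), of \<rho>] unfolding R_def by blast
    define j where "j v = \<lfloor>(\<rho> v - 2 * \<gamma> * real k) / R\<rfloor>" for v
    define a where "a v = 2 * \<gamma> * real k + R * of_int (j v)" for v
    define \<theta> where "\<theta> v = min (\<rho> v - a v) (a v + R - \<rho> v)" for v
    have bad: "real K * real (card {v \<in> Q. \<theta> v < \<gamma>}) \<le> real (card Q)"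
      using k by (simp add: \<theta>_def a_def j_def)
    have a: "a v \<le> \<rho> v" "\<rho> v < a v + R" for v
    proof -
      have "of_int (j v) \<le> (\<rho> v - 2 * \<gamma> * real k) / R"
        "(\<rho> v - 2 * \<gamma> * real k) / R < of_int (j v) + 1"
        unfolding j_def by linarith+
      then have "of_int (j v) * R \<le> \<rho> v - 2 * \<gamma> * real k"
        "\<rho> v - 2 * \<gamma> * real k < (of_int (j v) + 1) * R"
        using R by (simp_all only: pos_le_divide_eq pos_divide_less_eq)
      then show "a v \<le> \<rho> v" "\<rho> v < a v + R" by (simp_all add: a_def algebra_simps)
    qed
    have \<theta>0: "0 \<le> \<theta> v" for v using a[of v] by (simp add: \<theta>_def)
    have a_step: "a u + R \<le> a v" if "j u < j v" for u v
    proof -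
      have "of_int (j u) + 1 \<le> (of_int (j v) :: real)" using that by linarith
      then have "R * (of_int (j u) + 1) \<le> R * of_int (j v)" using R by (intro mult_left_mono) auto
      then show ?thesis by (simp add: a_def algebra_simps)
    qed
    have j_eq: "j u = j v" if "a v \<le> \<rho> u" "\<rho> u < a v + R" for u v
      using a_step[of u v] a_step[of v u] a[of u] that by (cases "j u" "j v" rule: linorder_cases) auto
    have a_eq: "a u = a v" if "j u = j v" for u v using that by (simp add: a_def)
    define S where "S v = {u \<in> Q. j u = j v}" for v
    define C where "C v = component E (S v) v" for v
    have vS: "v \<in> S v" if "v \<in> Q" for v using that by (simp add: S_def)
    have CS: "C v \<subseteq> S v" if "v \<in> Q" for v unfolding C_def by (rule component_subset[OF vS[OF that]])
    have SQ: "S v \<subseteq> Q" for v by (auto simp: S_def)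
    have CQ: "C v \<subseteq> Q" if "v \<in> Q" for v using CS[OF that] SQ[of v] by blast
    have Cc: "conn E (C v)" if "v \<in> Q" for v unfolding C_def by (rule conn_component[OF sym vS[OF that]])
    have vC: "v \<in> C v" for v by (simp add: C_def)
    have Ceq: "C u = C v" if "v \<in> Q" "u \<in> C v" for u v
    proof -
      have "u \<in> S v" using CS that by blast
      then have "S u = S v" by (auto simp: S_def)
      moreover have "component E (S v) u = component E (S v) v"
        by (rule component_eq[OF sym vS[OF that(1)]]) (use that(2) in \<open>simp add: C_def\<close>)
      ultimately show ?thesis by (simp only: C_def)
    qed
    have Cstep: "C u = C v" if "u \<in> Q" "v \<in> Q" "(u, v) \<in> E" "j u = j v" for u v
    proof -
      have "u \<in> S v" "v \<in> S v" using that by (auto simp: S_def)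
      then have "u \<in> C v"
        unfolding C_def using component_step[OF component_self _ _ edge_sym[OF that(3)]] by blast
      then show ?thesis by (rule Ceq[OF that(2)])
    qed
    have chop: "chop R Q (C v)" if v: "v \<in> Q" for v
      unfolding chop_def
    proof (intro exI conjI)
      show "pot Q x \<rho>" by (rule pot)
      show "C v \<subseteq> {u \<in> Q. a v \<le> \<rho> u \<and> \<rho> u < a v + R}"
      proof
        fix u assume "u \<in> C v"
        then have "u \<in> Q" "j u = j v" using CS[OF v] by (auto simp: S_def)
        then show "u \<in> {u \<in> Q. a v \<le> \<rho> u \<and> \<rho> u < a v + R}" using a[of u] a_eq[of u v] by simp
      qed
      show "\<forall>u\<in>C v. \<forall>t\<in>Q. (u, t) \<in> E \<and> a v \<le> \<rho> t \<and> \<rho> t < a v + R \<longrightarrow> t \<in> C v"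
      proof (intro ballI impI)
        fix u t assume h: "u \<in> C v" "t \<in> Q" "(u, t) \<in> E \<and> a v \<le> \<rho> t \<and> \<rho> t < a v + R"
        then have "t \<in> S v" using j_eq[of v t] by (simp add: S_def)
        then show "t \<in> C v" using h component_step[OF _ vS[OF v], of u E t] by (simp add: C_def)
      qed
    qed
    have "\<exists>p. C v \<subseteq> Q \<and> conn E (C v) \<longrightarrow> padded \<gamma> K m (C v) (fst p) (snd p)" for v
    proof (cases "C v \<subseteq> Q \<and> conn E (C v)")
      case True
      then have "finite (C v)" using Suc.prems(1) finite_subset by blast
      then obtain \<phi> cl where "padded \<gamma> K m (C v) \<phi> cl" using Suc.IH True by blast
      then show ?thesis by (intro exI[of _ "(\<phi>, cl)"]) simp
    qed blast
    \<comment> \<open>The choice depends on the set \<open>C v\<close> only, so all vertices of a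
      component use the same inner partition.\<close>
    then have "\<exists>p. \<forall>Z. Z \<in> C ` Q \<longrightarrow> padded \<gamma> K m Z (fst (p Z)) (snd (p Z))"
      using CQ Cc by (intro choice) (metis imageE)
    then obtain p where p: "\<And>v. v \<in> Q \<Longrightarrow> padded \<gamma> K m (C v) (fst (p (C v))) (snd (p (C v)))" by blast
    define \<phi>1 where "\<phi>1 v = fst (p (C v)) v" for v
    define cl where "cl v = snd (p (C v)) v" for v
    define \<phi> where "\<phi> v = min (\<phi>1 v) (min 1 (\<theta> v / \<gamma>))" for v
    have cl: "v \<in> cl v" "cl v \<subseteq> C v" "conn E (cl v)" "chops R m (C v) (cl v)" "\<And>u. u \<in> cl v \<Longrightarrow> cl u = cl v"
      and \<phi>1: "0 \<le> \<phi>1 v" "\<phi>1 v \<le> 1" if "v \<in> Q" for v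
    proof -
      note pv = p[OF that, unfolded padded_def R_def[symmetric]]
      note pv1 = bspec[OF conjunct1[OF pv] vC[of v], folded cl_def]
      note pv2 = bspec[OF conjunct1[OF conjunct2[OF pv]] vC[of v], folded \<phi>1_def]
      show "v \<in> cl v" "conn E (cl v)" "chops R m (C v) (cl v)" using pv1 by simp_all
      show sub: "cl v \<subseteq> C v" using pv1 by simp
      show "0 \<le> \<phi>1 v" "\<phi>1 v \<le> 1" using pv2 by simp_all
      fix u assume u: "u \<in> cl v"
      have "C u = C v" by (rule Ceq[OF that]) (use u sub in blast)
      moreover have "snd (p (C v)) u = cl v" using pv1 u by blast
      ultimately show "cl u = cl v" by (simp add: cl_def)
    qed
    have \<phi>01: "0 \<le> \<phi> v" "\<phi> v \<le> 1" "\<phi> v \<le> \<phi>1 v" "\<phi> v * \<gamma> \<le> \<theta> v" if "v \<in> Q" for v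
    proof -
      have "\<phi> v \<le> \<theta> v / \<gamma>" by (simp add: \<phi>_def)
      then show "\<phi> v * \<gamma> \<le> \<theta> v" using assms(3) by (simp add: pos_le_divide_eq)
    qed (use \<phi>1[OF that] \<theta>0[of v] assms(3) in \<open>auto simp: \<phi>_def\<close>)
    have edge1: "(cl u = cl v \<longrightarrow> \<bar>\<phi>1 u - \<phi>1 v\<bar> * \<gamma> \<le> max (w u) (w v)) \<and>
        (cl u \<noteq> cl v \<longrightarrow> \<phi>1 u * \<gamma> \<le> max (w u) (w v) \<and> \<phi>1 v * \<gamma> \<le> max (w u) (w v))"
      if v: "v \<in> Q" "C u = C v" "(u, v) \<in> E" for u v
    proof -
      note pv = p[OF v(1), unfolded padded_def]
      have u: "u \<in> C v" using vC[of u] v(2) by simp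
      note e1 = bspec[OF bspec[OF conjunct1[OF conjunct2[OF conjunct2[OF pv]]] u] vC]
      note e2 = bspec[OF bspec[OF conjunct1[OF conjunct2[OF conjunct2[OF conjunct2[OF pv]]]] u] vC]
      show ?thesis unfolding cl_def \<phi>1_def v(2) using e1[rule_format, OF v(3)] e2[rule_format, OF v(3)] by blast
    qed
    have edge: "(cl u = cl v \<longrightarrow> \<bar>\<phi> u - \<phi> v\<bar> * \<gamma> \<le> max (w u) (w v)) \<and>
        (cl u \<noteq> cl v \<longrightarrow> \<phi> u * \<gamma> \<le> max (w u) (w v) \<and> \<phi> v * \<gamma> \<le> max (w u) (w v))"
      if uv: "u \<in> Q" "v \<in> Q" "(u, v) \<in> E" for u v
    proof (cases "j u = j v")
      case True
      have CC: "C u = C v" by (rule Cstep[OF uv True])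
      show ?thesis
      proof (intro conjI impI)
        assume "cl u = cl v"
        then have 1: "\<bar>\<phi>1 u - \<phi>1 v\<bar> * \<gamma> \<le> max (w u) (w v)"
          using edge1[OF uv(2) CC uv(3)] by blast
        have "\<bar>\<theta> u - \<theta> v\<bar> \<le> \<bar>\<rho> u - \<rho> v\<bar>"
          using abs_min_diff[of "\<rho> u - a u" "a u + R - \<rho> u" "\<rho> v - a v" "a v + R - \<rho> v"] a_eq[OF True]
          unfolding \<theta>_def by simp
        also have "\<dots> \<le> max (w u) (w v)" by (rule pot_edge_abs[OF pot uv])
        finally have "\<bar>\<theta> u / \<gamma> - \<theta> v / \<gamma>\<bar> * \<gamma> \<le> max (w u) (w v)"
          using assms(3) by (simp flip: diff_divide_distrib)
        moreover have "\<bar>min 1 (\<theta> u / \<gamma>) - min 1 (\<theta> v / \<gamma>)\<bar> \<le> \<bar>\<theta> u / \<gamma> - \<theta> v / \<gamma>\<bar>"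
          by (auto simp: min_def)
        then have "\<bar>min 1 (\<theta> u / \<gamma>) - min 1 (\<theta> v / \<gamma>)\<bar> * \<gamma> \<le> \<bar>\<theta> u / \<gamma> - \<theta> v / \<gamma>\<bar> * \<gamma>"
          using assms(3) by (intro mult_right_mono) auto
        ultimately have 2: "\<bar>min 1 (\<theta> u / \<gamma>) - min 1 (\<theta> v / \<gamma>)\<bar> * \<gamma> \<le> max (w u) (w v)" by linarith
        have "\<bar>\<phi> u - \<phi> v\<bar> * \<gamma> \<le> max \<bar>\<phi>1 u - \<phi>1 v\<bar> \<bar>min 1 (\<theta> u / \<gamma>) - min 1 (\<theta> v / \<gamma>)\<bar> * \<gamma>"
          unfolding \<phi>_def using assms(3) by (intro mult_right_mono abs_min_diff) auto
        also have "\<dots> \<le> max (w u) (w v)" using 1 2 by (simp only: max_def[of "\<bar>_\<bar>"] split: if_split) simp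
        finally show "\<bar>\<phi> u - \<phi> v\<bar> * \<gamma> \<le> max (w u) (w v)" .
      next
        assume "cl u \<noteq> cl v"
        then have 1: "\<phi>1 u * \<gamma> \<le> max (w u) (w v) \<and> \<phi>1 v * \<gamma> \<le> max (w u) (w v)"
          using edge1[OF uv(2) CC uv(3)] by blast
        have 2: "\<phi> u * \<gamma> \<le> \<phi>1 u * \<gamma>" "\<phi> v * \<gamma> \<le> \<phi>1 v * \<gamma>"
          using \<phi>01(3)[OF uv(1)] \<phi>01(3)[OF uv(2)] assms(3) by (auto intro: mult_right_mono)
        show "\<phi> u * \<gamma> \<le> max (w u) (w v)" "\<phi> v * \<gamma> \<le> max (w u) (w v)" using 1 2 by linarith+
      qed
    next
      case False
      have "cl u \<noteq> cl v"
      proof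
        assume "cl u = cl v"
        then have "u \<in> C v" using cl(1)[OF uv(1)] cl(2)[OF uv(2)] by blast
        then show False using CS[OF uv(2)] False by (auto simp: S_def)
      qed
      \<comment> \<open>A boundary between layers separates the two levels, so each end of the edge
        is no farther from an end of its own layer than from the other level.\<close>
      moreover have "\<theta> u \<le> \<bar>\<rho> u - \<rho> v\<bar> \<and> \<theta> v \<le> \<bar>\<rho> u - \<rho> v\<bar>"
        using a_step[of u v] a_step[of v u] a[of u] a[of v] False unfolding \<theta>_def
        by (cases "j u" "j v" rule: linorder_cases) (auto simp: min_def)
      moreover have "\<bar>\<rho> u - \<rho> v\<bar> \<le> max (w u) (w v)" by (rule pot_edge_abs[OF pot uv])
      ultimately show ?thesis using \<phi>01(4)[OF uv(1)] \<phi>01(4)[OF uv(2)] by auto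
    qed
    have cnt: "real K * real (card {v \<in> Q. \<phi> v < 1}) \<le> real (Suc m) * real (card Q)"
    proof -
      have fin: "finite Q" by (rule Suc.prems)
      have 1: "real K * real (card {v \<in> Q. \<phi>1 v < 1}) \<le> real m * real (card Q)"
      proof (rule partition_count[OF fin, of C])
        show "v \<in> C v \<and> C v \<subseteq> Q" if "v \<in> Q" for v using vC CQ[OF that] by blast
        show "C u = C v" if "v \<in> Q" "u \<in> C v" for u v by (rule Ceq[OF that])
        fix t assume t: "t \<in> Q"
        have "\<phi>1 v = fst (p (C t)) v" if "v \<in> C t" for v using Ceq[OF t that] by (simp add: \<phi>1_def)
        then have "{v \<in> C t. \<phi>1 v < 1} = {v \<in> C t. fst (p (C t)) v < 1}" by auto
        then show "real K * real (card {u \<in> C t. \<phi>1 u < 1}) \<le> real m * real (card (C t))"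
          using p[OF t] by (simp add: padded_def)
      qed
      have "{v \<in> Q. \<phi> v < 1} \<subseteq> {v \<in> Q. \<theta> v < \<gamma>} \<union> {v \<in> Q. \<phi>1 v < 1}"
        using assms(3) by (auto simp: \<phi>_def min_def split: if_splits)
      then have "card {v \<in> Q. \<phi> v < 1} \<le> card ({v \<in> Q. \<theta> v < \<gamma>} \<union> {v \<in> Q. \<phi>1 v < 1})"
        using fin by (intro card_mono) auto
      also have "\<dots> \<le> card {v \<in> Q. \<theta> v < \<gamma>} + card {v \<in> Q. \<phi>1 v < 1}" by (rule card_Un_le)
      finally have "real (card {v \<in> Q. \<phi> v < 1}) \<le> real (card {v \<in> Q. \<theta> v < \<gamma>}) + real (card {v \<in> Q. \<phi>1 v < 1})"
        by simp
      then have "real K * real (card {v \<in> Q. \<phi> v < 1}) \<le> real K * (real (card {v \<in> Q. \<theta> v < \<gamma>}) + real (card {v \<in> Q. \<phi>1 v < 1}))"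
        by (intro mult_left_mono) auto
      then show ?thesis using 1 bad by (simp add: algebra_simps)
    qed
    have "\<forall>v\<in>Q. v \<in> cl v \<and> cl v \<subseteq> Q \<and> conn E (cl v) \<and> chops R (Suc m) Q (cl v) \<and> (\<forall>u\<in>cl v. cl u = cl v)"
    proof
      fix v assume v: "v \<in> Q"
      have "chops R (Suc m) Q (cl v)" using chop[OF v] cl(4)[OF v] unfolding chops.simps by blast
      moreover have "cl v \<subseteq> Q" using cl(2)[OF v] CQ[OF v] by blast
      moreover have "\<forall>u\<in>cl v. cl u = cl v" using cl(5)[OF v] by blast
      ultimately show "v \<in> cl v \<and> cl v \<subseteq> Q \<and> conn E (cl v) \<and> chops R (Suc m) Q (cl v) \<and> (\<forall>u\<in>cl v. cl u = cl v)"
        using cl(1,3)[OF v] by blast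
    qed
    moreover have "\<forall>v\<in>Q. 0 \<le> \<phi> v \<and> \<phi> v \<le> 1" using \<phi>01(1,2) by blast
    moreover have "\<forall>u\<in>Q. \<forall>v\<in>Q. (u, v) \<in> E \<longrightarrow> cl u = cl v \<longrightarrow> \<bar>\<phi> u - \<phi> v\<bar> * \<gamma> \<le> max (w u) (w v)"
      by (intro ballI impI, rule edge[THEN conjunct1, THEN mp])
    moreover have "\<forall>u\<in>Q. \<forall>v\<in>Q. (u, v) \<in> E \<longrightarrow> cl u \<noteq> cl v \<longrightarrow>
        \<phi> u * \<gamma> \<le> max (w u) (w v) \<and> \<phi> v * \<gamma> \<le> max (w u) (w v)"
      by (intro ballI impI, rule edge[THEN conjunct2, THEN mp])
    ultimately have "padded \<gamma> K (Suc m) Q \<phi> cl"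
      using cnt unfolding padded_def R_def[symmetric] by (intro conjI)
    then show ?thesis by blast
  qed
qed

text \<open>A distance function on all of a set exists only if the set is connected. The components
  of \<open>V\<close> are therefore treated separately and glued, which creates no further edges
  between pieces.\<close>

lemma padded_components:
  assumes fin: "finite V" and \<gamma>: "0 < \<gamma>" and K: "0 < K"
  shows "\<exists>\<phi> cl. (\<forall>v\<in>V. v \<in> cl v \<and> cl v \<subseteq> V \<and> conn E (cl v) \<and> (\<forall>u\<in>cl v. cl u = cl v) \<and>
        (\<exists>Q\<subseteq>V. chops (2 * \<gamma> * real K) m Q (cl v))) \<and>
     (\<forall>v\<in>V. 0 \<le> \<phi> v \<and> \<phi> v \<le> 1) \<and>
     (\<forall>u\<in>V. \<forall>v\<in>V. (u, v) \<in> E \<longrightarrow> (cl u = cl v \<longrightarrow> \<bar>\<phi> u - \<phi> v\<bar> * \<gamma> \<le> max (w u) (w v)) \<and>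
        (cl u \<noteq> cl v \<longrightarrow> \<phi> u * \<gamma> \<le> max (w u) (w v) \<and> \<phi> v * \<gamma> \<le> max (w u) (w v))) \<and>
     real K * real (card {v \<in> V. \<phi> v < 1}) \<le> real m * real (card V)"
proof -
  define C where "C v = component E V v" for v
  have vC: "v \<in> C v" for v by (simp add: C_def)
  have CV: "C v \<subseteq> V" if "v \<in> V" for v unfolding C_def by (rule component_subset[OF that])
  have Cc: "conn E (C v)" if "v \<in> V" for v unfolding C_def by (rule conn_component[OF sym that])
  have Ceq: "C u = C v" if "v \<in> V" "u \<in> C v" for u v
    using component_eq[OF sym that(1)] that(2) unfolding C_def by blast
  have Cstep: "C u = C v" if "u \<in> V" "v \<in> V" "(u, v) \<in> E" for u v
  proof -
    have "u \<in> C v" unfolding C_def using component_step[OF component_self that(2,1) edge_sym[OF that(3)]] .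
    then show ?thesis by (rule Ceq[OF that(2)])
  qed
  have "\<exists>p. Z \<in> C ` V \<longrightarrow> padded \<gamma> K m Z (fst p) (snd p)" for Z
  proof (cases "Z \<in> C ` V")
    case True
    then obtain v where v: "v \<in> V" "Z = C v" by blast
    have "finite Z" using CV[OF v(1)] fin finite_subset v(2) by blast
    then obtain \<phi> cl where "padded \<gamma> K m Z \<phi> cl" using padded_exists[OF _ _ \<gamma> K] Cc[OF v(1)] v(2) by blast
    then show ?thesis by (intro exI[of _ "(\<phi>, cl)"]) simp
  qed blast
  then obtain p where "\<And>Z. Z \<in> C ` V \<Longrightarrow> padded \<gamma> K m Z (fst (p Z)) (snd (p Z))" by metis
  then have p: "padded \<gamma> K m (C v) (fst (p (C v))) (snd (p (C v)))" if "v \<in> V" for v using that by blast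
  define \<phi> where "\<phi> v = fst (p (C v)) v" for v
  define cl where "cl v = snd (p (C v)) v" for v
  have cl: "v \<in> cl v \<and> cl v \<subseteq> V \<and> conn E (cl v) \<and> (\<forall>u\<in>cl v. cl u = cl v) \<and>
        (\<exists>Q\<subseteq>V. chops (2 * \<gamma> * real K) m Q (cl v))" if v: "v \<in> V" for v
  proof -
    note pv = bspec[OF conjunct1[OF p[OF v, unfolded padded_def]] vC[of v], folded cl_def]
    have "cl u = cl v" if "u \<in> cl v" for u
    proof -
      have "C u = C v" by (rule Ceq[OF v]) (use pv that in blast)
      moreover have "snd (p (C v)) u = cl v" using pv that by blast
      ultimately show ?thesis by (simp add: cl_def)
    qed
    then show ?thesis using pv CV[OF v] by blast
  qed
  have \<phi>: "0 \<le> \<phi> v \<and> \<phi> v \<le> 1" if v: "v \<in> V" for v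
    by (rule bspec[OF conjunct1[OF conjunct2[OF p[OF v, unfolded padded_def]]] vC[of v], folded \<phi>_def])
  have edge: "(cl u = cl v \<longrightarrow> \<bar>\<phi> u - \<phi> v\<bar> * \<gamma> \<le> max (w u) (w v)) \<and>
      (cl u \<noteq> cl v \<longrightarrow> \<phi> u * \<gamma> \<le> max (w u) (w v) \<and> \<phi> v * \<gamma> \<le> max (w u) (w v))"
    if v: "u \<in> V" "v \<in> V" "(u, v) \<in> E" for u v
  proof -
    have CC: "C u = C v" by (rule Cstep[OF v])
    note pv = p[OF v(2), unfolded padded_def]
    have u: "u \<in> C v" using vC[of u] CC by simp
    note e1 = bspec[OF bspec[OF conjunct1[OF conjunct2[OF conjunct2[OF pv]]] u] vC]
    note e2 = bspec[OF bspec[OF conjunct1[OF conjunct2[OF conjunct2[OF conjunct2[OF pv]]]] u] vC]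
    show ?thesis unfolding cl_def \<phi>_def CC using e1[rule_format, OF v(3)] e2[rule_format, OF v(3)] by blast
  qed
  have "real K * real (card {v \<in> V. \<phi> v < 1}) \<le> real m * real (card V)"
  proof (rule partition_count[OF fin, of C])
    show "v \<in> C v \<and> C v \<subseteq> V" if "v \<in> V" for v using vC CV[OF that] by blast
    show "C u = C v" if "v \<in> V" "u \<in> C v" for u v by (rule Ceq[OF that])
    fix t assume t: "t \<in> V"
    have "\<phi> v = fst (p (C t)) v" if "v \<in> C t" for v using Ceq[OF t that] by (simp add: \<phi>_def)
    then have "{v \<in> C t. \<phi> v < 1} = {v \<in> C t. fst (p (C t)) v < 1}" by auto
    then show "real K * real (card {u \<in> C t. \<phi> u < 1}) \<le> real m * real (card (C t))"
      using p[OF t] by (simp add: padded_def)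
  qed
  moreover have "\<forall>u\<in>V. \<forall>v\<in>V. (u, v) \<in> E \<longrightarrow> (cl u = cl v \<longrightarrow> \<bar>\<phi> u - \<phi> v\<bar> * \<gamma> \<le> max (w u) (w v)) \<and>
        (cl u \<noteq> cl v \<longrightarrow> \<phi> u * \<gamma> \<le> max (w u) (w v) \<and> \<phi> v * \<gamma> \<le> max (w u) (w v))"
    by (intro ballI impI edge)
  moreover note ballI[of V, OF cl] ballI[of V, OF \<phi>]
  ultimately show ?thesis by - (rule exI[of _ \<phi>], rule exI[of _ cl], intro conjI)
qed

end

section \<open>Spectral theorem and min-max bound\<close>

lemma symmetric_scalar_prod:
  assumes "A \<in> carrier_mat n n" "transpose_mat A = A" "x \<in> carrier_vec n" "y \<in> carrier_vec n"
  shows "x \<bullet> (A *\<^sub>v y) = (A *\<^sub>v x) \<bullet> (y :: real vec)"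
  using transpose_vec_mult_scalar[OF assms(1) assms(4) assms(3)] assms by simp

text \<open>A complex eigenvector has real and imaginary parts \<open>x\<close> and
  \<open>y\<close>. Comparing the products of \<open>x\<close> with \<open>A y\<close> and of
  \<open>A x\<close> with \<open>y\<close> gives \<open>Im k\<close> times the sum of their squared
  norms equal to 0, so \<open>k\<close> is real and a nonzero part is an eigenvector.\<close>

lemma real_symmetric_eigenvector:
  fixes A :: "real mat"
  assumes A: "A \<in> carrier_mat n n" and sym: "transpose_mat A = A" and n: "0 < n"
  shows "\<exists>e v. v \<in> carrier_vec n \<and> v \<noteq> 0\<^sub>v n \<and> A *\<^sub>v v = e \<cdot>\<^sub>v v"
proof -
  define CA where "CA = map_mat complex_of_real A"
  have CA: "CA \<in> carrier_mat n n" using A by (simp add: CA_def)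
  obtain k where "eigenvalue CA k" using spectrum_non_empty[OF CA n] by (auto simp: spectrum_def)
  then obtain z where z: "z \<in> carrier_vec n" "z \<noteq> 0\<^sub>v n" "CA *\<^sub>v z = k \<cdot>\<^sub>v z"
    using CA by (auto simp: eigenvalue_def eigenvector_def)
  define x where "x = vec n (\<lambda>i. Re (z $ i))"
  define y where "y = vec n (\<lambda>i. Im (z $ i))"
  have xy: "x \<in> carrier_vec n" "y \<in> carrier_vec n" by (simp_all add: x_def y_def)
  have eq: "(\<Sum>j<n. of_real (A $$ (i, j)) * z $ j) = k * z $ i" if i: "i < n" for i
  proof -
    have "(CA *\<^sub>v z) $ i = (\<Sum>j<n. of_real (A $$ (i, j)) * z $ j)"
      using i A z(1) by (simp add: CA_def scalar_prod_def atLeast0LessThan)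
    moreover have "(CA *\<^sub>v z) $ i = k * z $ i" using z i by simp
    ultimately show ?thesis by simp
  qed
  have Ax: "(A *\<^sub>v x) $ i = Re k * x $ i - Im k * y $ i" and Ay: "(A *\<^sub>v y) $ i = Im k * x $ i + Re k * y $ i"
    if i: "i < n" for i
  proof -
    have "(A *\<^sub>v x) $ i = (\<Sum>j<n. A $$ (i, j) * Re (z $ j))"
      using i A by (simp add: x_def scalar_prod_def atLeast0LessThan)
    also have "\<dots> = Re (\<Sum>j<n. of_real (A $$ (i, j)) * z $ j)" by simp
    finally show "(A *\<^sub>v x) $ i = Re k * x $ i - Im k * y $ i" using i by (simp add: eq x_def y_def)
    have "(A *\<^sub>v y) $ i = (\<Sum>j<n. A $$ (i, j) * Im (z $ j))"
      using i A by (simp add: y_def scalar_prod_def atLeast0LessThan)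
    also have "\<dots> = Im (\<Sum>j<n. of_real (A $$ (i, j)) * z $ j)" by simp
    finally show "(A *\<^sub>v y) $ i = Im k * x $ i + Re k * y $ i" using i by (simp add: eq x_def y_def)
  qed
  have sx: "u \<bullet> v = (\<Sum>i<n. u $ i * v $ i)" if "v \<in> carrier_vec n" for u v :: "real vec"
    using that by (simp add: scalar_prod_def atLeast0LessThan)
  have AV: "A *\<^sub>v x \<in> carrier_vec n" "A *\<^sub>v y \<in> carrier_vec n" using A xy by auto
  have "x \<bullet> (A *\<^sub>v y) = (A *\<^sub>v x) \<bullet> y" by (rule symmetric_scalar_prod[OF A sym xy])
  then have "(\<Sum>i<n. x $ i * (Im k * x $ i + Re k * y $ i)) = (\<Sum>i<n. (Re k * x $ i - Im k * y $ i) * y $ i)"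
    using sx[OF AV(2), of x] sx[OF xy(2), of "A *\<^sub>v x"] by (simp add: Ax Ay)
  then have "(\<Sum>i<n. x $ i * (Im k * x $ i + Re k * y $ i) - (Re k * x $ i - Im k * y $ i) * y $ i) = 0"
    by (simp add: sum_subtractf)
  also have "(\<Sum>i<n. x $ i * (Im k * x $ i + Re k * y $ i) - (Re k * x $ i - Im k * y $ i) * y $ i)
      = Im k * (\<Sum>i<n. (x $ i)\<^sup>2 + (y $ i)\<^sup>2)"
    unfolding sum_distrib_left by (intro sum.cong refl) (simp add: algebra_simps power2_eq_square)
  finally have "Im k * (\<Sum>i<n. (x $ i)\<^sup>2 + (y $ i)\<^sup>2) = 0" .
  moreover have "(\<Sum>i<n. (x $ i)\<^sup>2 + (y $ i)\<^sup>2) \<noteq> 0"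
  proof
    assume "(\<Sum>i<n. (x $ i)\<^sup>2 + (y $ i)\<^sup>2) = 0"
    then have "\<forall>i<n. (x $ i)\<^sup>2 + (y $ i)\<^sup>2 = 0" by (subst (asm) sum_nonneg_eq_0_iff) auto
    then have "\<forall>i<n. z $ i = 0" by (simp add: x_def y_def sum_power2_eq_zero_iff complex_eq_iff)
    then have "z = 0\<^sub>v n" using z(1) by (intro eq_vecI) auto
    then show False using z(2) by simp
  qed
  ultimately have k: "Im k = 0" by simp
  have "A *\<^sub>v x = Re k \<cdot>\<^sub>v x" "A *\<^sub>v y = Re k \<cdot>\<^sub>v y"
    using xy A by (auto intro!: eq_vecI simp: Ax Ay k simp del: index_mult_mat_vec)
  moreover have "x \<noteq> 0\<^sub>v n \<or> y \<noteq> 0\<^sub>v n"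
  proof (rule ccontr)
    assume "\<not> ?thesis"
    then have xy0: "x = 0\<^sub>v n" "y = 0\<^sub>v n" by auto
    have "Re (z $ i) = 0" "Im (z $ i) = 0" if "i < n" for i
      using arg_cong[OF xy0(1), of "\<lambda>v. v $ i"] arg_cong[OF xy0(2), of "\<lambda>v. v $ i"] that
      by (simp_all add: x_def y_def)
    then have "z = 0\<^sub>v n" using z(1) by (intro eq_vecI) (auto simp: complex_eq_iff)
    then show False using z(2) by simp
  qed
  ultimately show ?thesis using xy by blast
qed

lemma orthonormal_completion:
  fixes v :: "real vec"
  assumes v: "v \<in> carrier_vec n" "v \<noteq> 0\<^sub>v n"
  shows "\<exists>W c. W \<in> carrier_mat n n \<and> transpose_mat W * W = 1\<^sub>m n \<and> col W 0 = c \<cdot>\<^sub>v v"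
proof -
  interpret cof_vec_space n "TYPE(real)" .
  have n: "0 < n"
  proof (rule ccontr)
    assume "\<not> 0 < n"
    then have "v = 0\<^sub>v n" using v by (intro eq_vecI) auto
    then show False using v by simp
  qed
  define b where "b = basis_completion v"
  define ws where "ws = gram_schmidt n b"
  from basis_completion[OF v, folded b_def]
  have dist_b: "distinct b" and indep: "\<not> lin_dep (set b)" and b: "set b \<subseteq> carrier_vec n"
    and hdb: "hd b = v" and len_b: "length b = n" by auto
  from hdb len_b n obtain vs where bv: "b = v # vs" by (cases b, auto)
  from gram_schmidt_result[OF b dist_b indep refl, folded ws_def]
  have ws: "set ws \<subseteq> carrier_vec n" "corthogonal ws" "length ws = n" by (auto simp: len_b)
  from gram_schmidt_hd[OF v(1), of vs, folded bv] have hdws: "hd ws = v" unfolding ws_def .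
  have wsi: "ws ! i \<in> carrier_vec n" if "i < n" for i using ws that by auto
  have orth: "ws ! i \<bullet> ws ! j = 0 \<longleftrightarrow> i \<noteq> j" if "i < n" "j < n" for i j
    using corthogonalD[OF ws(2), of i j] that ws(3) by simp
  define c where "c i = 1 / sqrt (ws ! i \<bullet> ws ! i)" for i
  define W where "W = mat_of_cols n (map (\<lambda>i. c i \<cdot>\<^sub>v ws ! i) [0..<n])"
  have W: "W \<in> carrier_mat n n"
    using mat_of_cols_carrier(1)[of n "map (\<lambda>i. c i \<cdot>\<^sub>v ws ! i) [0..<n]"] by (simp add: W_def)
  have colW: "col W i = c i \<cdot>\<^sub>v ws ! i" if "i < n" for i
    unfolding W_def using that wsi[OF that] by (subst col_mat_of_cols) auto
  have "transpose_mat W * W = 1\<^sub>m n"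
  proof (rule eq_matI)
    fix i j assume ij: "i < dim_row (1\<^sub>m n :: real mat)" "j < dim_col (1\<^sub>m n :: real mat)"
    then have "(transpose_mat W * W) $$ (i, j) = c i * c j * (ws ! i \<bullet> ws ! j)"
      using W wsi[of i] wsi[of j] by (simp add: colW)
    also have "\<dots> = 1\<^sub>m n $$ (i, j)"
    proof (cases "i = j")
      case True
      have "0 < ws ! i \<bullet> ws ! i"
      proof -
        have "0 \<le> ws ! i \<bullet> ws ! i" by (simp add: scalar_prod_def sum_nonneg)
        then show ?thesis using orth[of i i] ij by simp
      qed
      then show ?thesis using True ij by (simp add: c_def flip: real_sqrt_mult)
    next
      case False
      then show ?thesis using orth[of i j] ij by simp
    qed
    finally show "(transpose_mat W * W) $$ (i, j) = 1\<^sub>m n $$ (i, j)" .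
  qed (use W in auto)
  moreover have "col W 0 = c 0 \<cdot>\<^sub>v v" using colW[OF n] hdws ws(3) n by (metis hd_conv_nth length_greater_0_conv)
  ultimately show ?thesis using W by blast
qed

text \<open>Deflation: conjugating by an orthogonal matrix whose first column is an eigenvector
  splits off a 1 by 1 block, because symmetry clears the first row along with the first
  column.\<close>

lemma real_spectral_theorem:
  fixes A :: "real mat"
  assumes "A \<in> carrier_mat n n" "transpose_mat A = A"
  shows "\<exists>U D. U \<in> carrier_mat n n \<and> D \<in> carrier_mat n n \<and> transpose_mat U * U = 1\<^sub>m n \<and> diagonal_mat D \<and>
     A = U * D * transpose_mat U"
  using assms
proof (induction n arbitrary: A)
  case 0
  then show ?case
    by (intro exI[of _ "1\<^sub>m 0"] exI[of _ A]) (auto simp: diagonal_mat_def intro!: eq_matI)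
next
  case (Suc n)
  obtain e v where v: "v \<in> carrier_vec (Suc n)" "v \<noteq> 0\<^sub>v (Suc n)" "A *\<^sub>v v = e \<cdot>\<^sub>v v"
    using real_symmetric_eigenvector[OF Suc.prems] by auto
  obtain W c where W: "W \<in> carrier_mat (Suc n) (Suc n)" "transpose_mat W * W = 1\<^sub>m (Suc n)" "col W 0 = c \<cdot>\<^sub>v v"
    using orthonormal_completion[OF v(1,2)] by auto
  define Wt where "Wt = transpose_mat W"
  have Wt: "Wt \<in> carrier_mat (Suc n) (Suc n)" using W by (simp add: Wt_def)
  have WWt: "W * Wt = 1\<^sub>m (Suc n)"
    using mat_mult_left_right_inverse[OF Wt W(1)] W(2) by (simp add: Wt_def)
  note A = Suc.prems(1)
  define A' where "A' = Wt * (A * W)"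
  have AW: "A * W \<in> carrier_mat (Suc n) (Suc n)" using A W by simp
  have A': "A' \<in> carrier_mat (Suc n) (Suc n)" using A W Wt by (simp add: A'_def)
  have symA': "transpose_mat A' = A'"
  proof -
    have "transpose_mat A' = transpose_mat (A * W) * transpose_mat Wt"
      unfolding A'_def by (rule transpose_mult[OF Wt AW])
    also have "transpose_mat (A * W) = Wt * A" using transpose_mult[OF A W(1)] Suc.prems(2) by (simp add: Wt_def)
    also have "transpose_mat Wt = W" by (simp add: Wt_def)
    finally show ?thesis using assoc_mult_mat[OF Wt A W(1)] by (simp add: A'_def)
  qed
  have colAW: "col (A * W) 0 = e \<cdot>\<^sub>v col W 0"
  proof -
    have "col (A * W) 0 = A *\<^sub>v col W 0" using A W by (intro col_mult2) auto
    also have "\<dots> = c \<cdot>\<^sub>v (A *\<^sub>v v)" using A v by (simp add: W(3) mult_mat_vec)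
    finally show ?thesis using v by (simp add: W(3) smult_smult_assoc mult.commute)
  qed
  have A'0: "A' $$ (i, 0) = (if i = 0 then e else 0)" if i: "i < Suc n" for i
  proof -
    have cW: "col W i \<in> carrier_vec (Suc n)" "col W 0 \<in> carrier_vec (Suc n)" using W(1) by (auto intro!: carrier_vecI)
    have "A' $$ (i, 0) = col W i \<bullet> (e \<cdot>\<^sub>v col W 0)"
      using i A W Wt AW colAW by (simp add: A'_def Wt_def)
    also have "\<dots> = e * (col W i \<bullet> col W 0)" using cW by simp
    also have "col W i \<bullet> col W 0 = (transpose_mat W * W) $$ (i, 0)" using i W(1) by simp
    also have "\<dots> = (if i = 0 then 1 else 0)" using i W(2) by simp
    finally show ?thesis by simp
  qed
  have A'0': "A' $$ (0, j) = (if j = 0 then e else 0)" if j: "j < Suc n" for j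
  proof -
    have "A' $$ (0, j) = transpose_mat A' $$ (0, j)" by (simp add: symA')
    also have "\<dots> = A' $$ (j, 0)" using j A' by simp
    finally show ?thesis using A'0[OF j] by simp
  qed
  define A2 where "A2 = mat n n (\<lambda>(i, j). A' $$ (Suc i, Suc j))"
  have A2: "A2 \<in> carrier_mat n n" by (simp add: A2_def)
  have "transpose_mat A2 = A2"
  proof (rule eq_matI)
    fix i j assume "i < dim_row A2" "j < dim_col A2"
    then have ij: "i < n" "j < n" using A2 by auto
    have "A' $$ (Suc j, Suc i) = transpose_mat A' $$ (Suc i, Suc j)" using ij A' by simp
    then show "transpose_mat A2 $$ (i, j) = A2 $$ (i, j)" using ij by (simp add: A2_def symA')
  qed (use A2 in auto)
  from Suc.IH[OF A2 this] obtain U2 D2 where U2: "U2 \<in> carrier_mat n n" "D2 \<in> carrier_mat n n"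
    "transpose_mat U2 * U2 = 1\<^sub>m n" "diagonal_mat D2" "A2 = U2 * D2 * transpose_mat U2" by blast
  define E1 where "E1 = mat 1 1 (\<lambda>_. e)"
  have E1: "E1 \<in> carrier_mat 1 1" by (simp add: E1_def)
  define U' where "U' = four_block_mat (1\<^sub>m 1) (0\<^sub>m 1 n) (0\<^sub>m n 1) U2"
  define D where "D = four_block_mat E1 (0\<^sub>m 1 n) (0\<^sub>m n 1) D2"
  have U': "U' \<in> carrier_mat (Suc n) (Suc n)" using U2(1) four_block_carrier_mat[of "1\<^sub>m 1" 1 1 U2 n n] by (simp add: U'_def)
  have D: "D \<in> carrier_mat (Suc n) (Suc n)" using U2(2) E1 four_block_carrier_mat[of E1 1 1 D2 n n] by (simp add: D_def)
  have Ut: "transpose_mat U' = four_block_mat (1\<^sub>m 1) (0\<^sub>m 1 n) (0\<^sub>m n 1) (transpose_mat U2)"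
    unfolding U'_def using U2(1) by (subst transpose_four_block_mat[of _ 1 1 _ n _ n]) auto
  have U2t: "transpose_mat U2 \<in> carrier_mat n n" using U2(1) by simp
  have UtU: "transpose_mat U' * U' = 1\<^sub>m (Suc n)"
    unfolding Ut unfolding U'_def
    using U2 by (subst mult_four_block_mat[of _ 1 1 _ n _ n _ _ 1 _ n]) auto
  have UD: "U' * D = four_block_mat E1 (0\<^sub>m 1 n) (0\<^sub>m n 1) (U2 * D2)"
    unfolding U'_def D_def using U2 E1
    by (subst mult_four_block_mat[of _ 1 1 _ n _ n _ _ 1 _ n]) auto
  have UDU: "U' * D * transpose_mat U' = four_block_mat E1 (0\<^sub>m 1 n) (0\<^sub>m n 1) A2"
    unfolding UD Ut U2(5) using U2 E1 U2t
    by (subst mult_four_block_mat[of _ 1 1 _ n _ n _ _ 1 _ n]) auto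
  have A'eq: "A' = U' * D * transpose_mat U'"
    unfolding UDU
  proof (rule eq_matI)
    fix i j assume "i < dim_row (four_block_mat E1 (0\<^sub>m 1 n) (0\<^sub>m n 1) A2)" "j < dim_col (four_block_mat E1 (0\<^sub>m 1 n) (0\<^sub>m n 1) A2)"
    then have ij: "i < Suc n" "j < Suc n" using E1 A2 by auto
    show "A' $$ (i, j) = four_block_mat E1 (0\<^sub>m 1 n) (0\<^sub>m n 1) A2 $$ (i, j)"
      using ij A'0[of i] A'0'[of j] by (cases i; cases j) (auto simp: E1_def A2_def)
  qed (use A' E1 A2 in auto)
  have dD: "diagonal_mat D"
    using U2(2,4) by (auto simp: diagonal_mat_def D_def E1_def)
  define U where "U = W * U'"
  have U: "U \<in> carrier_mat (Suc n) (Suc n)" using W U' by (simp add: U_def)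
  have Utt: "transpose_mat U = transpose_mat U' * Wt" unfolding U_def Wt_def by (rule transpose_mult[OF W(1) U'])
  have U't: "transpose_mat U' \<in> carrier_mat (Suc n) (Suc n)" using U' by simp
  have "transpose_mat U * U = transpose_mat U' * (Wt * (W * U'))"
    unfolding Utt using U' W Wt by (simp add: U_def assoc_mult_mat[of _ "Suc n" "Suc n" _ "Suc n" _ "Suc n"])
  also have "Wt * (W * U') = U'"
    using assoc_mult_mat[OF Wt W(1) U'] W(2) U' by (simp add: Wt_def)
  finally have "transpose_mat U * U = 1\<^sub>m (Suc n)" using UtU by simp
  moreover have "A = U * D * transpose_mat U"
  proof -
    have "U * D * transpose_mat U = W * (U' * D * transpose_mat U') * Wt"
      unfolding Utt unfolding U_def using W U' D U't Wt
      by (simp add: assoc_mult_mat[of _ "Suc n" "Suc n" _ "Suc n" _ "Suc n"])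
    also have "\<dots> = W * (Wt * (A * W)) * Wt" unfolding A'eq[symmetric] A'_def ..
    also have "\<dots> = (W * Wt) * A * (W * Wt)"
      using W Wt A AW by (simp add: assoc_mult_mat[of _ "Suc n" "Suc n" _ "Suc n" _ "Suc n"])
    also have "\<dots> = A" using A by (simp add: WWt)
    finally show ?thesis by simp
  qed
  ultimately show ?case using U D dD by blast
qed

lemma real_quadratic_form:
  fixes U D :: "real mat"
  assumes U: "U \<in> carrier_mat n n" and D: "D \<in> carrier_mat n n" and UU: "transpose_mat U * U = 1\<^sub>m n"
    and diag: "diagonal_mat D" and x: "x \<in> carrier_vec n"
  defines "y \<equiv> transpose_mat U *\<^sub>v x"
  shows "x \<bullet> ((U * D * transpose_mat U) *\<^sub>v x) = (\<Sum>i<n. D $$ (i, i) * (y $ i)\<^sup>2)"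
    and "x \<bullet> x = (\<Sum>i<n. (y $ i)\<^sup>2)"
proof -
  have Ut: "transpose_mat U \<in> carrier_mat n n" using U by simp
  have y: "y \<in> carrier_vec n" using Ut x by (simp add: y_def)
  have Dy: "D *\<^sub>v y \<in> carrier_vec n" using D y by simp
  have UUt: "U * transpose_mat U = 1\<^sub>m n" by (rule mat_mult_left_right_inverse[OF Ut U UU])
  have "(U * D * transpose_mat U) *\<^sub>v x = (U * D) *\<^sub>v y"
    unfolding y_def by (rule assoc_mult_mat_vec) (use U D Ut x in auto)
  also have "\<dots> = U *\<^sub>v (D *\<^sub>v y)" by (rule assoc_mult_mat_vec[OF U D y])
  finally have "x \<bullet> ((U * D * transpose_mat U) *\<^sub>v x) = y \<bullet> (D *\<^sub>v y)"
    unfolding y_def using transpose_vec_mult_scalar[OF U Dy x] by (simp add: y_def)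
  also have "\<dots> = (\<Sum>i<n. y $ i * (D *\<^sub>v y) $ i)"
    unfolding scalar_prod_def carrier_vecD[OF Dy] atLeast0LessThan ..
  also have "\<dots> = (\<Sum>i<n. D $$ (i, i) * (y $ i)\<^sup>2)"
  proof (rule sum.cong[OF refl])
    fix i assume i: "i \<in> {..<n}"
    have "(D *\<^sub>v y) $ i = (\<Sum>j<n. D $$ (i, j) * y $ j)"
      using i D y by (simp add: scalar_prod_def atLeast0LessThan)
    also have "\<dots> = (\<Sum>j<n. if j = i then D $$ (i, i) * y $ i else 0)"
      using diag D i by (intro sum.cong refl) (auto simp: diagonal_mat_def)
    also have "\<dots> = D $$ (i, i) * y $ i" using i by simp
    finally show "y $ i * (D *\<^sub>v y) $ i = D $$ (i, i) * (y $ i)\<^sup>2" by (simp add: power2_eq_square)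
  qed
  finally show "x \<bullet> ((U * D * transpose_mat U) *\<^sub>v x) = (\<Sum>i<n. D $$ (i, i) * (y $ i)\<^sup>2)" .
  have "U *\<^sub>v y = (U * transpose_mat U) *\<^sub>v x"
    unfolding y_def by (rule assoc_mult_mat_vec[symmetric, OF U Ut x])
  then have "U *\<^sub>v y = x" using UUt x by simp
  then have "x \<bullet> x = y \<bullet> y"
    using transpose_vec_mult_scalar[OF U y x] by (simp add: y_def)
  then show "x \<bullet> x = (\<Sum>i<n. (y $ i)\<^sup>2)"
    using y by (simp add: scalar_prod_def atLeast0LessThan power2_eq_square)
qed

text \<open>Zero rows pad the coefficients to a square matrix; as \<open>r < k\<close> the last row
  is zero, and the determinant vanishes.\<close>

lemma homogeneous_system:
  fixes b :: "nat \<Rightarrow> nat \<Rightarrow> real"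
  assumes "r < k"
  shows "\<exists>c. (\<exists>i<k. c i \<noteq> 0) \<and> (\<forall>j<r. (\<Sum>i<k. b j i * c i) = 0)"
proof -
  define B where "B = mat\<^sub>r k k (\<lambda>j. if j = k - 1 then 0\<^sub>v k else vec k (\<lambda>i. if j < r then b j i else 0))"
  have B: "B \<in> carrier_mat k k" by (intro carrier_matI) (simp_all add: B_def)
  have "det B = 0" unfolding B_def by (rule det_row_0) (use assms in auto)
  then obtain v where v: "v \<in> carrier_vec k" "v \<noteq> 0\<^sub>v k" "B *\<^sub>v v = 0\<^sub>v k"
    using det_0_iff_vec_prod_zero[OF B] by blast
  have "\<exists>i<k. v $ i \<noteq> 0"
  proof (rule ccontr)
    assume "\<not> ?thesis"
    then have "v = 0\<^sub>v k" using v(1) by (intro eq_vecI) auto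
    then show False using v(2) by simp
  qed
  moreover have "(\<Sum>i<k. b j i * v $ i) = 0" if j: "j < r" for j
  proof -
    have "(B *\<^sub>v v) $ j = (\<Sum>i<k. B $$ (j, i) * v $ i)"
      using j assms B v(1) by (simp add: scalar_prod_def atLeast0LessThan)
    also have "\<dots> = (\<Sum>i<k. b j i * v $ i)"
      using j assms by (intro sum.cong refl) (auto simp: B_def)
    finally show ?thesis using v(3) j assms by simp
  qed
  ultimately show ?thesis by blast
qed

text \<open>A root of one product must occur among the roots of the other, and its factor can be
  cancelled. This identifies any list of roots of the characteristic polynomial with the diagonal
  from the spectral theorem.\<close>

lemma linear_factors_mset:
  fixes xs ys :: "real list"
  assumes "prod_list (map (\<lambda>x. [:- x, 1:]) xs) = prod_list (map (\<lambda>x. [:- x, 1:]) ys)"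
  shows "mset xs = mset ys"
  using assms
proof (induction xs arbitrary: ys)
  case Nil
  show ?case
  proof (cases ys)
    case (Cons y zs)
    have "poly (prod_list (map (\<lambda>x. [:- x, 1:]) ys)) y = 0" by (simp add: Cons)
    then show ?thesis by (simp flip: Nil.prems)
  qed simp
next
  case (Cons x xs)
  have "poly (prod_list (map (\<lambda>x. [:- x, 1:]) ys)) x = 0" by (simp flip: Cons.prems)
  then have "x \<in> set ys" by (induction ys) auto
  then obtain us vs where ys: "ys = us @ x # vs" by (meson split_list)
  have "[:- x, 1:] * prod_list (map (\<lambda>x. [:- x, 1:]) xs) = [:- x, 1:] * prod_list (map (\<lambda>x. [:- x, 1:]) (us @ vs))"
    using Cons.prems
    by (simp only: ys map_append list.map prod_list.append prod_list.Cons mult.left_commute)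
  then have "prod_list (map (\<lambda>x. [:- x, 1:]) xs) = prod_list (map (\<lambda>x. [:- x, 1:]) (us @ vs))"
    by (simp only: mult_cancel_left) simp
  then have "mset xs = mset (us @ vs)" by (rule Cons.IH)
  then show ?case by (simp add: ys)
qed

lemma char_poly_spectral:
  fixes A :: "real mat"
  assumes U: "U \<in> carrier_mat n n" and D: "D \<in> carrier_mat n n" and UU: "transpose_mat U * U = 1\<^sub>m n"
    and diag: "diagonal_mat D" and A: "A = U * D * transpose_mat U"
  shows "char_poly A = prod_list (map (\<lambda>x. [:- x, 1:]) (diag_mat D))"
proof -
  have Ut: "transpose_mat U \<in> carrier_mat n n" using U by simp
  have UUt: "U * transpose_mat U = 1\<^sub>m n" by (rule mat_mult_left_right_inverse[OF Ut U UU])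
  have "similar_mat_wit A D U (transpose_mat U)"
    by (rule similar_mat_witI[OF UUt UU A]) (use A U D Ut in auto)
  then have "char_poly A = char_poly D" by (intro char_poly_similar) (auto simp: similar_mat_def)
  also have "upper_triangular D" using diag D by (auto simp: diagonal_mat_def upper_triangular_def)
  then have "char_poly D = prod_list (map (\<lambda>x. [:- x, 1:]) (diag_mat D))"
    using char_poly_upper_triangular[OF D] by simp
  finally show ?thesis .
qed

text \<open>Justifies the \<open>THE\<close> in \<open>lap_eigenvalues\<close>.\<close>

lemma sorted_eigenvalues_exist:
  fixes A :: "real mat"
  assumes "A \<in> carrier_mat n n" "transpose_mat A = A"
  shows "\<exists>!xs. sorted xs \<and> char_poly A = prod_list (map (\<lambda>x. [:- x, 1:]) xs)"
proof -
  obtain U D where UD: "U \<in> carrier_mat n n" "D \<in> carrier_mat n n" "transpose_mat U * U = 1\<^sub>m n"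
      "diagonal_mat D" "A = U * D * transpose_mat U"
    using real_spectral_theorem[OF assms] by blast
  have cp: "char_poly A = prod_list (map (\<lambda>x. [:- x, 1:]) (diag_mat D))" by (rule char_poly_spectral[OF UD])
  show ?thesis
  proof (rule ex1I[of _ "sort (diag_mat D)"])
    have "prod_list (map (\<lambda>x. [:- x, 1:]) (sort (diag_mat D))) = prod_mset (image_mset (\<lambda>x. [:- x, 1:]) (mset (sort (diag_mat D))))"
      by (simp only: prod_mset_prod_list[symmetric] mset_map)
    also have "\<dots> = prod_list (map (\<lambda>x. [:- x, 1:]) (diag_mat D))"
      by (simp only: prod_mset_prod_list[symmetric] mset_map mset_sort)
    finally show "sorted (sort (diag_mat D)) \<and> char_poly A = prod_list (map (\<lambda>x. [:- x, 1:]) (sort (diag_mat D)))"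
      using cp by simp
  next
    fix xs assume xs: "sorted xs \<and> char_poly A = prod_list (map (\<lambda>x. [:- x, 1:]) xs)"
    then have "mset xs = mset (diag_mat D)" using cp by (intro linear_factors_mset) simp
    then show "xs = sort (diag_mat D)" using xs by (metis properties_for_sort)
  qed
qed

text \<open>If the \<open>k\<close>-th eigenvalue exceeded \<open>M\<close>, fewer than
  \<open>k\<close> eigenvectors would belong to eigenvalues at most \<open>M\<close>. Some
  nontrivial combination of the \<open>k\<close> test vectors is then orthogonal to all of these,
  and its quadratic form is too large. Linear independence of the test vectors is contained in
  \<open>H\<close>.\<close>

lemma courant_fischer_upper:
  fixes A :: "real mat" and f :: "nat \<Rightarrow> real vec"
  assumes A: "A \<in> carrier_mat n n" "transpose_mat A = A" and es: "sorted es"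
    and cp: "char_poly A = prod_list (map (\<lambda>x. [:- x, 1:]) es)" and k: "1 \<le> k" "k \<le> n"
    and f: "\<And>i. i < k \<Longrightarrow> f i \<in> carrier_vec n"
    and H: "\<And>c x. \<exists>i<k. c i \<noteq> 0 \<Longrightarrow> x = vec n (\<lambda>j. \<Sum>i<k. c i * f i $ j) \<Longrightarrow> x \<noteq> 0\<^sub>v n \<and> x \<bullet> (A *\<^sub>v x) \<le> M * (x \<bullet> x)"
  shows "es ! (k - 1) \<le> M"
proof (rule ccontr)
  assume "\<not> ?thesis"
  then have big: "M < es ! (k - 1)" by simp
  obtain U D where UD: "U \<in> carrier_mat n n" "D \<in> carrier_mat n n" "transpose_mat U * U = 1\<^sub>m n"
      "diagonal_mat D" "A = U * D * transpose_mat U"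
    using real_spectral_theorem[OF A] by blast
  define ds where "ds = diag_mat D"
  have lds: "length ds = n" using UD(2) by (simp add: ds_def diag_mat_def)
  have ms: "mset es = mset ds"
    using char_poly_spectral[OF UD] cp unfolding ds_def by (intro linear_factors_mset) simp
  then have les: "length es = n" using lds by (metis size_mset)
  have dsi: "ds ! i = D $$ (i, i)" if "i < n" for i using that UD(2) by (simp add: ds_def diag_mat_def)
  define js where "js = filter (\<lambda>i. ds ! i \<le> M) [0..<n]"
  have "length js < k"
  proof -
    have "length js = length (filter (\<lambda>x. x \<le> M) ds)"
      unfolding js_def length_filter_conv_card lds by (intro arg_cong[of _ _ card]) auto
    also have "\<dots> = size (filter_mset (\<lambda>x. x \<le> M) (mset ds))" by (metis mset_filter size_mset)
    also have "\<dots> = length (filter (\<lambda>x. x \<le> M) es)" by (metis ms mset_filter size_mset)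
    also have "\<dots> = card {i. i < n \<and> es ! i \<le> M}" by (simp add: length_filter_conv_card les)
    also have "{i. i < n \<and> es ! i \<le> M} \<subseteq> {..<k - 1}"
    proof
      fix i assume i: "i \<in> {i. i < n \<and> es ! i \<le> M}"
      show "i \<in> {..<k - 1}"
      proof (rule ccontr)
        assume "i \<notin> {..<k - 1}"
        then have "es ! (k - 1) \<le> es ! i" using i es les by (intro sorted_nth_mono) auto
        then show False using i big by simp
      qed
    qed
    then have "card {i. i < n \<and> es ! i \<le> M} \<le> k - 1" using card_mono[of "{..<k - 1}"] by simp
    also have "k - 1 < k" using k by simp
    finally show ?thesis by simp
  qed
  define Ut where "Ut = transpose_mat U"
  have Ut: "Ut \<in> carrier_mat n n" using UD(1) by (simp add: Ut_def)
  obtain c where c: "\<exists>i<k. c i \<noteq> 0" "\<forall>j<length js. (\<Sum>i<k. (Ut *\<^sub>v f i) $ (js ! j) * c i) = 0"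
    using homogeneous_system[OF \<open>length js < k\<close>, of "\<lambda>j i. (Ut *\<^sub>v f i) $ (js ! j)"] by blast
  define x where "x = vec n (\<lambda>j. \<Sum>i<k. c i * f i $ j)"
  have x: "x \<in> carrier_vec n" by (simp add: x_def)
  have Hx: "x \<noteq> 0\<^sub>v n" "x \<bullet> (A *\<^sub>v x) \<le> M * (x \<bullet> x)" using H[OF c(1) x_def] by auto
  define y where "y = Ut *\<^sub>v x"
  have y_i: "y $ l = (\<Sum>i<k. (Ut *\<^sub>v f i) $ l * c i)" if l: "l < n" for l
  proof -
    have "y $ l = (\<Sum>j<n. Ut $$ (l, j) * (\<Sum>i<k. c i * f i $ j))"
      using l Ut by (simp add: y_def x_def scalar_prod_def atLeast0LessThan)
    also have "\<dots> = (\<Sum>j<n. \<Sum>i<k. Ut $$ (l, j) * f i $ j * c i)"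
      by (simp add: sum_distrib_left mult_ac)
    also have "\<dots> = (\<Sum>i<k. \<Sum>j<n. Ut $$ (l, j) * f i $ j * c i)" by (rule sum.swap)
    also have "\<dots> = (\<Sum>i<k. (Ut *\<^sub>v f i) $ l * c i)"
    proof (rule sum.cong[OF refl])
      fix i assume "i \<in> {..<k}"
      then have "f i \<in> carrier_vec n" using f by simp
      then have "(Ut *\<^sub>v f i) $ l = (\<Sum>j<n. Ut $$ (l, j) * f i $ j)"
        using l Ut by (simp add: scalar_prod_def atLeast0LessThan)
      then show "(\<Sum>j<n. Ut $$ (l, j) * f i $ j * c i) = (Ut *\<^sub>v f i) $ l * c i" by (simp add: sum_distrib_right)
    qed
    finally show ?thesis .
  qed
  have y0: "y $ l = 0" if l: "l < n" "D $$ (l, l) \<le> M" for l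
  proof -
    have "l \<in> set js" using l dsi by (simp add: js_def)
    then obtain j where "j < length js" "js ! j = l" by (auto simp: in_set_conv_nth)
    then show ?thesis using c(2) y_i[OF l(1)] by auto
  qed
  have q1: "x \<bullet> (A *\<^sub>v x) = (\<Sum>i<n. D $$ (i, i) * (y $ i)\<^sup>2)"
    using real_quadratic_form(1)[OF UD(1-4) x] UD(5) by (simp add: y_def Ut_def)
  have q2: "x \<bullet> x = (\<Sum>i<n. (y $ i)\<^sup>2)"
    using real_quadratic_form(2)[OF UD(1-4) x] by (simp add: y_def Ut_def)
  have "0 < x \<bullet> x"
    using conjugate_square_greater_0_vec[OF x] Hx(1) by simp
  then have "\<exists>i<n. y $ i \<noteq> 0" unfolding q2 by (metis (no_types, lifting) lessThan_iff less_irrefl power_zero_numeral sum.neutral)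
  then obtain i where i: "i < n" "y $ i \<noteq> 0" by blast
  have "(\<Sum>i<n. M * (y $ i)\<^sup>2) < (\<Sum>i<n. D $$ (i, i) * (y $ i)\<^sup>2)"
  proof (rule sum_strict_mono_ex1)
    show "\<forall>i\<in>{..<n}. M * (y $ i)\<^sup>2 \<le> D $$ (i, i) * (y $ i)\<^sup>2"
    proof
      fix l assume "l \<in> {..<n}"
      then show "M * (y $ l)\<^sup>2 \<le> D $$ (l, l) * (y $ l)\<^sup>2"
        using y0[of l] by (cases "D $$ (l, l) \<le> M") (auto intro: mult_right_mono)
    qed
    have "M < D $$ (i, i)" using y0[of i] i by (cases "D $$ (i, i) \<le> M") auto
    then have "M * (y $ i)\<^sup>2 < D $$ (i, i) * (y $ i)\<^sup>2" using i by (intro mult_strict_right_mono) auto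
    then show "\<exists>a\<in>{..<n}. M * (y $ a)\<^sup>2 < D $$ (a, a) * (y $ a)\<^sup>2" using i by blast
  qed simp
  then have "M * (x \<bullet> x) < x \<bullet> (A *\<^sub>v x)" by (simp add: q1 q2 sum_distrib_left)
  then show False using Hx(2) by simp
qed

section \<open>The quadratic form of the Laplacian and disjointly supported test functions\<close>

definition adj :: "graph \<Rightarrow> nat \<Rightarrow> nat \<Rightarrow> real" where
  "adj G u v = (if {u, v} \<in> edges G then 1 else 0)"

lemma adj_sym: "adj G u v = adj G v u"
  by (simp add: adj_def insert_commute)

lemma adj_nonneg: "0 \<le> adj G u v"
  by (simp add: adj_def)

lemma graph_edgeD:
  assumes "graph G" "{u, v} \<in> edges G"
  shows "u \<in> verts G" "v \<in> verts G" "u \<noteq> v"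
  using assms by (auto simp: graph_def doubleton_eq_iff)

lemma degree_adj:
  assumes "graph G" "v \<in> verts G"
  shows "real (degree G v) = (\<Sum>u\<in>verts G. adj G v u)"
proof -
  have fin: "finite (verts G)" using assms by (simp add: graph_def)
  have "{e \<in> edges G. v \<in> e} = (\<lambda>u. {v, u}) ` {u \<in> verts G. {v, u} \<in> edges G}"
  proof (intro subset_antisym subsetI)
    fix e assume e: "e \<in> {e \<in> edges G. v \<in> e}"
    then obtain a b where ab: "a \<in> verts G" "b \<in> verts G" "e = {a, b}" using assms(1) by (auto simp: graph_def)
    then have "e = {v, a} \<and> v = b \<or> e = {v, b} \<and> v = a" using e by auto
    then show "e \<in> (\<lambda>u. {v, u}) ` {u \<in> verts G. {v, u} \<in> edges G}" using ab e by auto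
  qed auto
  moreover have "inj_on (\<lambda>u. {v, u}) {u \<in> verts G. {v, u} \<in> edges G}"
    by (auto simp: inj_on_def doubleton_eq_iff)
  ultimately have "degree G v = card {u \<in> verts G. {v, u} \<in> edges G}" by (simp add: degree_def card_image)
  then show ?thesis using fin by (simp add: adj_def sum.If_cases Int_def)
qed

text \<open>The double sum meets every edge in both orientations, hence the division by 2.\<close>

lemma laplacian_form:
  assumes G: "graph G"
  defines "vs \<equiv> sorted_list_of_set (verts G)" and "n \<equiv> card (verts G)"
  shows "laplacian G \<in> carrier_mat n n" "transpose_mat (laplacian G) = laplacian G"
    and "vec n (\<lambda>i. g (vs ! i)) \<bullet> (laplacian G *\<^sub>v vec n (\<lambda>i. g (vs ! i)))
      = (\<Sum>u\<in>verts G. \<Sum>v\<in>verts G. adj G u v * (g u - g v)\<^sup>2) / 2"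
    and "vec n (\<lambda>i. g (vs ! i)) \<bullet> vec n (\<lambda>i. g (vs ! i)) = (\<Sum>v\<in>verts G. (g v)\<^sup>2)"
proof -
  define V where "V = verts G"
  have fin: "finite V" using G by (simp add: graph_def V_def)
  have vs: "length vs = n" "distinct vs" "set vs = V" using fin by (simp_all add: vs_def n_def V_def)
  have L: "laplacian G = mat n n (\<lambda>(i, j). if i = j then real (degree G (vs ! i))
                       else if {vs ! i, vs ! j} \<in> edges G then -1 else 0)"
    using vs(1) unfolding laplacian_def vs_def[symmetric] Let_def by simp
  show Lc: "laplacian G \<in> carrier_mat n n" by (simp add: L)
  show "transpose_mat (laplacian G) = laplacian G"
    by (rule eq_matI) (auto simp: L insert_commute)
  have bij: "bij_betw (\<lambda>i. vs ! i) {..<n} V" using bij_betw_nth[OF vs(2)] vs by simp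
  have re: "(\<Sum>i<n. F (vs ! i)) = (\<Sum>v\<in>V. F v)" for F :: "nat \<Rightarrow> real"
    by (rule sum.reindex_bij_betw[OF bij])
  show "vec n (\<lambda>i. g (vs ! i)) \<bullet> vec n (\<lambda>i. g (vs ! i)) = (\<Sum>v\<in>verts G. (g v)\<^sup>2)"
    using re[of "\<lambda>v. (g v)\<^sup>2"] by (simp add: scalar_prod_def atLeast0LessThan power2_eq_square V_def)
  define l where "l u v = (if u = v then real (degree G u) else 0) - adj G u v" for u v
  have adj0: "adj G u u = 0" for u using graph_edgeD[OF G, of u u] by (auto simp: adj_def)
  have Lij: "laplacian G $$ (i, j) = l (vs ! i) (vs ! j)" if "i < n" "j < n" for i j
    using that vs adj0[of "vs ! j"] by (auto simp: L l_def nth_eq_iff_index_eq adj_def)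
  have "vec n (\<lambda>i. g (vs ! i)) \<bullet> (laplacian G *\<^sub>v vec n (\<lambda>i. g (vs ! i)))
      = (\<Sum>i<n. g (vs ! i) * (\<Sum>j<n. laplacian G $$ (i, j) * g (vs ! j)))"
    using Lc by (simp add: scalar_prod_def atLeast0LessThan)
  also have "\<dots> = (\<Sum>i<n. g (vs ! i) * (\<Sum>j<n. l (vs ! i) (vs ! j) * g (vs ! j)))"
    by (intro sum.cong refl arg_cong2[of _ _ _ _ "(*)"]) (simp_all add: Lij)
  also have "\<dots> = (\<Sum>u\<in>V. g u * (\<Sum>v\<in>V. l u v * g v))"
    using re[of "\<lambda>u. g u * (\<Sum>j<n. l u (vs ! j) * g (vs ! j))"] re[of "\<lambda>v. l u v * g v" for u] by simp
  also have "\<dots> = (\<Sum>u\<in>V. real (degree G u) * (g u)\<^sup>2 - (\<Sum>v\<in>V. adj G u v * g u * g v))"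
  proof (rule sum.cong[OF refl])
    fix u assume u: "u \<in> V"
    have "(\<Sum>v\<in>V. l u v * g v) = (\<Sum>v\<in>V. (if u = v then real (degree G u) * g v else 0) - adj G u v * g v)"
      by (intro sum.cong refl) (simp add: l_def left_diff_distrib)
    also have "\<dots> = real (degree G u) * g u - (\<Sum>v\<in>V. adj G u v * g v)"
      using fin u by (simp add: sum_subtractf)
    finally show "g u * (\<Sum>v\<in>V. l u v * g v) = real (degree G u) * (g u)\<^sup>2 - (\<Sum>v\<in>V. adj G u v * g u * g v)"
      by (simp add: right_diff_distrib power2_eq_square sum_distrib_left mult_ac)
  qed
  also have "\<dots> = (\<Sum>u\<in>V. \<Sum>v\<in>V. adj G u v * (g u)\<^sup>2) - (\<Sum>u\<in>V. \<Sum>v\<in>V. adj G u v * g u * g v)"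
    using degree_adj[OF G] by (simp add: sum_subtractf V_def sum_distrib_right)
  finally have 1: "vec n (\<lambda>i. g (vs ! i)) \<bullet> (laplacian G *\<^sub>v vec n (\<lambda>i. g (vs ! i))) =
      (\<Sum>u\<in>V. \<Sum>v\<in>V. adj G u v * (g u)\<^sup>2) - (\<Sum>u\<in>V. \<Sum>v\<in>V. adj G u v * g u * g v)" .
  have 2: "(\<Sum>u\<in>V. \<Sum>v\<in>V. adj G u v * (g v)\<^sup>2) = (\<Sum>u\<in>V. \<Sum>v\<in>V. adj G u v * (g u)\<^sup>2)"
    by (subst sum.swap) (simp add: adj_sym)
  have "(\<Sum>u\<in>V. \<Sum>v\<in>V. adj G u v * (g u - g v)\<^sup>2) =
      (\<Sum>u\<in>V. \<Sum>v\<in>V. adj G u v * (g u)\<^sup>2 + adj G u v * (g v)\<^sup>2 - 2 * (adj G u v * g u * g v))"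
    by (intro sum.cong refl) (simp add: power2_eq_square algebra_simps)
  also have "\<dots> = 2 * (\<Sum>u\<in>V. \<Sum>v\<in>V. adj G u v * (g u)\<^sup>2) - 2 * (\<Sum>u\<in>V. \<Sum>v\<in>V. adj G u v * g u * g v)"
    by (simp add: sum.distrib sum_subtractf sum_distrib_left[symmetric] 2)
  finally show "vec n (\<lambda>i. g (vs ! i)) \<bullet> (laplacian G *\<^sub>v vec n (\<lambda>i. g (vs ! i)))
      = (\<Sum>u\<in>verts G. \<Sum>v\<in>verts G. adj G u v * (g u - g v)\<^sup>2) / 2"
    using 1 by (simp add: V_def)
qed

text \<open>Edges may join the supports of different test functions, so the energies are not
  additive; a factor 2 is lost. It cancels against the 1/2 in \<open>laplacian_form\<close>, which
  is why \<open>en\<close> uses the sum over ordered pairs.\<close>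

lemma lap_eig_le:
  fixes f :: "nat \<Rightarrow> nat \<Rightarrow> real"
  assumes G: "graph G" and k: "1 \<le> k" "k \<le> card (verts G)"
    and disj: "\<And>i j v. i < k \<Longrightarrow> j < k \<Longrightarrow> i \<noteq> j \<Longrightarrow> f i v = 0 \<or> f j v = 0"
    and nz: "\<And>i. i < k \<Longrightarrow> 0 < (\<Sum>v\<in>verts G. (f i v)\<^sup>2)"
    and en: "\<And>i. i < k \<Longrightarrow> (\<Sum>u\<in>verts G. \<Sum>v\<in>verts G. adj G u v * (f i u - f i v)\<^sup>2) \<le> M * (\<Sum>v\<in>verts G. (f i v)\<^sup>2)"
  shows "lap_eig G k \<le> M"
proof -
  define vs where "vs = sorted_list_of_set (verts G)"
  define n where "n = card (verts G)"
  define V where "V = verts G"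
  note L = laplacian_form[OF G, folded vs_def n_def V_def]
  have fin: "finite V" using G by (simp add: graph_def V_def)
  have ev: "sorted (lap_eigenvalues G)" "char_poly (laplacian G) = prod_list (map (\<lambda>x. [:- x, 1:]) (lap_eigenvalues G))"
    using theI'[OF sorted_eigenvalues_exist[OF L(1,2)]] unfolding lap_eigenvalues_def by auto
  have single: "\<exists>i<k. \<forall>j<k. j \<noteq> i \<longrightarrow> f j v = 0" for v
  proof (cases "\<exists>i<k. f i v \<noteq> 0")
    case True
    then show ?thesis using disj by metis
  next
    case False
    then show ?thesis using k by (intro exI[of _ 0]) auto
  qed
  have collapse: "(\<Sum>j<k. F j) = F i" if "i < k" "\<And>j. j < k \<Longrightarrow> j \<noteq> i \<Longrightarrow> F j = 0" for F :: "nat \<Rightarrow> real" and i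
    using that by (subst sum.mono_neutral_right[of _ "{i}"]) auto
  have "lap_eigenvalues G ! (k - 1) \<le> M"
  proof (rule courant_fischer_upper[OF L(1,2) ev k[folded n_def], of "\<lambda>i. vec n (\<lambda>j. f i (vs ! j))"])
    fix c :: "nat \<Rightarrow> real" and x
    assume c: "\<exists>i<k. c i \<noteq> 0" and x0: "x = vec n (\<lambda>j. \<Sum>i<k. c i * vec n (\<lambda>j. f i (vs ! j)) $ j)"
    define g where "g v = (\<Sum>i<k. c i * f i v)" for v
    have x: "x = vec n (\<lambda>j. g (vs ! j))" unfolding x0 g_def by (intro eq_vecI) auto
    have g2: "(g v)\<^sup>2 = (\<Sum>i<k. (c i)\<^sup>2 * (f i v)\<^sup>2)" for v
    proof -
      obtain i where i: "i < k" "\<forall>j<k. j \<noteq> i \<longrightarrow> f j v = 0" using single by blast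
      have "g v = c i * f i v" unfolding g_def by (rule collapse[OF i(1)]) (use i in auto)
      moreover have "(\<Sum>i<k. (c i)\<^sup>2 * (f i v)\<^sup>2) = (c i)\<^sup>2 * (f i v)\<^sup>2" by (rule collapse[OF i(1)]) (use i in auto)
      ultimately show ?thesis by (simp add: power_mult_distrib)
    qed
    \<comment> \<open>At most one test function is nonzero at each end. If it is the same one at
      both ends, the bound even holds without the factor 2; otherwise it is the inequality between
      the square of a difference and twice the sum of the squares.\<close>
    have gg: "(g u - g v)\<^sup>2 \<le> 2 * (\<Sum>i<k. (c i)\<^sup>2 * (f i u - f i v)\<^sup>2)" for u v
    proof -
      obtain i where i: "i < k" "\<forall>j<k. j \<noteq> i \<longrightarrow> f j u = 0" using single by blast
      obtain l where l: "l < k" "\<forall>j<k. j \<noteq> l \<longrightarrow> f j v = 0" using single by blast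
      have gu: "g u = c i * f i u" unfolding g_def by (rule collapse[OF i(1)]) (use i in auto)
      have gv: "g v = c l * f l v" unfolding g_def by (rule collapse[OF l(1)]) (use l in auto)
      have "(\<Sum>i<k. (c i)\<^sup>2 * (f i u * f i v)) = (if i = l then g u * g v else 0)"
      proof (cases "i = l")
        case True
        have "(\<Sum>i<k. (c i)\<^sup>2 * (f i u * f i v)) = (c i)\<^sup>2 * (f i u * f i v)"
          by (rule collapse[OF i(1)]) (use i in auto)
        then show ?thesis using True gu gv by (simp add: power2_eq_square)
      next
        case False
        have "(c j)\<^sup>2 * (f j u * f j v) = 0" if "j < k" for j using i l that False by (cases "j = i") auto
        then have "(\<Sum>i<k. (c i)\<^sup>2 * (f i u * f i v)) = 0" by (intro sum.neutral) auto
        then show ?thesis using False by simp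
      qed
      moreover have "(\<Sum>i<k. (c i)\<^sup>2 * (f i u - f i v)\<^sup>2) = (\<Sum>i<k. (c i)\<^sup>2 * (f i u)\<^sup>2 + (c i)\<^sup>2 * (f i v)\<^sup>2 - 2 * ((c i)\<^sup>2 * (f i u * f i v)))"
        by (intro sum.cong refl) (simp add: power2_eq_square algebra_simps)
      then have "(\<Sum>i<k. (c i)\<^sup>2 * (f i u - f i v)\<^sup>2) = (g u)\<^sup>2 + (g v)\<^sup>2 - 2 * (\<Sum>i<k. (c i)\<^sup>2 * (f i u * f i v))"
        by (simp add: sum.distrib sum_subtractf g2 sum_distrib_left)
      moreover have "0 \<le> (g u - g v)\<^sup>2" "0 \<le> (g u + g v)\<^sup>2" by simp_all
      ultimately show ?thesis by (auto simp: power2_eq_square algebra_simps split: if_splits)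
    qed
    have xx: "x \<bullet> x = (\<Sum>i<k. (c i)\<^sup>2 * (\<Sum>v\<in>V. (f i v)\<^sup>2))"
    proof -
      have "x \<bullet> x = (\<Sum>v\<in>V. \<Sum>i<k. (c i)\<^sup>2 * (f i v)\<^sup>2)" unfolding x L(4) g2 ..
      also have "\<dots> = (\<Sum>i<k. \<Sum>v\<in>V. (c i)\<^sup>2 * (f i v)\<^sup>2)" by (rule sum.swap)
      finally show ?thesis by (simp add: sum_distrib_left)
    qed
    have "x \<bullet> (laplacian G *\<^sub>v x) = (\<Sum>u\<in>V. \<Sum>v\<in>V. adj G u v * (g u - g v)\<^sup>2) / 2" unfolding x L(3) ..
    also have "\<dots> \<le> (\<Sum>u\<in>V. \<Sum>v\<in>V. adj G u v * (2 * (\<Sum>i<k. (c i)\<^sup>2 * (f i u - f i v)\<^sup>2))) / 2"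
      by (intro divide_right_mono sum_mono mult_left_mono gg adj_nonneg) simp
    also have "\<dots> = (\<Sum>u\<in>V. \<Sum>v\<in>V. \<Sum>i<k. (c i)\<^sup>2 * (adj G u v * (f i u - f i v)\<^sup>2))"
      by (simp add: sum_distrib_left sum_divide_distrib mult_ac)
    also have "\<dots> = (\<Sum>i<k. \<Sum>u\<in>V. \<Sum>v\<in>V. (c i)\<^sup>2 * (adj G u v * (f i u - f i v)\<^sup>2))"
    proof -
      have "(\<Sum>u\<in>V. \<Sum>v\<in>V. \<Sum>i<k. (c i)\<^sup>2 * (adj G u v * (f i u - f i v)\<^sup>2)) =
          (\<Sum>u\<in>V. \<Sum>i<k. \<Sum>v\<in>V. (c i)\<^sup>2 * (adj G u v * (f i u - f i v)\<^sup>2))"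
        by (intro sum.cong refl sum.swap)
      also have "\<dots> = (\<Sum>i<k. \<Sum>u\<in>V. \<Sum>v\<in>V. (c i)\<^sup>2 * (adj G u v * (f i u - f i v)\<^sup>2))" by (rule sum.swap)
      finally show ?thesis .
    qed
    also have "\<dots> = (\<Sum>i<k. (c i)\<^sup>2 * (\<Sum>u\<in>V. \<Sum>v\<in>V. adj G u v * (f i u - f i v)\<^sup>2))"
      by (simp add: sum_distrib_left)
    also have "\<dots> \<le> (\<Sum>i<k. (c i)\<^sup>2 * (M * (\<Sum>v\<in>V. (f i v)\<^sup>2)))"
      using en by (intro sum_mono mult_left_mono) (auto simp: V_def)
    also have "\<dots> = M * (x \<bullet> x)" unfolding xx by (simp add: sum_distrib_left mult_ac)
    finally have le: "x \<bullet> (laplacian G *\<^sub>v x) \<le> M * (x \<bullet> x)" .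
    obtain i where i: "i < k" "c i \<noteq> 0" using c by blast
    have "0 < (c i)\<^sup>2 * (\<Sum>v\<in>V. (f i v)\<^sup>2)" using i nz[OF i(1)] by (simp add: V_def)
    also have "\<dots> \<le> x \<bullet> x" unfolding xx
      using i(1) by (intro member_le_sum) (auto intro!: mult_nonneg_nonneg sum_nonneg)
    finally have "0 < x \<bullet> x" .
    then have "x \<noteq> 0\<^sub>v n" by (auto simp: scalar_prod_def)
    then show "x \<noteq> 0\<^sub>v n \<and> x \<bullet> (laplacian G *\<^sub>v x) \<le> M * (x \<bullet> x)" using le by blast
  qed simp
  then show ?thesis by (simp add: lap_eig_def)
qed

section \<open>Clique models and minors\<close>

definition edge_rel :: "graph \<Rightarrow> (nat \<times> nat) set" where
  "edge_rel G = {(u, v). {u, v} \<in> edges G}"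

lemma sym_edge_rel: "sym (edge_rel G)"
  by (auto simp: edge_rel_def sym_def insert_commute)

lemma conn_image:
  assumes "conn E S" "\<And>a b. a \<in> S \<Longrightarrow> b \<in> S \<Longrightarrow> (a, b) \<in> E \<Longrightarrow> g a = g b \<or> (g a, g b) \<in> E'"
  shows "conn E' (g ` S)"
proof -
  have "(g x, g y) \<in> (E' \<inter> g ` S \<times> g ` S)\<^sup>*" if "(x, y) \<in> (E \<inter> S \<times> S)\<^sup>*" for x y
    using that
  proof (induction rule: rtrancl_induct)
    case (step y z)
    then have "g y = g z \<or> (g y, g z) \<in> E' \<inter> g ` S \<times> g ` S" using assms(2)[of y z] by blast
    with step.IH show ?case by (metis rtrancl.rtrancl_into_rtrancl)
  qed simp
  then show ?thesis using assms(1) by (auto simp: conn_def)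
qed

lemma minor_remove_edges:
  assumes "finite X" "X \<subseteq> edges G" "minor H (verts G, edges G - X)"
  shows "minor H G"
  using assms
proof (induction X rule: finite_induct)
  case empty
  then show ?case by (simp add: verts_def edges_def)
next
  case (insert e X)
  define G' where "G' = (verts G, edges G - X)"
  have "delete_edge G' e = (verts G, edges G - insert e X)"
    by (auto simp: delete_edge_def G'_def verts_def edges_def)
  moreover have "e \<in> edges G'" using insert by (auto simp: G'_def edges_def)
  ultimately have "minor H G'" using minor.del_e[of H G' e] insert.prems by simp
  then show ?case using insert unfolding G'_def by simp
qed

lemma graph_delete_vertex: "graph G \<Longrightarrow> graph (delete_vertex G v)"
  unfolding graph_def delete_vertex_def verts_def edges_def fst_conv snd_conv by blast

lemma graph_contract_edge:
  assumes "graph G" "{u, v} \<in> edges G" "u \<noteq> v"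
  shows "graph (contract_edge G u v)"
proof -
  have uv: "u \<in> verts G" using assms by (auto simp: graph_def doubleton_eq_iff)
  have "\<exists>a b. a \<in> verts G - {v} \<and> b \<in> verts G - {v} \<and> a \<noteq> b \<and> e' = {a, b}"
    if e: "e \<in> edges G" "e' = (\<lambda>x. if x = v then u else x) ` e" "card e' = 2" for e e'
  proof -
    obtain a b where ab: "a \<in> verts G" "b \<in> verts G" "e = {a, b}" using assms(1) e(1) by (auto simp: graph_def)
    define g where "g x = (if x = v then u else x)" for x
    have e': "e' = {g a, g b}" using e(2) ab by (auto simp: g_def)
    have "g a \<noteq> g b"
    proof
      assume "g a = g b"
      then have "e' = {g a}" using e' by simp
      then show False using e(3) by simp
    qed
    moreover have "g a \<in> verts G - {v}" "g b \<in> verts G - {v}" using ab uv assms(3) by (auto simp: g_def)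
    ultimately show ?thesis using e' by blast
  qed
  then show ?thesis using assms(1) by (auto simp: graph_def contract_edge_def verts_def edges_def)
qed

text \<open>Any bijection of the vertices embeds \<open>H\<close> into the complete graph, and the
  surplus edges are deleted.\<close>

lemma complete_graph_minor:
  assumes G: "graph G" and H: "graph H" "card (verts H) = card (verts G)"
    and complete: "\<And>u v. u \<in> verts G \<Longrightarrow> v \<in> verts G \<Longrightarrow> u \<noteq> v \<Longrightarrow> {u, v} \<in> edges G"
  shows "minor H G"
proof -
  have fin: "finite (verts G)" "finite (verts H)" using G H by (simp_all add: graph_def)
  obtain f where f: "bij_betw f (verts H) (verts G)"
    using finite_same_card_bij[OF fin(2,1) H(2)] by blast
  have inj: "inj_on f (verts H)" and img: "f ` verts H = verts G" using f by (auto simp: bij_betw_def)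
  define X where "X = edges G - (\<lambda>e. f ` e) ` edges H"
  have "edges G \<subseteq> Pow (verts G)" using G by (auto simp: graph_def)
  then have finE: "finite (edges G)" using fin finite_subset by blast
  define G' where "G' = (verts G, edges G - X)"
  have eH: "f ` e \<in> edges G" if e: "e \<in> edges H" for e
  proof -
    obtain a b where ab: "a \<in> verts H" "b \<in> verts H" "a \<noteq> b" "e = {a, b}" using H(1) e by (auto simp: graph_def)
    then have "f a \<noteq> f b" using inj by (auto simp: inj_on_def)
    then have "{f a, f b} \<in> edges G" using ab img by (intro complete) auto
    then show ?thesis using ab by simp
  qed
  have eG': "edges G' = (\<lambda>e. f ` e) ` edges H" using eH by (auto simp: G'_def X_def edges_def)
  have vG': "verts G' = verts G" by (simp add: G'_def verts_def)
  have "graph G'" using G by (auto simp: graph_def G'_def verts_def edges_def)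
  moreover have "graph_iso H G'"
    unfolding graph_iso_def
  proof (intro exI[of _ f] conjI ballI)
    show "bij_betw f (verts H) (verts G')" using f by (simp add: vG')
    fix u v assume uv: "u \<in> verts H" "v \<in> verts H"
    show "({u, v} \<in> edges H) = ({f u, f v} \<in> edges G')"
    proof
      assume "{u, v} \<in> edges H"
      then have "f ` {u, v} \<in> edges G'" unfolding eG' by (rule imageI)
      then show "{f u, f v} \<in> edges G'" by simp
    next
      assume "{f u, f v} \<in> edges G'"
      then obtain e where e: "e \<in> edges H" "f ` {u, v} = f ` e" unfolding eG' by auto
      have "e \<subseteq> verts H" using e H(1) by (auto simp: graph_def)
      then have "{u, v} = e" using inj_on_image_eq_iff[OF inj, of "{u, v}" e] uv e(2) by auto
      then show "{u, v} \<in> edges H" using e by simp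
    qed
  qed
  ultimately have "minor H G'" using H by (intro minor.iso)
  then show ?thesis
    using minor_remove_edges[of X G H] finE unfolding G'_def by (simp add: X_def)
qed

lemma kmodel_minor:
  assumes "graph G" "kmodel (edge_rel G) (verts G) B (card (verts H))" "graph H"
  shows "minor H G"
  using assms
proof (induction "card (verts G)" arbitrary: G B rule: less_induct)
  case less
  define h where "h = card (verts H)"
  define E where "E = edge_rel G"
  have fin: "finite (verts G)" using less.prems by (simp add: graph_def)
  have B: "B i \<noteq> {}" "B i \<subseteq> verts G" "conn E (B i)" if "i < h" for i
    using less.prems(2) that by (auto simp: kmodel_def h_def E_def)
  have Bd: "B i \<inter> B j = {}" "\<exists>x\<in>B i. \<exists>y\<in>B j. (x, y) \<in> E" if "i < h" "j < h" "i \<noteq> j" for i j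
    using less.prems(2) that by (auto simp: kmodel_def h_def E_def)
  consider (unused) v where "v \<in> verts G" "v \<notin> (\<Union>i<h. B i)"
    | (big) i x y where "i < h" "x \<in> B i" "y \<in> B i" "x \<noteq> y"
    | (single) "verts G \<subseteq> (\<Union>i<h. B i)" "\<And>i x y. i < h \<Longrightarrow> x \<in> B i \<Longrightarrow> y \<in> B i \<Longrightarrow> x = y"
    by blast
  then show ?case
  proof cases
    case unused
    define G' where "G' = delete_vertex G v"
    have vG': "verts G' = verts G - {v}" by (simp add: G'_def delete_vertex_def verts_def)
    have E': "(x, y) \<in> edge_rel G'" if "(x, y) \<in> E" "x \<noteq> v" "y \<noteq> v" for x y
      using that by (auto simp: edge_rel_def G'_def delete_vertex_def edges_def E_def)
    have nv: "v \<notin> B i" if "i < h" for i using unused that by blast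
    have "kmodel (edge_rel G') (verts G') B h"
      unfolding kmodel_def
    proof (intro conjI allI impI)
      fix i assume i: "i < h"
      show "B i \<noteq> {}" by (rule B(1)[OF i])
      show "B i \<subseteq> verts G'" using B(2)[OF i] nv[OF i] by (auto simp: vG')
      show "conn (edge_rel G') (B i)"
        using conn_image[OF B(3)[OF i], of "\<lambda>x. x" "edge_rel G'"] E' nv[OF i] by auto
      fix j assume j: "j < h" "i \<noteq> j"
      show "B i \<inter> B j = {}" by (rule Bd(1)[OF i j])
      obtain x y where xy: "x \<in> B i" "y \<in> B j" "(x, y) \<in> E" using Bd(2)[OF i j] by blast
      then have "x \<noteq> v" "y \<noteq> v" using nv[OF i] nv[OF j(1)] by auto
      then show "\<exists>x\<in>B i. \<exists>y\<in>B j. (x, y) \<in> edge_rel G'" using xy E' by blast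
    qed
    moreover have "card (verts G') < card (verts G)" unfolding vG' by (rule card_Diff1_less[OF fin unused(1)])
    moreover have "graph G'" unfolding G'_def by (rule graph_delete_vertex[OF less.prems(1)])
    ultimately have "minor H G'" using less.hyps less.prems(3) by (simp add: h_def)
    then show ?thesis unfolding G'_def using unused(1) by (rule minor.del_v)
  next
    case big
    note i = big(1)
    obtain u v where uv: "u \<in> B i" "u \<in> {x}" "v \<in> B i" "v \<notin> {x}" "(u, v) \<in> E"
      using conn_crossing[OF B(3)[OF i] big(2) _ big(3), of "{x}"] big(4) by blast
    then have ne: "u \<noteq> v" and e: "{u, v} \<in> edges G" by (auto simp: E_def edge_rel_def)
    have vV: "v \<in> verts G" using uv B(2)[OF i] by blast
    define G' where "G' = contract_edge G u v"
    define g where "g x = (if x = v then u else x)" for x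
    have vG': "verts G' = verts G - {v}" by (simp add: G'_def contract_edge_def verts_def)
    have E': "(g a, g b) \<in> edge_rel G'" if "(a, b) \<in> E" "g a \<noteq> g b" for a b
    proof -
      have "{a, b} \<in> edges G" using that by (simp add: E_def edge_rel_def)
      moreover have "{g a, g b} = (\<lambda>x. if x = v then u else x) ` {a, b}" by (simp add: g_def)
      moreover have "card {g a, g b} = 2" using that(2) by simp
      ultimately have "{g a, g b} \<in> edges G'" unfolding G'_def contract_edge_def edges_def by auto
      then show ?thesis by (simp add: edge_rel_def)
    qed
    define B' where "B' j = g ` B j" for j
    have B'i: "B' i = B i - {v}" using uv ne by (auto simp: B'_def g_def)
    have B'j: "B' j = B j" if "j < h" "j \<noteq> i" for j
    proof -
      have "v \<notin> B j" using Bd(1)[OF that(1) i that(2)] uv by blast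
      then show ?thesis by (force simp: B'_def g_def)
    qed
    have B'B: "B' j \<subseteq> B j" if "j < h" for j using B'i B'j[OF that] by (cases "j = i") auto
    have vB': "v \<notin> B' j" for j using ne by (auto simp: B'_def g_def)
    have "kmodel (edge_rel G') (verts G') B' h"
      unfolding kmodel_def
    proof (intro conjI allI impI)
      fix j assume j: "j < h"
      show "B' j \<noteq> {}" using B(1)[OF j] by (simp add: B'_def)
      show "B' j \<subseteq> verts G'" using B'B[OF j] vB'[of j] B(2)[OF j] by (auto simp: vG')
      show "conn (edge_rel G') (B' j)"
        unfolding B'_def by (rule conn_image[OF B(3)[OF j]]) (use E' in blast)
      fix l assume l: "l < h" "j \<noteq> l"
      show dis: "B' j \<inter> B' l = {}" using Bd(1)[OF j l] B'B[OF j] B'B[OF l(1)] by blast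
      obtain a b where ab: "a \<in> B j" "b \<in> B l" "(a, b) \<in> E" using Bd(2)[OF j l] by blast
      then have gab: "g a \<in> B' j" "g b \<in> B' l" by (auto simp: B'_def)
      then have "g a \<noteq> g b" using dis by (metis disjoint_iff)
      then show "\<exists>x\<in>B' j. \<exists>y\<in>B' l. (x, y) \<in> edge_rel G'" using gab E'[OF ab(3)] by blast
    qed
    moreover have "card (verts G') < card (verts G)" unfolding vG' by (rule card_Diff1_less[OF fin vV])
    moreover have "graph G'" unfolding G'_def by (rule graph_contract_edge[OF less.prems(1) e ne])
    ultimately have "minor H G'" using less.hyps less.prems(3) by (simp add: h_def)
    then show ?thesis unfolding G'_def using e ne by (rule minor.contr)
  next
    case single
    define b where "b i = (SOME x. x \<in> B i)" for i
    have bi: "B i = {b i}" if i: "i < h" for i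
    proof -
      obtain x where "x \<in> B i" using B(1)[OF i] by blast
      then have "b i \<in> B i" unfolding b_def by (rule someI)
      then show ?thesis using single(2)[OF i] by blast
    qed
    have "(\<Union>i<h. B i) = (\<Union>i<h. {b i})" using bi by (intro SUP_cong) auto
    moreover have "(\<Union>i<h. B i) \<subseteq> verts G" by (intro UN_least B(2)) simp
    ultimately have Vb: "verts G = b ` {..<h}" using single(1) by auto
    have "inj_on b {..<h}"
    proof (rule inj_onI, rule ccontr)
      fix i j assume ij: "i \<in> {..<h}" "j \<in> {..<h}" "b i = b j" "i \<noteq> j"
      then show False using Bd(1)[of i j] bi[of i] bi[of j] by auto
    qed
    then have "card (verts H) = card (verts G)" using Vb by (simp add: card_image h_def)
    moreover have "{u, v} \<in> edges G" if uv: "u \<in> verts G" "v \<in> verts G" "u \<noteq> v" for u v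
    proof -
      obtain i j where "i < h" "j < h" "u = b i" "v = b j" using uv Vb by auto
      then show ?thesis using Bd(2)[of i j] bi[of i] bi[of j] uv(3) by (auto simp: E_def edge_rel_def)
    qed
    ultimately show ?thesis by (intro complete_graph_minor less.prems)
  qed
qed

lemma minor_closed_no_kmodel:
  assumes "\<forall>G\<in>F. graph G" "minor_closed F" "graph H" "H \<notin> F" "G \<in> F"
  shows "\<not> (\<exists>B. kmodel (edge_rel G) (verts G) B (card (verts H)))"
  using assms kmodel_minor unfolding minor_closed_def by blast

section \<open>The eigenvalue bound\<close>

lemma degree_le_max_degree:
  assumes "graph G" "v \<in> verts G"
  shows "degree G v \<le> max_degree G"
  using assms by (simp add: max_degree_def graph_def)

text \<open>Indicators of \<open>k\<close> single vertices are the test functions; each has mass 1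
  and, over ordered pairs, energy twice the degree. This covers the range where \<open>n / k\<close>
  is bounded.\<close>

lemma lap_eig_le_max_degree:
  assumes G: "graph G" and k: "1 \<le> k" "k \<le> card (verts G)"
  shows "lap_eig G k \<le> 2 * real (max_degree G)"
proof -
  define V where "V = verts G"
  have fin: "finite V" using G by (simp add: graph_def V_def)
  obtain e where e: "bij_betw e {0..<card V} V" using ex_bij_betw_nat_finite[OF fin] by blast
  have eV: "e i \<in> V" if "i < k" for i using e that k by (auto simp: bij_betw_def V_def)
  have einj: "e i \<noteq> e j" if "i < k" "j < k" "i \<noteq> j" for i j
    using e that k by (auto simp: bij_betw_def V_def inj_on_def)
  define f where "f i v = (if v = e i then 1 else 0 :: real)" for i v
  show ?thesis
  proof (rule lap_eig_le[OF G k, of f])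
    fix i j v assume "i < k" "j < k" "i \<noteq> j"
    then show "f i v = 0 \<or> f j v = 0" using einj[of i j] by (auto simp: f_def)
  next
    fix i assume i: "i < k"
    have mass: "(\<Sum>v\<in>verts G. (f i v)\<^sup>2) = 1"
    proof -
      have "(\<Sum>v\<in>V. (f i v)\<^sup>2) = (\<Sum>v\<in>V. if v = e i then 1 else 0)" by (intro sum.cong refl) (simp add: f_def)
      then show ?thesis using fin eV[OF i] by (simp add: V_def)
    qed
    then show "0 < (\<Sum>v\<in>verts G. (f i v)\<^sup>2)" by simp
    have "(\<Sum>u\<in>V. \<Sum>v\<in>V. adj G u v * (f i u - f i v)\<^sup>2) \<le> (\<Sum>u\<in>V. \<Sum>v\<in>V. adj G u v * f i u + adj G u v * f i v)"
      by (intro sum_mono) (auto simp: f_def adj_def)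
    also have "\<dots> = (\<Sum>u\<in>V. \<Sum>v\<in>V. adj G u v * f i u) + (\<Sum>u\<in>V. \<Sum>v\<in>V. adj G u v * f i v)"
      by (simp add: sum.distrib)
    also have "(\<Sum>u\<in>V. \<Sum>v\<in>V. adj G u v * f i v) = (\<Sum>u\<in>V. \<Sum>v\<in>V. adj G u v * f i u)"
      by (subst sum.swap) (simp add: adj_sym)
    also have "(\<Sum>u\<in>V. \<Sum>v\<in>V. adj G u v * f i u) = (\<Sum>u\<in>V. if u = e i then real (degree G u) else 0)"
    proof (rule sum.cong[OF refl])
      fix u assume "u \<in> V"
      then show "(\<Sum>v\<in>V. adj G u v * f i u) = (if u = e i then real (degree G u) else 0)"
        using degree_adj[OF G, of u] by (auto simp: f_def V_def)
    qed
    also have "\<dots> = real (degree G (e i))" using fin eV[OF i] by simp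
    finally show "(\<Sum>u\<in>verts G. \<Sum>v\<in>verts G. adj G u v * (f i u - f i v)\<^sup>2)
        \<le> 2 * real (max_degree G) * (\<Sum>v\<in>verts G. (f i v)\<^sup>2)"
      using degree_le_max_degree[OF G, of "e i"] eV[OF i] mass by (simp add: V_def)
  qed
qed

text \<open>A Markov-type argument: the functions with quotient above \<open>4 * \<E> / n\<close>
  carry mass at most \<open>n / 4\<close> in total. The remaining mass of at least
  \<open>n / 4\<close>, in portions of at most \<open>r\<close>, is spread over at least
  \<open>k\<close> functions.\<close>

lemma lap_eig_le_energy:
  fixes f :: "'c \<Rightarrow> nat \<Rightarrow> real"
  assumes G: "graph G" and k: "1 \<le> k" and fin: "finite \<C>"
    and disj: "\<And>c c' v. c \<in> \<C> \<Longrightarrow> c' \<in> \<C> \<Longrightarrow> c \<noteq> c' \<Longrightarrow> f c v = 0 \<or> f c' v = 0"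
    and small: "\<And>c. c \<in> \<C> \<Longrightarrow> (\<Sum>v\<in>verts G. (f c v)\<^sup>2) \<le> r" and r: "0 < r" "4 * real k * r \<le> real (card (verts G))"
    and mass: "real (card (verts G)) / 2 \<le> (\<Sum>c\<in>\<C>. \<Sum>v\<in>verts G. (f c v)\<^sup>2)"
    and energy: "(\<Sum>c\<in>\<C>. \<Sum>u\<in>verts G. \<Sum>v\<in>verts G. adj G u v * (f c u - f c v)\<^sup>2) \<le> \<E>"
    and kn: "k \<le> card (verts G)"
  shows "lap_eig G k \<le> 4 * \<E> / real (card (verts G))"
proof -
  define n where "n = real (card (verts G))"
  define ms where "ms c = (\<Sum>v\<in>verts G. (f c v)\<^sup>2)" for c
  define en where "en c = (\<Sum>u\<in>verts G. \<Sum>v\<in>verts G. adj G u v * (f c u - f c v)\<^sup>2)" for c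
  have n: "0 < n" using k kn by (simp add: n_def)
  have en0: "0 \<le> en c" for c unfolding en_def by (intro sum_nonneg mult_nonneg_nonneg adj_nonneg) auto
  have ms0: "0 \<le> ms c" for c unfolding ms_def by (intro sum_nonneg) auto
  have \<E>: "(\<Sum>c\<in>\<C>. en c) \<le> \<E>" using energy by (simp add: en_def)
  define bad where "bad = {c \<in> \<C>. 4 * \<E> / n * ms c < en c}"
  define good where "good = {c \<in> \<C>. \<not> 4 * \<E> / n * ms c < en c \<and> 0 < ms c}"
  have \<E>0: "0 \<le> \<E>" using sum_nonneg[of \<C> en] en0 \<E> by (meson order_trans)
  have badms: "(\<Sum>c\<in>bad. ms c) \<le> n / 4"
  proof (cases "\<E> = 0")
    \<comment> \<open>The general case divides by \<open>\<E>\<close>. With zero total energy, no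
      function exceeds the threshold.\<close>
    case True
    have "en c = 0" if "c \<in> \<C>" for c
    proof -
      have "en c \<le> (\<Sum>c\<in>\<C>. en c)" using that fin en0 by (intro member_le_sum) auto
      then show ?thesis using \<E> True en0[of c] by linarith
    qed
    then have "bad = {}" using True by (auto simp: bad_def)
    then show ?thesis using n by simp
  next
    case False
    then have \<E>1: "0 < \<E>" using \<E>0 by simp
    have "4 * \<E> / n * (\<Sum>c\<in>bad. ms c) = (\<Sum>c\<in>bad. 4 * \<E> / n * ms c)" by (simp add: sum_distrib_left)
    also have "\<dots> \<le> (\<Sum>c\<in>bad. en c)" by (intro sum_mono) (auto simp: bad_def)
    also have "\<dots> \<le> (\<Sum>c\<in>\<C>. en c)" using fin en0 by (intro sum_mono2) (auto simp: bad_def)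
    also have "\<dots> \<le> \<E>" by (rule \<E>)
    finally show ?thesis using \<E>1 n by (simp add: field_simps)
  qed
  have "n / 2 \<le> (\<Sum>c\<in>\<C>. ms c)" using mass by (simp add: n_def ms_def)
  also have "\<dots> \<le> (\<Sum>c\<in>bad \<union> good. ms c)"
  proof -
    have "c \<in> bad \<union> good \<or> ms c = 0" if "c \<in> \<C>" for c using that ms0[of c] by (auto simp: bad_def good_def)
    then have "\<forall>c\<in>\<C> - (bad \<union> good). ms c = 0" by blast
    moreover have "bad \<union> good \<subseteq> \<C>" by (auto simp: bad_def good_def)
    ultimately show ?thesis using sum.mono_neutral_right[OF fin, of "bad \<union> good" ms] by simp
  qed
  also have "\<dots> = (\<Sum>c\<in>bad. ms c) + (\<Sum>c\<in>good. ms c)"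
    using fin by (intro sum.union_disjoint) (auto simp: bad_def good_def)
  also have "(\<Sum>c\<in>good. ms c) \<le> (\<Sum>c\<in>good. r)" using small by (intro sum_mono) (auto simp: good_def ms_def)
  finally have "n / 4 \<le> real (card good) * r" using badms by simp
  moreover have "real k * r \<le> n / 4" using r by (simp add: n_def)
  ultimately have "real k * r \<le> real (card good) * r" by linarith
  then have "k \<le> card good" using r by simp
  moreover have fing: "finite good" using fin by (simp add: good_def)
  ultimately obtain T where T: "T \<subseteq> good" "card T = k" "finite T" using obtain_subset_with_card_n by blast
  obtain e where e: "bij_betw e {0..<k} T" using ex_bij_betw_nat_finite[OF T(3)] T(2) by blast
  have eT: "e i \<in> good" if "i < k" for i using e that T(1) by (auto simp: bij_betw_def)
  have einj: "e i \<noteq> e j" if "i < k" "j < k" "i \<noteq> j" for i j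
    using e that by (auto simp: bij_betw_def inj_on_def)
  have "lap_eig G k \<le> 4 * \<E> / n"
  proof (rule lap_eig_le[OF G k kn, of "\<lambda>i. f (e i)"])
    fix i j v assume ij: "i < k" "j < k" "i \<noteq> j"
    then show "f (e i) v = 0 \<or> f (e j) v = 0"
      using eT[OF ij(1)] eT[OF ij(2)] einj[OF ij] by (intro disj) (auto simp: good_def)
  next
    fix i assume "i < k"
    then have "e i \<in> good" by (rule eT)
    then show "0 < (\<Sum>v\<in>verts G. (f (e i) v)\<^sup>2)"
      "(\<Sum>u\<in>verts G. \<Sum>v\<in>verts G. adj G u v * (f (e i) u - f (e i) v)\<^sup>2) \<le> 4 * \<E> / n * (\<Sum>v\<in>verts G. (f (e i) v)\<^sup>2)"
      by (auto simp: good_def ms_def en_def)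
  qed
  then show ?thesis by (simp add: n_def)
qed

lemma sum_two_values:
  fixes F :: "'c \<Rightarrow> real"
  assumes "finite \<C>" "\<And>c. c \<in> \<C> \<Longrightarrow> c \<noteq> a \<Longrightarrow> c \<noteq> b \<Longrightarrow> F c = 0" "\<And>c. 0 \<le> F c"
  shows "(\<Sum>c\<in>\<C>. F c) \<le> (if a = b then F a else F a + F b)"
proof -
  have "(\<Sum>c\<in>\<C>. F c) = (\<Sum>c\<in>\<C> \<inter> {a, b}. F c)"
    using assms(1,2) by (intro sum.mono_neutral_right) auto
  also have "\<dots> \<le> (\<Sum>c\<in>{a, b}. F c)" using assms(3) by (intro sum_mono2) auto
  finally show ?thesis by auto
qed

text \<open>Adding \<open>\<epsilon>\<close> makes the weight positive without changing the order of its norm. Vertices of weight above \<open>\<gamma>\<close>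
  are few and lie outside the supports of the test functions.\<close>

lemma lap_eig_kmodel_free:
  fixes m :: nat
  defines "C \<equiv> (2 ^ (Suc m * Suc m))\<^sup>2 :: real"
  defines "K \<equiv> 4 * (m + 1)"
  defines "R \<equiv> 1 / ((real m + 2) * (30 * (real m + 1) + 1))"
  defines "\<gamma> \<equiv> R / (2 * real K)"
  defines "A \<equiv> 4 * (32768 * C)"
  assumes G: "graph G" and no: "\<not> (\<exists>B. kmodel (edge_rel G) (verts G) B (Suc m))"
    and k: "1 \<le> k" and kr: "real k * (4 * real r) \<le> real (card (verts G))"
    and rk: "real (card (verts G)) \<le> 8 * real k * real r"
    and r: "2 \<le> r" "4 * A / \<gamma>\<^sup>2 \<le> real r"
  shows "lap_eig G k \<le> 128 * A / \<gamma>\<^sup>2 * real (max_degree G) * real k / real (card (verts G))"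
proof -
  define V where "V = verts G"
  define E where "E = edge_rel G"
  define n where "n = real (card V)"
  define d where "d = real (max_degree G)"
  have fin: "finite V" using G by (simp add: graph_def V_def)
  have symE: "sym E" by (simp add: E_def sym_edge_rel)
  \<comment> \<open>The constants fit together as follows: \<open>K = 4 * (m + 1)\<close> keeps the
    fraction \<open>m / K\<close> of vertices with \<open>\<phi> < 1\<close> below 1/4,
    \<open>R\<close> makes the bound of \<open>chops_diameter\<close> equal to 1, and
    \<open>\<gamma>\<close> gives the layers the width \<open>R\<close>.\<close>
  have K: "0 < K" by (simp add: K_def)
  have R0: "0 < R" by (simp add: R_def)
  have \<gamma>: "0 < \<gamma>" using R0 K by (simp add: \<gamma>_def)
  have RK: "2 * \<gamma> * real K = R" using K by (simp add: \<gamma>_def)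
  have \<gamma>R: "\<gamma> \<le> R" using R0 by (simp add: \<gamma>_def K_def divide_le_eq)
  have A0: "0 < A" by (simp add: A_def C_def)
  have r0: "0 < real r" using r by simp
  have "1 * 1 \<le> real k * (4 * real r)" using k r0 r by (intro mult_mono) auto
  then have n0: "0 < n" using kr by (simp add: n_def V_def)
  have kn: "k \<le> card V"
  proof -
    have "real k * 1 \<le> real k * (4 * real r)" using r by (intro mult_left_mono) auto
    then show ?thesis using kr by (simp add: V_def)
  qed
  obtain \<omega> where \<omega>: "\<And>v. 0 \<le> \<omega> v" "(\<Sum>v\<in>V. (\<omega> v)\<^sup>2) \<le> 32768 * C * n / real r"
    and spread: "\<And>Q. Q \<subseteq> V \<Longrightarrow> conn E Q \<Longrightarrow> r \<le> card Q \<Longrightarrow>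
        (\<exists>x\<in>Q. \<exists>y\<in>Q. \<forall>P. P \<subseteq> V \<and> conn E P \<and> x \<in> P \<and> y \<in> P \<longrightarrow> (1 :: real) \<le> sum \<omega> P)"
    using spreading_weight[OF symE no[folded E_def V_def] fin r(1)] unfolding C_def n_def by blast
  define \<epsilon> where "\<epsilon> = sqrt (32768 * C / real r)"
  have C0: "0 < C" by (simp add: C_def)
  have \<epsilon>: "0 < \<epsilon>" "\<epsilon>\<^sup>2 = 32768 * C / real r" using r0 C0 by (simp_all add: \<epsilon>_def)
  define w where "w v = \<omega> v + \<epsilon>" for v
  have wpos: "0 < w v" for v using \<omega>(1)[of v] \<epsilon> by (simp add: w_def)
  have w2: "(\<Sum>v\<in>V. (w v)\<^sup>2) \<le> A * n / real r"
  proof -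
    have "(w v)\<^sup>2 \<le> 2 * (\<omega> v)\<^sup>2 + 2 * \<epsilon>\<^sup>2" for v
    proof -
      have "0 \<le> (\<omega> v - \<epsilon>)\<^sup>2" by simp
      then show ?thesis by (simp add: w_def power2_eq_square algebra_simps)
    qed
    then have "(\<Sum>v\<in>V. (w v)\<^sup>2) \<le> (\<Sum>v\<in>V. 2 * (\<omega> v)\<^sup>2 + 2 * \<epsilon>\<^sup>2)" by (intro sum_mono)
    also have "\<dots> = 2 * (\<Sum>v\<in>V. (\<omega> v)\<^sup>2) + 2 * (32768 * C * n / real r)"
      by (simp add: sum.distrib sum_distrib_left \<epsilon>(2) n_def)
    also have "\<dots> \<le> 4 * (32768 * C * n / real r)" using \<omega>(2) by simp
    finally show ?thesis by (simp add: A_def)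
  qed
  interpret weighted E w by unfold_locales (use symE wpos in auto)
  define V' where "V' = {v \<in> V. w v \<le> \<gamma>}"
  have V'V: "V' \<subseteq> V" by (auto simp: V'_def)
  have fin': "finite V'" using fin by (simp add: V'_def)
  \<comment> \<open>Chebyshev's inequality; the lower bound on \<open>r\<close> is what makes the
    right-hand side \<open>n / 4\<close>.\<close>
  have big: "real (card (V - V')) \<le> n / 4"
  proof -
    have "real (card (V - V')) * \<gamma>\<^sup>2 = (\<Sum>v\<in>V - V'. \<gamma>\<^sup>2)" by simp
    also have "\<dots> \<le> (\<Sum>v\<in>V - V'. (w v)\<^sup>2)" using \<gamma> by (intro sum_mono power_mono) (auto simp: V'_def)
    also have "\<dots> \<le> (\<Sum>v\<in>V. (w v)\<^sup>2)" using fin by (intro sum_mono2) auto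
    also have "\<dots> \<le> A * n / real r" by (rule w2)
    also have "\<dots> \<le> n / 4 * \<gamma>\<^sup>2"
    proof -
      have "4 * A \<le> real r * \<gamma>\<^sup>2" using r(2) \<gamma> by (simp add: pos_divide_le_eq)
      then have "4 * A * n \<le> real r * \<gamma>\<^sup>2 * n" using n0 by (intro mult_right_mono) auto
      then show ?thesis using r0 by (simp add: field_simps)
    qed
    finally show ?thesis using \<gamma> by simp
  qed
  have cV: "n = real (card V') + real (card (V - V'))"
    using card_Un_disjoint[of V' "V - V'"] fin fin' V'V by (simp add: n_def Un_absorb1 flip: of_nat_add)
  obtain \<phi> cl where cl: "\<forall>v\<in>V'. v \<in> cl v \<and> cl v \<subseteq> V' \<and> conn E (cl v) \<and> (\<forall>u\<in>cl v. cl u = cl v) \<and>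
        (\<exists>Q\<subseteq>V'. chops R m Q (cl v))"
     and \<phi>: "\<forall>v\<in>V'. 0 \<le> \<phi> v \<and> \<phi> v \<le> 1"
     and edge: "\<forall>u\<in>V'. \<forall>v\<in>V'. (u, v) \<in> E \<longrightarrow> (cl u = cl v \<longrightarrow> \<bar>\<phi> u - \<phi> v\<bar> * \<gamma> \<le> max (w u) (w v)) \<and>
        (cl u \<noteq> cl v \<longrightarrow> \<phi> u * \<gamma> \<le> max (w u) (w v) \<and> \<phi> v * \<gamma> \<le> max (w u) (w v))"
     and cnt: "real K * real (card {v \<in> V'. \<phi> v < 1}) \<le> real m * real (card V')"
    using padded_components[OF fin' \<gamma> K, of m] unfolding RK by blast
  \<comment> \<open>A piece with \<open>r\<close> vertices would contain two points at distance at
    least 1 by \<open>spread\<close>, and passing to \<open>V'\<close> and to the larger weight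
    \<open>w\<close> cannot shorten distances. \<open>chops_diameter\<close> forbids this.\<close>
  have small_cl: "card (cl v) < r" if v: "v \<in> V'" for v
  proof (rule ccontr)
    assume "\<not> card (cl v) < r"
    then obtain x y where xy: "x \<in> cl v" "y \<in> cl v"
      "\<And>P. P \<subseteq> V \<Longrightarrow> conn E P \<Longrightarrow> x \<in> P \<Longrightarrow> y \<in> P \<Longrightarrow> 1 \<le> sum \<omega> P"
      using spread[of "cl v"] cl v V'V by (metis not_less subset_trans)
    obtain Q where Q: "Q \<subseteq> V'" "chops R m Q (cl v)" using cl v by blast
    have f: "far V' 1 x y"
      unfolding far_def
    proof (intro allI impI, elim conjE)
      fix P assume P: "P \<subseteq> V'" "conn E P" "x \<in> P" "y \<in> P"
      have "1 \<le> sum \<omega> P" using P V'V by (intro xy(3)) auto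
      also have "\<dots> \<le> sum w P" using \<epsilon> by (intro sum_mono) (simp add: w_def)
      finally show "1 \<le> sum w P" .
    qed
    have eq: "(real m + 2) * (30 * (real m + 1) * R + R) = 1"
    proof -
      define X where "X = (real m + 2) * (30 * (real m + 1) + 1)"
      have "0 < X" by (simp add: X_def)
      then have "X * R = 1" unfolding R_def X_def[symmetric] by simp
      then show ?thesis by (simp add: X_def algebra_simps)
    qed
    have "\<not> far V' ((real m + 2) * (30 * (real m + 1) * R + R)) x y"
    proof (rule chops_diameter[OF fin' R0 Q(2,1)])
      show "w u \<le> R" if "u \<in> V'" for u using that \<gamma>R by (simp add: V'_def)
      have "Q \<subseteq> verts G" using Q(1) V'V by (simp add: V_def)
      then show "\<not> (\<exists>B. kmodel E Q B (Suc m))" using no kmodel_mono unfolding E_def by blast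
      show "conn E (cl v)" using cl v by blast
    qed (rule xy)+
    then show False using f unfolding eq by blast
  qed
  define \<C> where "\<C> = cl ` V'"
  define f where "f c v = (if v \<in> V' \<and> cl v = c then \<phi> v else 0)" for c v
  have finC: "finite \<C>" using fin' by (simp add: \<C>_def)
  have f01: "0 \<le> f c v" "f c v \<le> 1" for c v using \<phi> by (auto simp: f_def)
  have energy: "(\<Sum>c\<in>\<C>. \<Sum>u\<in>V. \<Sum>v\<in>V. adj G u v * (f c u - f c v)\<^sup>2) \<le> 4 * d * (A * n / real r) / \<gamma>\<^sup>2"
  proof -
    have pw: "(\<Sum>c\<in>\<C>. (f c u - f c v)\<^sup>2) \<le> 2 * ((w u)\<^sup>2 + (w v)\<^sup>2) / \<gamma>\<^sup>2"
      if uv: "u \<in> V" "v \<in> V" "(u, v) \<in> E" for u v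
    proof -
      define T where "T = ((w u)\<^sup>2 + (w v)\<^sup>2) / \<gamma>\<^sup>2"
      define M where "M = max (w u) (w v)"
      have M2: "M\<^sup>2 \<le> (w u)\<^sup>2 + (w v)\<^sup>2" by (simp add: M_def max_def)
      have sq: "x\<^sup>2 \<le> T" if "\<bar>x\<bar> * \<gamma> \<le> M" for x
      proof -
        have "(\<bar>x\<bar> * \<gamma>)\<^sup>2 \<le> M\<^sup>2" using that \<gamma> by (intro power_mono) auto
        then have "x\<^sup>2 * \<gamma>\<^sup>2 \<le> (w u)\<^sup>2 + (w v)\<^sup>2" using M2 by (simp add: power_mult_distrib)
        then show ?thesis using \<gamma> by (simp add: T_def pos_le_divide_eq)
      qed
      have nn: "0 \<le> T" by (simp add: T_def)
      have bd: "(\<Sum>c\<in>\<C>. (f c u - f c v)\<^sup>2) \<le> (if cl u = cl v then (f (cl u) u - f (cl u) v)\<^sup>2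
           else (f (cl u) u - f (cl u) v)\<^sup>2 + (f (cl v) u - f (cl v) v)\<^sup>2)"
        by (rule sum_two_values[OF finC]) (auto simp: f_def)
      consider "u \<in> V'" "v \<in> V'" "cl u = cl v" | "u \<in> V'" "v \<in> V'" "cl u \<noteq> cl v" | "u \<notin> V'" | "v \<notin> V'" by blast
      then have "(\<Sum>c\<in>\<C>. (f c u - f c v)\<^sup>2) \<le> T + T"
      proof cases
        case 1
        then have "(f (cl u) u - f (cl u) v)\<^sup>2 \<le> T"
          using edge uv(3) by (intro sq) (simp add: f_def M_def)
        then show ?thesis using bd 1 nn by simp
      next
        case 2
        then have "\<bar>\<phi> u\<bar> * \<gamma> \<le> M" "\<bar>\<phi> v\<bar> * \<gamma> \<le> M" using edge uv(3) \<phi> by (simp_all add: M_def)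
        from sq[OF this(1)] sq[OF this(2)] show ?thesis using bd 2 by (simp add: f_def)
      next
        \<comment> \<open>A vertex outside \<open>V'\<close> has weight above
          \<open>\<gamma>\<close>, which pays for the jump of a test function from a value of at
          most 1 down to 0.\<close>
        case 3
        then have "\<gamma> \<le> M" using uv by (simp add: V'_def M_def)
        have one: "\<bar>f c v\<bar> * \<gamma> \<le> M" for c
        proof -
          have "\<bar>f c v\<bar> * \<gamma> \<le> 1 * \<gamma>" using f01[of c v] \<gamma> by (intro mult_right_mono) auto
          then show ?thesis using \<open>\<gamma> \<le> M\<close> by simp
        qed
        have "(f (cl u) v)\<^sup>2 \<le> T" "(f (cl v) v)\<^sup>2 \<le> T"
          by (rule sq[OF one])+
        moreover have "f c u = 0" for c using 3 by (simp add: f_def)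
        ultimately show ?thesis using bd nn by (auto split: if_splits)
      next
        case 4
        then have "\<gamma> \<le> M" using uv by (simp add: V'_def M_def)
        have one: "\<bar>f c u\<bar> * \<gamma> \<le> M" for c
        proof -
          have "\<bar>f c u\<bar> * \<gamma> \<le> 1 * \<gamma>" using f01[of c u] \<gamma> by (intro mult_right_mono) auto
          then show ?thesis using \<open>\<gamma> \<le> M\<close> by simp
        qed
        have "(f (cl u) u)\<^sup>2 \<le> T" "(f (cl v) u)\<^sup>2 \<le> T"
          by (rule sq[OF one])+
        moreover have "f c v = 0" for c using 4 by (simp add: f_def)
        ultimately show ?thesis using bd nn by (auto split: if_splits)
      qed
      then show ?thesis by (simp add: T_def field_simps)
    qed
    have "(\<Sum>c\<in>\<C>. \<Sum>u\<in>V. \<Sum>v\<in>V. adj G u v * (f c u - f c v)\<^sup>2) = (\<Sum>u\<in>V. \<Sum>c\<in>\<C>. \<Sum>v\<in>V. adj G u v * (f c u - f c v)\<^sup>2)"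
      by (rule sum.swap)
    also have "\<dots> = (\<Sum>u\<in>V. \<Sum>v\<in>V. \<Sum>c\<in>\<C>. adj G u v * (f c u - f c v)\<^sup>2)"
      by (intro sum.cong refl sum.swap)
    also have "\<dots> = (\<Sum>u\<in>V. \<Sum>v\<in>V. adj G u v * (\<Sum>c\<in>\<C>. (f c u - f c v)\<^sup>2))"
      by (simp add: sum_distrib_left)
    also have "\<dots> \<le> (\<Sum>u\<in>V. \<Sum>v\<in>V. adj G u v * (2 * ((w u)\<^sup>2 + (w v)\<^sup>2) / \<gamma>\<^sup>2))"
    proof (intro sum_mono)
      fix u v assume uv: "u \<in> V" "v \<in> V"
      show "adj G u v * (\<Sum>c\<in>\<C>. (f c u - f c v)\<^sup>2) \<le> adj G u v * (2 * ((w u)\<^sup>2 + (w v)\<^sup>2) / \<gamma>\<^sup>2)"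
      proof (cases "{u, v} \<in> edges G")
        case True
        then show ?thesis using pw[OF uv] by (simp add: adj_def E_def edge_rel_def)
      next
        case False
        then show ?thesis by (simp add: adj_def)
      qed
    qed
    also have "\<dots> = 2 / \<gamma>\<^sup>2 * ((\<Sum>u\<in>V. \<Sum>v\<in>V. adj G u v * (w u)\<^sup>2) + (\<Sum>u\<in>V. \<Sum>v\<in>V. adj G u v * (w v)\<^sup>2))"
    proof -
      have "(\<Sum>u\<in>V. \<Sum>v\<in>V. adj G u v * (2 * ((w u)\<^sup>2 + (w v)\<^sup>2) / \<gamma>\<^sup>2)) =
          (\<Sum>u\<in>V. \<Sum>v\<in>V. 2 / \<gamma>\<^sup>2 * (adj G u v * (w u)\<^sup>2 + adj G u v * (w v)\<^sup>2))"
        by (intro sum.cong refl) (simp add: field_simps)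
      then show ?thesis by (simp only: sum_distrib_left[symmetric] sum.distrib)
    qed
    also have "(\<Sum>u\<in>V. \<Sum>v\<in>V. adj G u v * (w v)\<^sup>2) = (\<Sum>u\<in>V. \<Sum>v\<in>V. adj G u v * (w u)\<^sup>2)"
      by (subst sum.swap) (simp add: adj_sym)
    also have "(\<Sum>u\<in>V. \<Sum>v\<in>V. adj G u v * (w u)\<^sup>2) = (\<Sum>u\<in>V. real (degree G u) * (w u)\<^sup>2)"
      by (intro sum.cong refl) (simp add: degree_adj[OF G] V_def sum_distrib_right)
    finally have "(\<Sum>c\<in>\<C>. \<Sum>u\<in>V. \<Sum>v\<in>V. adj G u v * (f c u - f c v)\<^sup>2)
        \<le> 4 / \<gamma>\<^sup>2 * (\<Sum>u\<in>V. real (degree G u) * (w u)\<^sup>2)" by simp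
    also have "\<dots> \<le> 4 / \<gamma>\<^sup>2 * (\<Sum>u\<in>V. d * (w u)\<^sup>2)"
      using degree_le_max_degree[OF G] by (intro mult_left_mono sum_mono mult_right_mono) (auto simp: d_def V_def)
    also have "\<dots> = 4 / \<gamma>\<^sup>2 * (d * (\<Sum>u\<in>V. (w u)\<^sup>2))" by (simp add: sum_distrib_left)
    also have "\<dots> \<le> 4 / \<gamma>\<^sup>2 * (d * (A * n / real r))"
      using w2 by (intro mult_left_mono) (auto simp: d_def)
    finally show ?thesis by (simp add: mult_ac)
  qed
  have mass_c: "(\<Sum>v\<in>V. (f c v)\<^sup>2) \<le> real r" if c: "c \<in> \<C>" for c
  proof -
    obtain t where t: "t \<in> V'" "c = cl t" using c by (auto simp: \<C>_def)
    have finc: "finite c" using cl t fin' finite_subset by blast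
    have cV: "c \<subseteq> V" using cl t V'V by blast
    have "(\<Sum>v\<in>V. (f c v)\<^sup>2) \<le> (\<Sum>v\<in>V. if v \<in> c then 1 else 0)"
    proof (rule sum_mono)
      fix v assume "v \<in> V"
      have "v \<in> c" if "v \<in> V'" "cl v = c" using cl that by blast
      moreover have "(f c v)\<^sup>2 \<le> 1" using f01[of c v] by (simp add: power_le_one)
      ultimately show "(f c v)\<^sup>2 \<le> (if v \<in> c then 1 else 0)" by (auto simp: f_def)
    qed
    also have "\<dots> = real (card (V \<inter> c))" using fin by (simp add: sum.If_cases)
    also have "V \<inter> c = c" using cV by blast
    finally show ?thesis using small_cl[OF t(1)] t(2) by simp
  qed
  \<comment> \<open>At most a quarter of \<open>V\<close> is lost outside \<open>V'\<close>, and at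
    most a quarter of \<open>V'\<close> to \<open>\<phi> < 1\<close>; the fraction 9/16 that is left
    exceeds 1/2.\<close>
  have mass: "n / 2 \<le> (\<Sum>c\<in>\<C>. \<Sum>v\<in>V. (f c v)\<^sup>2)"
  proof -
    have "real K * real (card {v \<in> V'. \<phi> v < 1}) \<le> real K * (real (card V') / 4)"
    proof -
      have "real m * real (card V') \<le> real K * (real (card V') / 4)" by (simp add: K_def algebra_simps)
      then show ?thesis using cnt by linarith
    qed
    then have "real (card {v \<in> V'. \<phi> v < 1}) \<le> real (card V') / 4" using K by simp
    moreover have "card V' = card {v \<in> V'. \<phi> v < 1} + card {v \<in> V'. \<not> \<phi> v < 1}"
      using fin' by (subst card_Un_disjoint[symmetric]) (auto intro: arg_cong[of _ _ card])
    ultimately have "3 / 4 * real (card V') \<le> real (card {v \<in> V'. \<not> \<phi> v < 1})" by simp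
    moreover have "n / 2 \<le> 3 / 4 * real (card V')" using big cV n0 by linarith
    ultimately have "n / 2 \<le> real (card {v \<in> V'. \<not> \<phi> v < 1})" by linarith
    also have "\<dots> = (\<Sum>v\<in>V'. if \<not> \<phi> v < 1 then 1 else 0)" using fin' by (simp add: sum.If_cases Int_def)
    also have "\<dots> \<le> (\<Sum>v\<in>V'. \<Sum>c\<in>\<C>. (f c v)\<^sup>2)"
    proof (rule sum_mono)
      fix v assume v: "v \<in> V'"
      show "(if \<not> \<phi> v < 1 then 1 else 0) \<le> (\<Sum>c\<in>\<C>. (f c v)\<^sup>2)"
      proof (cases "\<phi> v < 1")
        case True
        then show ?thesis by (simp add: sum_nonneg)
      next
        case False
        then have "\<phi> v = 1" using \<phi> v by force
        then have "1 = (f (cl v) v)\<^sup>2" using v by (simp add: f_def)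
        also have "\<dots> \<le> (\<Sum>c\<in>\<C>. (f c v)\<^sup>2)" using v finC by (intro member_le_sum[of "cl v" \<C> "\<lambda>c. (f c v)\<^sup>2"]) (auto simp: \<C>_def)
        finally show ?thesis using False by simp
      qed
    qed
    also have "\<dots> \<le> (\<Sum>v\<in>V. \<Sum>c\<in>\<C>. (f c v)\<^sup>2)" using fin V'V by (intro sum_mono2) (auto simp: sum_nonneg)
    also have "\<dots> = (\<Sum>c\<in>\<C>. \<Sum>v\<in>V. (f c v)\<^sup>2)" by (rule sum.swap)
    finally show ?thesis .
  qed
  have "lap_eig G k \<le> 4 * (4 * d * (A * n / real r) / \<gamma>\<^sup>2) / real (card (verts G))"
  proof (rule lap_eig_le_energy[OF G k finC, of f "real r"])
    show "f c v = 0 \<or> f c' v = 0" if "c \<noteq> c'" for c c' v using that by (auto simp: f_def)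
  qed (use mass_c mass energy r0 kr kn in \<open>auto simp: V_def n_def mult_ac\<close>)
  also have "\<dots> = 16 * d * A / \<gamma>\<^sup>2 * (1 / real r)"
    using n0 by (simp add: n_def V_def mult_ac)
  \<comment> \<open>Here \<open>1 / r\<close> is replaced by \<open>8 * k / n\<close>, and
    \<open>16 * 8 = 128\<close> is the constant in the conclusion.\<close>
  also have "\<dots> \<le> 16 * d * A / \<gamma>\<^sup>2 * (8 * real k / n)"
  proof (rule mult_left_mono)
    show "1 / real r \<le> 8 * real k / n" using rk r0 n0 by (simp add: n_def V_def field_simps)
    show "0 \<le> 16 * d * A / \<gamma>\<^sup>2" using A0 by (simp add: d_def)
  qed
  finally show ?thesis by (simp add: d_def n_def V_def mult_ac)
qed

theorem theorem1p2:
  fixes F :: "graph set"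
  assumes "\<forall>G\<in>F. graph G"
    and "minor_closed F"
    and "\<exists>G. graph G \<and> G \<notin> F"
  shows "\<exists>c>0. \<forall>G\<in>F. \<forall>k. 1 \<le> k \<and> k \<le> card (verts G) \<longrightarrow>
           lap_eig G k \<le> c * real (max_degree G) * real k / real (card (verts G))"
proof -
  obtain H where H: "graph H" "H \<notin> F" using assms(3) by blast
  define m where "m = card (verts H) - 1"
  have no: "\<not> (\<exists>B. kmodel (edge_rel G) (verts G) B (Suc m))" if "G \<in> F" for G
  proof -
    have n: "\<not> (\<exists>B. kmodel (edge_rel G) (verts G) B (card (verts H)))"
      by (rule minor_closed_no_kmodel[OF assms(1,2) H that])
    \<comment> \<open>For size 0 the empty model always exists, so the order of \<open>H\<close> is
      positive and equals \<open>Suc m\<close>.\<close>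
    then have "card (verts H) \<noteq> 0" by (auto simp: kmodel_def)
    then show ?thesis using n by (simp add: m_def)
  qed
  define C where "C = ((2 ^ (Suc m * Suc m))\<^sup>2 :: real)"
  define K where "K = 4 * (m + 1)"
  define R where "R = 1 / ((real m + 2) * (30 * (real m + 1) + 1))"
  define \<gamma> where "\<gamma> = R / (2 * real K)"
  define A where "A = 4 * (32768 * C)"
  \<comment> \<open>The summand 2 guarantees \<open>r >= 2\<close>, as required for a set of
    \<open>r\<close> vertices to contain a pair.\<close>
  define r0 where "r0 = nat \<lceil>4 * A / \<gamma>\<^sup>2\<rceil> + 2"
  have A0: "0 < A" by (simp add: A_def C_def)
  have \<gamma>: "0 < \<gamma>" by (simp add: \<gamma>_def R_def K_def)
  define c where "c = 8 * real r0 + 128 * A / \<gamma>\<^sup>2"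
  have "0 < 128 * A / \<gamma>\<^sup>2" using A0 \<gamma> by simp
  then have c1: "8 * real r0 \<le> c" "128 * A / \<gamma>\<^sup>2 \<le> c" "0 < c" by (simp_all add: c_def add_nonneg_pos)
  have "lap_eig G k \<le> c * real (max_degree G) * real k / real (card (verts G))"
    if G: "G \<in> F" and k: "1 \<le> k" "k \<le> card (verts G)" for G k
  proof -
    define n where "n = card (verts G)"
    have gG: "graph G" using assms(1) G by blast
    have n0: "0 < real n" using k by (simp add: n_def)
    have scale: "a * real (max_degree G) * real k / real n \<le> c * real (max_degree G) * real k / real n" if "a \<le> c" for a
      using that n0 by (intro divide_right_mono mult_right_mono) auto
    show ?thesis
    proof (cases "4 * k * r0 \<le> n")
      case True
      define r where "r = n div (4 * k)"
      have "r0 \<le> r" unfolding r_def using True k by (simp add: less_eq_div_iff_mult_less_eq mult_ac)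
      then have r: "2 \<le> r" "4 * A / \<gamma>\<^sup>2 \<le> real r" unfolding r0_def by linarith+
      have "4 * k * r \<le> n" unfolding r_def by (rule times_div_less_eq_dividend)
      then have "real (4 * k * r) \<le> real n" by (rule of_nat_mono)
      then have kr: "real k * (4 * real r) \<le> real (card (verts G))" by (simp add: n_def mult_ac)
      \<comment> \<open>As \<open>r\<close> is at least 1, rounding \<open>n / (4 * k)\<close> down
        loses at most a factor 2, which turns 4 into the 8 of \<open>rk\<close>.\<close>
      have n1: "n < 4 * k * r + 4 * k"
        unfolding r_def using k dividend_less_times_div[of "4 * k" n] by simp
      have "4 * k \<le> 4 * k * r" using r by simp
      with n1 have "n \<le> 8 * k * r" by linarith
      then have "real n \<le> real (8 * k * r)" by (rule of_nat_mono)
      then have rk: "real (card (verts G)) \<le> 8 * real k * real r" by (simp add: n_def)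
      have "lap_eig G k \<le> 128 * A / \<gamma>\<^sup>2 * real (max_degree G) * real k / real (card (verts G))"
        unfolding A_def \<gamma>_def R_def K_def C_def
        by (rule lap_eig_kmodel_free[OF gG no[OF G] k(1) kr rk r(1) r(2)[unfolded A_def \<gamma>_def R_def K_def C_def]])
      then show ?thesis using scale[OF c1(2)] by (simp add: n_def)
    next
      \<comment> \<open>Now \<open>n < 4 * k * r0\<close>, so inflating
        \<open>2 * max_degree G\<close> by the factor \<open>4 * k * r0 / n\<close> is harmless;
        this is the source of the summand \<open>8 * r0\<close> in \<open>c\<close>.\<close>
      case False
      then have "real n \<le> real (4 * k * r0)" by (intro of_nat_mono) simp
      then have "1 \<le> 4 * real k * real r0 / real n" using n0 by simp
      then have "2 * real (max_degree G) * 1 \<le> 2 * real (max_degree G) * (4 * real k * real r0 / real n)"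
        by (intro mult_left_mono) auto
      then have "2 * real (max_degree G) \<le> 8 * real r0 * real (max_degree G) * real k / real n" by (simp add: mult_ac)
      then show ?thesis using lap_eig_le_max_degree[OF gG k] scale[OF c1(1)] by (simp add: n_def)
    qed
  qed
  then show ?thesis using c1(3) by blast
qed

end
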